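(* Let $\mathbb{K}_0$ be a proper sub-division ring of the division ring $\mathbb{K}$, and let $\Gamma(\mathbb{K})$ be one of $\mathrm{Gr}_{1,n}(A_n(\mathbb{K}))$ ($n\ge 3$), $\mathrm{Gr}_{1,-}(D_n(\mathbb{K}))$ ($n\ge4$), $\mathrm{Gr}_{1,+,-}(D_n(\mathbb{K}))$ ($n\ge4$) or $\mathrm{Gr}_{+,-}(D_n(\mathbb{K}))$ ($n\ge3$), with $\mathbb{K}$ a field in the $D_n$ cases. Then the set $\Omega_{\mathbb{K}_0}(\Gamma(\mathbb{K}))$ of nearly $\mathbb{K}_0$-rational points of $\Gamma(\mathbb{K})$ is a proper subspace of $\Gamma(\mathbb{K})$.
   Context: Building $A_n(\mathbb{K})$ ($X_n=A_n$): elements are the subspaces of dimension $1,\dots,n$ of an $(n+1)$-dimensional right $\mathbb{K}$-vector space $V$ with fixed basis $E$ (type = dimension), incidence is symmetrized inclusion; diagram: path $1-\cdots-n$. Building $D_n(\mathbb{K})$ ($X_n=D_n$): $V$ is $2n$-dimensional over the field $\mathbb{K}$ with basis $E=(e_1,\dots,e_{2n})$ and quadratic form $q=x_1x_2+\dots+x_{2n-1}x_{2n}$; the $n$-dimensional totally singular subspaces split into classes $\mathfrak S^{+},\mathfrak S^-$ ($X,Y$ in the same class iff $X\cap Y$ has even codimension in $X$). Elements: totally singular subspaces of dimension $i\in\{1,\dots,n-2\}$ (type $i$) and members of $\mathfrak S^\pm$ (type $\pm$); incidence is symmetrized inclusion except $X\in\mathfrak S^+$, $Y\in\mathfrak S^-$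 incident iff $\dim(X\cap Y)=n-1$. Diagram: path $1-\cdots-(n-2)$ with $n-2$ adjacent to $+$ and $-$. A flag is a set of pairwise incident elements. $\mathrm{Gr}_J$ has as points the flags of type $J$ and as lines the flags of type $(J\setminus\{j\})\cup\mathrm{fr}(j)$ ($\mathrm{fr}(j)$ = diagram neighbours of $j$), incidence meaning the union is a flag. A vector is $\mathbb{K}_0$-rational if it is a $\mathbb{K}_0$-combination of $E$; a subspace/element is $\mathbb{K}_0$-rational if it has a basis of $\mathbb{K}_0$-rational vectors. A node $t$ of the diagram splits $J$ if $t\notin J$ and $J$ is not contained in a single connected component of the diagram with $t$ removed. A point $F$ ($J$-flag) of $\Gamma(\mathbb{K})=\mathrm{Gr}_J(X_n(\mathbb{K}))$ is nearly $\mathbb{K}_0$-rational if at least one element of $F$ is $\mathbb{K}_0$-rational, or there is a $\mathbb{K}_0$-rational element of $X_n(\mathbb{K})$ incident with all elements of $F$ whose type splits $J$. A subspace of a point-line geometry is a set of points containing all points of every line meeting it in at least two points; it is proper if it is not the whole point set. *)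

theory Defs
  imports Complex_Main
begin

section \<open>Right vector spaces over a division ring\<close>

text \<open>
  The standard right vector space of dimension \<open>N\<close> is modelled by coordinate vectors
  indexed by \<open>1, ..., N\<close> and vanishing elsewhere, and the fixed basis \<open>E\<close> by the unit vectors.
  The library's vector spaces require a commutative field of scalars, so span, basis and
  dimension are defined here; scalars multiply from the right.
\<close>

definition sub_division_ring :: "'k::division_ring set \<Rightarrow> bool" where
  "sub_division_ring K0 \<longleftrightarrow>
     1 \<in> K0 \<and> (\<forall>x\<in>K0. \<forall>y\<in>K0. x - y \<in> K0 \<and> x * y \<in> K0) \<and> (\<forall>x\<in>K0. inverse x \<in> K0)"

type_synonym 'k vec = "nat \<Rightarrow> 'k"

definition vecs :: "nat \<Rightarrow> 'k::division_ring vec set" where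
  "vecs N = {v. \<forall>i. i \<notin> {1..N} \<longrightarrow> v i = 0}"

definition unit_vec :: "nat \<Rightarrow> 'k::division_ring vec" where
  "unit_vec j = (\<lambda>i. if i = j then 1 else 0)"

definition std_basis :: "nat \<Rightarrow> 'k::division_ring vec set" where
  "std_basis N = unit_vec ` {1..N}"

definition lincomb :: "'k::division_ring vec set \<Rightarrow> ('k vec \<Rightarrow> 'k) \<Rightarrow> 'k vec" where
  "lincomb B c = (\<lambda>i. \<Sum>b\<in>B. b i * c b)"

text \<open>Combinations of a finite set \<open>B\<close> with coefficients in \<open>C\<close>; only used for finite \<open>B\<close>.\<close>

definition combs :: "'k::division_ring set \<Rightarrow> 'k vec set \<Rightarrow> 'k vec set" where
  "combs C B = {lincomb B c | c. \<forall>b\<in>B. c b \<in> C}"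

definition is_subspace :: "nat \<Rightarrow> 'k::division_ring vec set \<Rightarrow> bool" where
  "is_subspace N U \<longleftrightarrow>
     U \<subseteq> vecs N \<and> (\<lambda>i. 0) \<in> U \<and>
     (\<forall>u\<in>U. \<forall>v\<in>U. (\<lambda>i. u i + v i) \<in> U) \<and> (\<forall>u\<in>U. \<forall>a. (\<lambda>i. u i * a) \<in> U)"

definition is_basis :: "'k::division_ring vec set \<Rightarrow> 'k vec set \<Rightarrow> bool" where
  "is_basis B U \<longleftrightarrow>
     finite B \<and> combs UNIV B = U \<and> (\<forall>c. lincomb B c = (\<lambda>i. 0) \<longrightarrow> (\<forall>b\<in>B. c b = 0))"

definition vdim :: "'k::division_ring vec set \<Rightarrow> nat" where
  "vdim U = card (SOME B. is_basis B U)"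

definition rational_vec :: "'k::division_ring set \<Rightarrow> nat \<Rightarrow> 'k vec \<Rightarrow> bool" where
  "rational_vec K0 N v \<longleftrightarrow> v \<in> combs K0 (std_basis N)"

definition rational_subspace :: "'k::division_ring set \<Rightarrow> nat \<Rightarrow> 'k vec set \<Rightarrow> bool" where
  "rational_subspace K0 N U \<longleftrightarrow> (\<exists>B. is_basis B U \<and> (\<forall>b\<in>B. rational_vec K0 N b))"


section \<open>Typed incidence geometries and their Grassmannians\<close>

record ('e, 't) geometry =
  elems :: "'e set"
  etype :: "'e \<Rightarrow> 't"
  inc :: "'e \<Rightarrow> 'e \<Rightarrow> bool"
  nodes :: "'t set"
  adj :: "'t \<Rightarrow> 't \<Rightarrow> bool"

definition is_flag :: "('e, 't) geometry \<Rightarrow> 'e set \<Rightarrow> bool" where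
  "is_flag X F \<longleftrightarrow> F \<subseteq> elems X \<and> pairwise (inc X) F"

definition flags_of_type :: "('e, 't) geometry \<Rightarrow> 't set \<Rightarrow> 'e set set" where
  "flags_of_type X J = {F. is_flag X F \<and> etype X ` F = J}"

definition fr :: "('e, 't) geometry \<Rightarrow> 't \<Rightarrow> 't set" where
  "fr X j = {t \<in> nodes X. adj X j t}"

definition gr_points :: "('e, 't) geometry \<Rightarrow> 't set \<Rightarrow> 'e set set" where
  "gr_points X J = flags_of_type X J"

definition gr_lines :: "('e, 't) geometry \<Rightarrow> 't set \<Rightarrow> 'e set set" where
  "gr_lines X J = (\<Union>j\<in>J. flags_of_type X ((J - {j}) \<union> fr X j))"

definition points_on :: "('e, 't) geometry \<Rightarrow> 't set \<Rightarrow> 'e set \<Rightarrow> 'e set set" where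
  "points_on X J L = {P \<in> gr_points X J. is_flag X (P \<union> L)}"

definition gr_subspace :: "('e, 't) geometry \<Rightarrow> 't set \<Rightarrow> 'e set set \<Rightarrow> bool" where
  "gr_subspace X J S \<longleftrightarrow>
     S \<subseteq> gr_points X J \<and>
     (\<forall>L\<in>gr_lines X J.
        (\<exists>P\<in>S \<inter> points_on X J L. \<exists>Q\<in>S \<inter> points_on X J L. P \<noteq> Q) \<longrightarrow> points_on X J L \<subseteq> S)"

definition proper_gr_subspace :: "('e, 't) geometry \<Rightarrow> 't set \<Rightarrow> 'e set set \<Rightarrow> bool" where
  "proper_gr_subspace X J S \<longleftrightarrow> gr_subspace X J S \<and> S \<noteq> gr_points X J"

definition components_without :: "('e, 't) geometry \<Rightarrow> 't \<Rightarrow> 't set set" where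
  "components_without X t =
     (let M = nodes X - {t}; R = {(a, b). a \<in> M \<and> b \<in> M \<and> adj X a b}
      in {{b. (a, b) \<in> R\<^sup>*} | a. a \<in> M})"

definition splits :: "('e, 't) geometry \<Rightarrow> 't \<Rightarrow> 't set \<Rightarrow> bool" where
  "splits X t J \<longleftrightarrow>
     t \<in> nodes X \<and> t \<notin> J \<and> \<not> (\<exists>C\<in>components_without X t. J \<subseteq> C)"

text \<open>The predicate \<open>rat\<close> singles out the rational elements of the geometry.\<close>

definition nearly_rational_points ::
    "('e, 't) geometry \<Rightarrow> ('e \<Rightarrow> bool) \<Rightarrow> 't set \<Rightarrow> 'e set set" where
  "nearly_rational_points X rat J =
     {F \<in> gr_points X J.
        (\<exists>x\<in>F. rat x) \<or>
        (\<exists>y\<in>elems X. rat y \<and> splits X (etype X y) J \<and> (\<forall>x\<in>F. inc X y x))}"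


section \<open>The buildings of type A and D\<close>

definition A_building :: "nat \<Rightarrow> ('k::division_ring vec set, nat) geometry" where
  "A_building n =
     \<lparr> elems = {U. is_subspace (n + 1) U \<and> vdim U \<in> {1..n}},
       etype = vdim,
       inc = (\<lambda>X Y. X \<subseteq> Y \<or> Y \<subseteq> X),
       nodes = {1..n},
       adj = (\<lambda>i j. j = i + 1 \<or> i = j + 1) \<rparr>"

datatype D_type = TDim nat | TPlus | TMinus

definition quad :: "nat \<Rightarrow> 'k::division_ring vec \<Rightarrow> 'k" where
  "quad n x = (\<Sum>i=1..n. x (2 * i - 1) * x (2 * i))"

definition tot_singular :: "nat \<Rightarrow> 'k::division_ring vec set \<Rightarrow> bool" where
  "tot_singular n U \<longleftrightarrow> is_subspace (2 * n) U \<and> (\<forall>u\<in>U. quad n u = 0)"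

definition max_singular :: "nat \<Rightarrow> 'k::division_ring vec set set" where
  "max_singular n = {U. tot_singular n U \<and> vdim U = n}"

text \<open>
  \<open>Sp\<close> and \<open>Sm\<close> are the two classes of maximal totally singular subspaces. Which class is
  called \<open>+\<close> is arbitrary, so both labellings satisfy this predicate.
\<close>

definition singular_classes ::
    "nat \<Rightarrow> 'k::division_ring vec set set \<Rightarrow> 'k vec set set \<Rightarrow> bool" where
  "singular_classes n Sp Sm \<longleftrightarrow>
     Sp \<union> Sm = max_singular n \<and> Sp \<inter> Sm = {} \<and>
     (\<forall>X\<in>max_singular n. \<forall>Y\<in>max_singular n.
        (X \<in> Sp \<longleftrightarrow> Y \<in> Sp) \<longleftrightarrow> even (vdim X - vdim (X \<inter> Y)))"

definition D_building ::
    "nat \<Rightarrow> 'k::division_ring vec set set \<Rightarrow> 'k vec set set \<Rightarrow> ('k vec set, D_type) geometry" where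
  "D_building n Sp Sm =
     \<lparr> elems = {U. tot_singular n U \<and> vdim U \<in> {1..n - 2}} \<union> Sp \<union> Sm,
       etype = (\<lambda>U. if U \<in> Sp then TPlus else if U \<in> Sm then TMinus else TDim (vdim U)),
       inc = (\<lambda>X Y. if X \<in> Sp \<and> Y \<in> Sm \<or> X \<in> Sm \<and> Y \<in> Sp
                     then vdim (X \<inter> Y) = n - 1 else X \<subseteq> Y \<or> Y \<subseteq> X),
       nodes = TDim ` {1..n - 2} \<union> {TPlus, TMinus},
       adj = (\<lambda>s t. case (s, t) of
                 (TDim i, TDim j) \<Rightarrow> j = i + 1 \<or> i = j + 1
               | (TDim i, _) \<Rightarrow> i = n - 2
               | (_, TDim j) \<Rightarrow> j = n - 2
               | _ \<Rightarrow> False) \<rparr>"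

definition Omega_A :: "'k::division_ring set \<Rightarrow> nat \<Rightarrow> nat set \<Rightarrow> 'k vec set set set" where
  "Omega_A K0 n J = nearly_rational_points (A_building n) (rational_subspace K0 (n + 1)) J"

definition Omega_D ::
    "'k::division_ring set \<Rightarrow> nat \<Rightarrow> 'k vec set set \<Rightarrow> 'k vec set set \<Rightarrow> D_type set \<Rightarrow>
     'k vec set set set" where
  "Omega_D K0 n Sp Sm J =
     nearly_rational_points (D_building n Sp Sm) (rational_subspace K0 (2 * n)) J"

end

theory Submission
  imports Defs "HOL-Library.Function_Algebras"
begin

text \<open>
  A point is nearly rational essentially when some rational subspace fits between its smallest and its
  largest element. On a line on which only the smallest element varies, two such rational subspaces
  are joined; when only the largest element varies, they are intersected. The intersection of two
  rational subspaces is rational because a vector \<open>x\<close> can be written as \<open>\<Sum>l\<in>L. r l \<star> l\<close> with \<open>L\<close>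
  left independent over \<open>K0\<close> and rational \<open>r l\<close>, and then the \<open>r l\<close> lie in every rational subspace
  containing \<open>x\<close>. In type D one also needs that a maximal totally singular subspace is rational once
  it contains a rational subspace of codimension one. For properness, coordinates are twisted by an
  element of the division ring outside \<open>K0\<close>.
\<close>

section \<open>Linear algebra over a division ring\<close>

text \<open>The obstacle is dimension: a join or an intersection found on a line need not have the
  dimension of a splitting element. For flags containing a point, this is harmless. At the extreme
  dimensions a member of the flag itself becomes rational, and in type D the dimension
  \<open>n - 1\<close>, which is not a type, is pushed up to a maximal subspace. For
  \<open>{TPlus, TMinus}\<close> only dimension \<open>n - 2\<close> splits and an intersection may
  be too small, so those lines need the case analysis of \<open>rational_pencil\<close>. In type D
  an intersection stays inside the third point of the line for a reason of parity: two distinct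
  maximal subspaces of one class through a common subspace of dimension \<open>n - 2\<close> have
  nothing else in common. The division ring may be infinite-dimensional over \<open>K0\<close> and
  noncommutative, so only finitely many scalars are expanded at a time. A left independent set can
  always be enlarged, and this is what makes expansions of one vector in different rational
  subspaces comparable. In the singular witness the hyperbolic pairs (1,2) and (3,4) are twisted
  together, so that the two terms containing \<open>a\<close> cancel in the quadratic form.\<close>

definition scl :: "'k::division_ring vec \<Rightarrow> 'k \<Rightarrow> 'k vec" (infixl \<open>\<star>\<close> 75) where
  "v \<star> a = (\<lambda>i. v i * a)"

text \<open>Closure without a bound on the coordinates, so that arbitrary intersections stay closed
  and \<open>hull\<close> provides spans; \<open>is_subspace N\<close> adds containment in
  \<open>vecs N\<close>.\<close>

definition lsub :: "'k::division_ring vec set \<Rightarrow> bool" where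
  "lsub U \<longleftrightarrow> 0 \<in> U \<and> (\<forall>u\<in>U. \<forall>v\<in>U. u + v \<in> U) \<and> (\<forall>u\<in>U. \<forall>a. u \<star> a \<in> U)"

abbreviation lspan :: "'k::division_ring vec set \<Rightarrow> 'k vec set" where
  "lspan S \<equiv> lsub hull S"

text \<open>Stated through the closure operator because this is the form in which the exchange
  property acts; \<open>indep_iff_lincomb\<close> links it to vanishing combinations.\<close>

definition indep :: "'k::division_ring vec set \<Rightarrow> bool" where
  "indep B \<longleftrightarrow> (\<forall>b\<in>B. b \<notin> lspan (B - {b}))"

lemma scl_apply [simp]: "(v \<star> a) i = v i * a"
  by (simp add: scl_def)

lemma scl_simps [simp]:
  "v \<star> 0 = 0" "v \<star> 1 = v" "0 \<star> a = 0" "v \<star> a \<star> b = v \<star> (a * b)"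
  by (auto simp: fun_eq_iff mult.assoc)

lemma scl_add: "(u + v) \<star> a = u \<star> a + v \<star> a" "v \<star> (a + b) = v \<star> a + v \<star> b"
  by (auto simp: fun_eq_iff algebra_simps)

lemma sum_fun_apply: "(\<Sum>b\<in>B. f b) i = (\<Sum>b\<in>B. f b i)" for f :: "'a \<Rightarrow> 'i \<Rightarrow> 'b::comm_monoid_add"
  by (induction B rule: infinite_finite_induct) auto

lemma scl_sum: "(\<Sum>b\<in>B. f b) \<star> a = (\<Sum>b\<in>B. f b \<star> a)" "v \<star> (\<Sum>b\<in>B. g b) = (\<Sum>b\<in>B. v \<star> g b)"
  by (auto simp: fun_eq_iff sum_fun_apply sum_distrib_left sum_distrib_right)

lemma is_subspace_iff: "is_subspace N U \<longleftrightarrow> U \<subseteq> vecs N \<and> lsub U"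
  by (auto simp: is_subspace_def lsub_def plus_fun_def zero_fun_def scl_def)

lemma lincomb_eq: "lincomb B c = (\<Sum>b\<in>B. b \<star> c b)"
  by (auto simp: lincomb_def fun_eq_iff sum_fun_apply)

lemma lsubD:
  assumes "lsub U"
  shows "0 \<in> U" "u \<in> U \<Longrightarrow> v \<in> U \<Longrightarrow> u + v \<in> U" "u \<in> U \<Longrightarrow> u \<star> a \<in> U"
  using assms by (auto simp: lsub_def)

lemma lsubI:
  assumes "0 \<in> U" "\<And>u v. u \<in> U \<Longrightarrow> v \<in> U \<Longrightarrow> u + v \<in> U" "\<And>u a. u \<in> U \<Longrightarrow> u \<star> a \<in> U"
  shows "lsub U"
  using assms by (auto simp: lsub_def)

lemma lsub_diff:
  assumes "lsub U" "u \<in> U" "v \<in> U"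
  shows "u - v \<in> U"
proof -
  have "u - v = u + v \<star> (-1)" by (simp add: fun_eq_iff)
  also have "\<dots> \<in> U" using assms by (intro lsubD)
  finally show ?thesis .
qed

lemma lsub_sum: "lsub U \<Longrightarrow> (\<And>b. b \<in> B \<Longrightarrow> f b \<in> U) \<Longrightarrow> (\<Sum>b\<in>B. f b) \<in> U"
  by (induction B rule: infinite_finite_induct) (auto intro: lsubD)

lemma lsub_Inter: "(\<And>U. U \<in> T \<Longrightarrow> lsub U) \<Longrightarrow> lsub (\<Inter>T)"
  by (auto simp: lsub_def)

lemma lsub_Int: "lsub U \<Longrightarrow> lsub W \<Longrightarrow> lsub (U \<inter> W)"
  by (auto simp: lsub_def)

lemma lsub_lspan [simp]: "lsub (lspan S)"
  by (rule hull_in) (auto intro: lsub_Inter)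

lemma lspan_inc: "x \<in> S \<Longrightarrow> x \<in> lspan S"
  by (rule hull_inc)

lemma lspan_sum_scl: "B \<subseteq> S \<Longrightarrow> (\<Sum>b\<in>B. b \<star> c b) \<in> lspan S"
  by (intro lsub_sum lsubD(3) lsub_lspan) (auto intro: lspan_inc)

lemma lspan_lsub: "lsub U \<Longrightarrow> lspan U = U"
  by (simp add: hull_same)

lemma lspan_subset_iff: "lsub U \<Longrightarrow> lspan S \<subseteq> U \<longleftrightarrow> S \<subseteq> U"
  by (rule subset_hull)

lemma lsub_vecs [simp]: "lsub (vecs N)"
  by (auto simp: lsub_def vecs_def)

text \<open>The right-hand side describes a subspace containing \<open>insert b S\<close>. Working
  modulo one vector at a time replaces coordinates in the exchange property, in kernels and in
  extensions of totally singular subspaces.\<close>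

lemma lspan_insert_iff: "x \<in> lspan (insert b S) \<longleftrightarrow> (\<exists>a. x - b \<star> a \<in> lspan S)"
proof
  let ?U = "{x. \<exists>a. x - b \<star> a \<in> lspan S}"
  have "lsub ?U"
  proof (rule lsubI)
    show "0 \<in> ?U" using lsubD(1)[OF lsub_lspan[of S]] by (auto intro!: exI[of _ 0])
  next
    fix u v assume "u \<in> ?U" "v \<in> ?U"
    then obtain c d where cd: "u - b \<star> c \<in> lspan S" "v - b \<star> d \<in> lspan S" by auto
    have "(u + v) - b \<star> (c + d) = (u - b \<star> c) + (v - b \<star> d)"
      by (auto simp: fun_eq_iff algebra_simps)
    then have "(u + v) - b \<star> (c + d) \<in> lspan S" using lsubD(2)[OF lsub_lspan cd] by metis
    then show "u + v \<in> ?U" by blast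
  next
    fix u a assume "u \<in> ?U"
    then obtain c where c: "u - b \<star> c \<in> lspan S" by auto
    have "u \<star> a - b \<star> (c * a) = (u - b \<star> c) \<star> a"
      by (simp add: fun_eq_iff algebra_simps)
    with c show "u \<star> a \<in> ?U" by (auto intro!: exI[of _ "c * a"] lsubD(3))
  qed
  moreover have "insert b S \<subseteq> ?U"
  proof -
    have "b - b \<star> 1 \<in> lspan S" using lsubD(1)[OF lsub_lspan[of S]] by simp
    moreover have "x - b \<star> 0 \<in> lspan S" if "x \<in> S" for x using that by (simp add: lspan_inc)
    ultimately show ?thesis by blast
  qed
  ultimately have "lspan (insert b S) \<subseteq> ?U" by (simp add: lspan_subset_iff)
  moreover assume "x \<in> lspan (insert b S)"
  ultimately show "\<exists>a. x - b \<star> a \<in> lspan S" by auto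
next
  assume "\<exists>a. x - b \<star> a \<in> lspan S"
  then obtain a where "x - b \<star> a \<in> lspan S" by auto
  then have "x - b \<star> a \<in> lspan (insert b S)" by (meson hull_mono subset_insertI subsetD)
  moreover have "b \<star> a \<in> lspan (insert b S)" by (simp add: lspan_inc lsubD(3))
  ultimately have "(x - b \<star> a) + b \<star> a \<in> lspan (insert b S)" by (rule lsubD(2)[OF lsub_lspan])
  then show "x \<in> lspan (insert b S)" by simp
qed

section \<open>Exchange, independence and invariance of the number of basis vectors\<close>

lemma lspan_exchange:
  assumes "x \<in> lspan (insert y S)" "x \<notin> lspan S"
  shows "y \<in> lspan (insert x S)"
proof -
  obtain a where a: "x - y \<star> a \<in> lspan S" using assms(1) by (auto simp: lspan_insert_iff)
  then have "a \<noteq> 0" using assms(2) by auto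
  have "(x - y \<star> a) \<star> (- inverse a) \<in> lspan S" using a by (simp add: lsubD(3))
  moreover have "(x - y \<star> a) \<star> (- inverse a) = y - x \<star> inverse a"
    using \<open>a \<noteq> 0\<close> by (simp add: fun_eq_iff algebra_simps)
  ultimately show ?thesis by (auto simp: lspan_insert_iff)
qed

lemma indep_insert:
  assumes "indep B" "x \<notin> lspan B"
  shows "indep (insert x B)"
  unfolding indep_def
proof
  have "x \<notin> B" using assms(2) by (auto simp: lspan_inc)
  fix b assume b: "b \<in> insert x B"
  show "b \<notin> lspan (insert x B - {b})"
  proof (cases "b = x")
    case True
    with \<open>x \<notin> B\<close> assms show ?thesis by simp
  next
    case False
    then have "b \<in> B" using b by auto
    have eq: "insert x B - {b} = insert x (B - {b})" using False by auto
    have "b \<notin> lspan (B - {b})" using assms(1) \<open>b \<in> B\<close> by (auto simp: indep_def)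
    moreover have "x \<notin> lspan (insert b (B - {b}))" using assms(2) \<open>b \<in> B\<close> by (simp add: insert_absorb)
    ultimately show ?thesis unfolding eq using lspan_exchange by blast
  qed
qed

text \<open>Add the vectors of \<open>D\<close> to \<open>C\<close> one by one: \<open>b\<close> is
  the vector at which \<open>x\<close> enters the span, and \<open>E\<close> is the set reached just
  before.\<close>

lemma lspan_step:
  assumes "finite D" "x \<notin> lspan C" "x \<in> lspan (C \<union> D)"
  obtains E b where "b \<in> D" "C \<subseteq> E" "E \<subseteq> C \<union> D" "x \<notin> lspan E" "x \<in> lspan (insert b E)"
  using assms
proof (induction D arbitrary: C thesis)
  case empty
  then show ?case by simp
next
  case (insert b D)
  show ?case
  proof (cases "x \<in> lspan (insert b C)")
    case True
    then show ?thesis using insert.prems by blast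
  next
    case False
    from insert.prems(3) have "x \<in> lspan (insert b C \<union> D)" by simp
    from insert.IH[OF _ False this] obtain E d where
      "d \<in> D" "insert b C \<subseteq> E" "E \<subseteq> insert b C \<union> D" "x \<notin> lspan E" "x \<in> lspan (insert d E)" by blast
    then show ?thesis using insert.prems(1)[of d E] by auto
  qed
qed

text \<open>Some \<open>a\<close> in \<open>A - B\<close> is traded for a vector \<open>b\<close> of
  \<open>B\<close>, which keeps the cardinality and the spanning property and shrinks
  \<open>A - B\<close>. Starting \<open>lspan_step\<close> from \<open>A \<inter> B\<close>
  guarantees that \<open>b\<close> is not in \<open>A\<close>, so no earlier trade is
  undone.\<close>

lemma steinitz:
  assumes "finite B" "finite A" "indep A" "A \<subseteq> lspan B"
  shows "card A \<le> card B"
  using assms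
proof (induction "card (A - B)" arbitrary: B)
  case 0
  then show ?case by (auto intro: card_mono)
next
  case (Suc n)
  then obtain a where a: "a \<in> A" "a \<notin> B"
    by (metis Diff_eq_empty_iff card.empty nat.distinct(1) subsetI)
  have na: "a \<notin> lspan (A \<inter> B)"
    using Suc.prems(3) a hull_mono[of "A \<inter> B" "A - {a}" lsub] unfolding indep_def by blast
  have "a \<in> lspan ((A \<inter> B) \<union> (B - A))"
    using Suc.prems(4) a by (metis Int_Diff_Un Int_commute subsetD)
  then obtain E b where E: "b \<in> B - A" "A \<inter> B \<subseteq> E" "E \<subseteq> A \<inter> B \<union> (B - A)"
      "a \<notin> lspan E" "a \<in> lspan (insert b E)"
    using lspan_step[OF _ na] Suc.prems(1) by (metis finite_Diff)
  have "b \<notin> E" using E(4,5) by (auto simp: insert_absorb)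
  have "b \<in> lspan (insert a E)" using lspan_exchange[OF E(5,4)] .
  moreover have "insert a E \<subseteq> insert a (B - {b})" using E \<open>b \<notin> E\<close> by auto
  ultimately have b: "b \<in> lspan (insert a (B - {b}))" by (meson hull_mono subsetD)
  let ?B = "insert a (B - {b})"
  have "x \<in> lspan ?B" if "x \<in> B" for x using b that by (cases "x = b") (auto intro: lspan_inc)
  then have "B \<subseteq> lspan ?B" by blast
  then have "A \<subseteq> lspan ?B" using Suc.prems(4) by (meson lspan_subset_iff lsub_lspan order_trans)
  moreover have "n = card (A - ?B)"
  proof -
    have "A - ?B = (A - B) - {a}" using a E(1) by auto
    then show ?thesis using Suc.hyps(2) Suc.prems(2) a by simp
  qed
  ultimately have "card A \<le> card ?B" using Suc.hyps(1)[of ?B] Suc.prems by auto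
  also have "\<dots> = card B" using a E(1) Suc.prems(1)
    by (simp add: card.insert_remove) (metis card_gt_0_iff Suc_pred empty_iff)
  finally show ?case .
qed

lemma combs_UNIV: "finite B \<Longrightarrow> combs UNIV B = lspan B"
proof
  assume fin: "finite B"
  show "combs UNIV B \<subseteq> lspan B"
    by (auto simp: combs_def lincomb_eq lspan_sum_scl)
  have "lsub (combs UNIV B)"
  proof (rule lsubI)
    show "0 \<in> combs UNIV B" by (auto simp: combs_def lincomb_eq intro!: exI[of _ "\<lambda>_. 0"])
  next
    fix u v assume "u \<in> combs UNIV B" "v \<in> combs UNIV B"
    then obtain c d where "u = lincomb B c" "v = lincomb B d" by (auto simp: combs_def)
    then have "u + v = lincomb B (\<lambda>b. c b + d b)" by (simp add: lincomb_eq scl_add sum.distrib)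
    then show "u + v \<in> combs UNIV B" by (auto simp: combs_def)
  next
    fix u a assume "u \<in> combs UNIV B"
    then obtain c where "u = lincomb B c" by (auto simp: combs_def)
    then have "u \<star> a = lincomb B (\<lambda>b. c b * a)" by (simp add: lincomb_eq scl_sum)
    then show "u \<star> a \<in> combs UNIV B" by (auto simp: combs_def)
  qed
  moreover have "B \<subseteq> combs UNIV B"
  proof
    fix b assume "b \<in> B"
    have "lincomb B (\<lambda>x. if x = b then 1 else 0) = (\<Sum>x\<in>B. if x = b then x else 0)"
      unfolding lincomb_eq by (rule sum.cong) auto
    also have "\<dots> = b" using \<open>b \<in> B\<close> fin by simp
    finally have "b = lincomb B (\<lambda>x. if x = b then 1 else 0)" by simp
    then show "b \<in> combs UNIV B" unfolding combs_def by blast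
  qed
  ultimately show "lspan B \<subseteq> combs UNIV B" by (simp add: lspan_subset_iff)
qed

lemma indep_iff_lincomb:
  assumes "finite B"
  shows "indep B \<longleftrightarrow> (\<forall>c. lincomb B c = 0 \<longrightarrow> (\<forall>b\<in>B. c b = 0))"
proof (intro iffI allI impI ballI)
  fix c b assume ind: "indep B" and c: "lincomb B c = 0" and b: "b \<in> B"
  show "c b = 0"
  proof (rule ccontr)
    assume nz: "c b \<noteq> 0"
    have eq: "0 = b \<star> c b + (\<Sum>x\<in>B - {b}. x \<star> c x)"
      using c b assms by (simp add: lincomb_eq sum.remove)
    have "(\<Sum>x\<in>B - {b}. x \<star> c x) \<in> lspan (B - {b})"
      by (simp add: lspan_sum_scl)
    then have "(\<Sum>x\<in>B - {b}. x \<star> c x) \<star> (- inverse (c b)) \<in> lspan (B - {b})" by (simp add: lsubD(3))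
    moreover have "(\<Sum>x\<in>B - {b}. x \<star> c x) = - (b \<star> c b)" using eq by (metis add.commute eq_neg_iff_add_eq_0)
    then have "(\<Sum>x\<in>B - {b}. x \<star> c x) \<star> (- inverse (c b)) = b"
      using nz by (simp add: fun_eq_iff mult.assoc)
    ultimately show False using ind b by (auto simp: indep_def)
  qed
next
  assume *: "\<forall>c. lincomb B c = 0 \<longrightarrow> (\<forall>b\<in>B. c b = 0)"
  show "indep B" unfolding indep_def
  proof (intro ballI notI)
    fix b assume b: "b \<in> B" "b \<in> lspan (B - {b})"
    then obtain c where c: "b = lincomb (B - {b}) c"
      using combs_UNIV[of "B - {b}"] assms by (auto simp: combs_def)
    have "lincomb B (c(b := -1)) = b \<star> (-1) + (\<Sum>x\<in>B - {b}. x \<star> (c(b := -1)) x)"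
      using b assms by (simp add: lincomb_eq sum.remove)
    also have "(\<Sum>x\<in>B - {b}. x \<star> (c(b := -1)) x) = lincomb (B - {b}) c"
      unfolding lincomb_eq by (rule sum.cong) auto
    also have "b \<star> (-1) + lincomb (B - {b}) c = 0" using c by (simp add: fun_eq_iff)
    finally have "(c(b := -1)) b = 0" using * b by blast
    then show False by simp
  qed
qed

lemma is_basis_iff: "is_basis B U \<longleftrightarrow> finite B \<and> indep B \<and> lspan B = U"
  by (auto simp: is_basis_def combs_UNIV indep_iff_lincomb zero_fun_def)

text \<open>The choice hidden in \<open>vdim\<close> is harmless, since \<open>steinitz\<close>
  applies to any two bases in both directions.\<close>

lemma vdim_eq_card:
  assumes "is_basis B U"
  shows "vdim U = card B"
proof -
  have "is_basis (SOME B. is_basis B U) U" using assms by (rule someI)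
  moreover have "card A \<le> card B" if "is_basis A U" "is_basis B U" for A B
    using that steinitz[of B A] hull_subset[of A lsub] by (auto simp: is_basis_iff)
  ultimately show ?thesis
    unfolding vdim_def using assms by (simp add: antisym)
qed

lemma std_basis_span: "(vecs N :: 'k::division_ring vec set) = lspan (std_basis N)"
proof
  show "lspan (std_basis N) \<subseteq> (vecs N :: 'k vec set)"
    unfolding lspan_subset_iff[OF lsub_vecs] by (auto simp: std_basis_def vecs_def unit_vec_def)
  show "(vecs N :: 'k vec set) \<subseteq> lspan (std_basis N)"
  proof
    fix v :: "'k vec" assume v: "v \<in> vecs N"
    have "v = (\<Sum>i\<in>{1..N}. unit_vec i \<star> v i)"
    proof
      fix j
      have "(\<Sum>i\<in>{1..N}. unit_vec i \<star> v i) j = (\<Sum>i\<in>{1..N}. if j = i then v i else 0)"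
        unfolding sum_fun_apply by (rule sum.cong) (auto simp: unit_vec_def)
      then show "v j = (\<Sum>i\<in>{1..N}. unit_vec i \<star> v i) j" using v by (auto simp: vecs_def)
    qed
    also have "\<dots> \<in> lspan (std_basis N)"
      by (intro lsub_sum lsubD(3) lsub_lspan lspan_inc) (simp add: std_basis_def)
    finally show "v \<in> lspan (std_basis N)" .
  qed
qed

lemma unit_vec_eq_iff [simp]: "(unit_vec i :: 'k::division_ring vec) = unit_vec j \<longleftrightarrow> i = j"
  unfolding unit_vec_def by (metis zero_neq_one)

lemma finite_std_basis [simp]: "finite (std_basis N)"
  by (simp add: std_basis_def)

lemma card_std_basis: "card (std_basis N :: 'k::division_ring vec set) = N"
proof -
  have "inj_on (unit_vec :: nat \<Rightarrow> 'k vec) {1..N}" by (rule inj_onI) simp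
  then show ?thesis by (simp add: std_basis_def card_image)
qed

text \<open>A largest independent set between \<open>A\<close> and \<open>S\<close> works; sizes are
  bounded because the unit vectors span. The new vectors are taken from \<open>S\<close> itself,
  which need not be a subspace: with \<open>S\<close> a set of rational vectors this yields rational
  bases.\<close>

lemma basis_exists:
  fixes S :: "'k::division_ring vec set"
  assumes "S \<subseteq> vecs N" "finite A" "indep A" "A \<subseteq> S"
  obtains B where "A \<subseteq> B" "B \<subseteq> S" "finite B" "indep B" "lspan B = lspan S"
proof -
  let ?P = "\<lambda>B. A \<subseteq> B \<and> B \<subseteq> S \<and> finite B \<and> indep B"
  have "card B < Suc N" if "?P B" for B
    using steinitz[of "std_basis N" B] that assms(1) std_basis_span[of N, where ?'k='k]
    by (metis card_std_basis finite_std_basis le_imp_less_Suc order_trans)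
  then have "\<forall>B. ?P B \<longrightarrow> card B < Suc N" by blast
  moreover have "?P A" using assms by auto
  ultimately obtain B where B: "?P B" and max: "\<And>C. ?P C \<Longrightarrow> card C \<le> card B"
    using ex_has_greatest_nat[of ?P A card "Suc N"] by (metis less_imp_le)
  have "S \<subseteq> lspan B"
  proof
    fix x assume "x \<in> S"
    show "x \<in> lspan B"
    proof (rule ccontr)
      assume x: "x \<notin> lspan B"
      then have "x \<notin> B" by (auto simp: lspan_inc)
      have "?P (insert x B)" using B x \<open>x \<in> S\<close> indep_insert by auto
      from max[OF this] show False using \<open>x \<notin> B\<close> B by simp
    qed
  qed
  then have "lspan B = lspan S" using B by (metis hull_mono lspan_subset_iff lsub_lspan subset_antisym)
  with B that show ?thesis by blast
qed

lemma indep_empty [simp]: "indep {}"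
  by (simp add: indep_def)

section \<open>Dimension of subspaces\<close>

lemma is_subspace_lspan: "S \<subseteq> vecs N \<Longrightarrow> is_subspace N (lspan S)"
  by (auto simp: is_subspace_iff lspan_subset_iff lspan_inc)

lemma is_subspaceD: "is_subspace N U \<Longrightarrow> lsub U" "is_subspace N U \<Longrightarrow> U \<subseteq> vecs N"
  by (auto simp: is_subspace_iff)

lemma is_subspace_Int: "is_subspace N U \<Longrightarrow> is_subspace N W \<Longrightarrow> is_subspace N (U \<inter> W)"
  by (auto simp: is_subspace_iff lsub_Int)

lemma is_subspace_vecs [simp]: "is_subspace N (vecs N)"
  by (simp add: is_subspace_iff)

lemma subspace_basis:
  assumes "is_subspace N U"
  obtains B where "is_basis B U" "B \<subseteq> U" "card B = vdim U"
proof -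
  obtain B where B: "B \<subseteq> U" "finite B" "indep B" "lspan B = lspan U"
    using basis_exists[of U N "{}"] assms by (auto simp: is_subspace_iff)
  then have "is_basis B U" using assms by (simp add: is_basis_iff is_subspace_iff lspan_lsub)
  then show ?thesis using B that vdim_eq_card by metis
qed

lemma basis_extend:
  assumes "is_subspace N U" "is_subspace N W" "U \<subseteq> W" "is_basis A U"
  obtains B where "A \<subseteq> B" "is_basis B W" "card B = vdim W"
proof -
  have "A \<subseteq> U" using assms(4) by (auto simp: is_basis_iff lspan_inc)
  then obtain B where B: "A \<subseteq> B" "B \<subseteq> W" "finite B" "indep B" "lspan B = lspan W"
    using basis_exists[of W N A] assms subset_trans[of A U W]
    unfolding is_subspace_iff is_basis_iff by metis
  then have "is_basis B W" using assms by (simp add: is_basis_iff is_subspace_iff lspan_lsub)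
  then show ?thesis using B that vdim_eq_card by metis
qed

lemma vdim_mono:
  assumes "is_subspace N U" "is_subspace N W" "U \<subseteq> W"
  shows "vdim U \<le> vdim W"
proof -
  obtain A where A: "is_basis A U" "card A = vdim U" using subspace_basis[OF assms(1)] by metis
  obtain B where "A \<subseteq> B" "is_basis B W" "card B = vdim W" using basis_extend[OF assms A(1)] by metis
  then show ?thesis using A by (metis card_mono is_basis_iff)
qed

lemma vdim_equal:
  assumes "is_subspace N U" "is_subspace N W" "U \<subseteq> W" "vdim W \<le> vdim U"
  shows "U = W"
proof -
  obtain A where A: "is_basis A U" "card A = vdim U" using subspace_basis[OF assms(1)] by metis
  obtain B where "A \<subseteq> B" "is_basis B W" "card B = vdim W" using basis_extend[OF assms(1-3) A(1)] by metis
  then show ?thesis using A assms(4) by (metis card_seteq is_basis_iff)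
qed

lemma vdim_less:
  assumes "is_subspace N U" "is_subspace N W" "U \<subset> W"
  shows "vdim U < vdim W"
  using vdim_equal[OF assms(1,2)] assms(3) by (metis linorder_not_le psubset_eq)

lemma vdim_vecs [simp]: "vdim (vecs N :: 'k::division_ring vec set) = N"
proof -
  obtain B :: "'k vec set" where B: "is_basis B (vecs N)" "card B = vdim (vecs N :: 'k vec set)"
    using subspace_basis[OF is_subspace_vecs] by metis
  have "indep (std_basis N :: 'k vec set)"
    unfolding indep_def
  proof
    fix b :: "'k vec" assume "b \<in> std_basis N"
    then obtain i where i: "b = unit_vec i" by (auto simp: std_basis_def)
    have "lsub {x :: 'k vec. x i = 0}" by (auto simp: lsub_def)
    moreover have "std_basis N - {b} \<subseteq> {x. x i = 0}" using i by (auto simp: std_basis_def unit_vec_def)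
    ultimately have "lspan (std_basis N - {b}) \<subseteq> {x. x i = 0}" by (simp add: lspan_subset_iff)
    moreover have "b i \<noteq> 0" using i by (simp add: unit_vec_def)
    ultimately show "b \<notin> lspan (std_basis N - {b})" by auto
  qed
  then have "is_basis (std_basis N :: 'k vec set) (vecs N)"
    by (simp add: is_basis_iff std_basis_span)
  then show ?thesis using vdim_eq_card card_std_basis by metis
qed

lemma vdim_lspan_le:
  assumes "S \<subseteq> vecs N" "finite S"
  shows "vdim (lspan S) \<le> card S"
proof -
  obtain A where A: "is_basis A (lspan S)" "card A = vdim (lspan S)"
    using subspace_basis[OF is_subspace_lspan[OF assms(1)]] by metis
  then show ?thesis using steinitz[of S A] assms(2) by (metis hull_subset is_basis_iff)
qed

lemma vdim_insert_le:
  assumes "is_subspace N U" "x \<in> vecs N"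
  shows "vdim (lspan (insert x U)) \<le> vdim U + 1"
proof -
  obtain A where A: "is_basis A U" "A \<subseteq> U" "card A = vdim U" using subspace_basis[OF assms(1)] by metis
  have "lspan (insert x U) = lspan (insert x A)"
    using A by (metis hull_insert is_basis_iff)
  also have "vdim \<dots> \<le> card (insert x A)"
    using A assms by (intro vdim_lspan_le[of _ N]) (auto simp: is_basis_iff is_subspace_iff)
  also have "\<dots> \<le> vdim U + 1" using A by (metis Suc_eq_plus1 card_insert_le_m1 card_insert_if is_basis_iff le_Suc_eq order_refl)
  finally show ?thesis .
qed

lemma vdim_insert:
  assumes "is_subspace N U" "x \<in> vecs N" "x \<notin> U"
  shows "vdim (lspan (insert x U)) = vdim U + 1"
proof -
  have "is_subspace N (lspan (insert x U))"
    using assms by (intro is_subspace_lspan) (auto simp: is_subspace_iff)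
  moreover have "U \<subset> lspan (insert x U)"
    using hull_subset[of "insert x U" lsub] assms(3) by blast
  ultimately have "vdim U < vdim (lspan (insert x U))" using vdim_less assms(1) by blast
  then show ?thesis using vdim_insert_le[OF assms(1,2)] by linarith
qed

text \<open>Extend a basis \<open>D\<close> of the intersection to bases \<open>B\<close> and
  \<open>C\<close>: their union spans the sum, and \<open>D \<subseteq> B \<inter> C\<close> bounds
  its size.\<close>

lemma vdim_Un_Int_le:
  assumes U: "is_subspace N U" and W: "is_subspace N W"
  shows "vdim (lspan (U \<union> W)) + vdim (U \<inter> W) \<le> vdim U + vdim W"
proof -
  note I = is_subspace_Int[OF U W]
  obtain D where D: "is_basis D (U \<inter> W)" "card D = vdim (U \<inter> W)" using subspace_basis[OF I] by metis
  obtain B where B: "D \<subseteq> B" "is_basis B U" "card B = vdim U" using basis_extend[OF I U _ D(1)] by auto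
  obtain C where C: "D \<subseteq> C" "is_basis C W" "card C = vdim W" using basis_extend[OF I W _ D(1)] by auto
  have fin: "finite B" "finite C" using B C by (auto simp: is_basis_iff)
  have "lspan (U \<union> W) = lspan (B \<union> C)"
    using B(2) C(2) hull_Un[of lsub B C] lsub_Inter by (auto simp: is_basis_iff)
  also have "B \<union> C \<subseteq> vecs N"
    using B(2) C(2) U W by (auto simp: is_basis_iff is_subspace_iff lspan_inc)
  then have "vdim (lspan (B \<union> C)) \<le> card (B \<union> C)" using fin by (intro vdim_lspan_le) auto
  finally have "vdim (lspan (U \<union> W)) \<le> card (B \<union> C)" .
  moreover have "card D \<le> card (B \<inter> C)" using B(1) C(1) fin by (intro card_mono) auto
  moreover have "card (B \<union> C) + card (B \<inter> C) = card B + card C" using card_Un_Int[OF fin] by simp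
  ultimately show ?thesis using B C D by linarith
qed

lemma vdim_pos_iff:
  assumes "is_subspace N U"
  shows "vdim U \<ge> 1 \<longleftrightarrow> (\<exists>x\<in>U. x \<noteq> 0)"
proof
  assume "vdim U \<ge> 1"
  moreover have "vdim {0 :: 'a vec} = 0"
  proof -
    have "lspan ({} :: 'a vec set) = {0}" by (rule hull_unique) (auto simp: lsub_def)
    then show ?thesis using vdim_eq_card[of "{}" "{0 :: 'a vec}"] by (simp add: is_basis_iff)
  qed
  ultimately have "U \<noteq> {0}" by auto
  then show "\<exists>x\<in>U. x \<noteq> 0" using lsubD(1)[OF is_subspaceD(1)[OF assms]] by blast
next
  assume "\<exists>x\<in>U. x \<noteq> 0"
  then have "{0} \<subset> U" using lsubD(1)[OF is_subspaceD(1)[OF assms]] by auto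
  moreover have "is_subspace N {0 :: 'a vec}" by (auto simp: is_subspace_iff lsub_def vecs_def)
  ultimately show "vdim U \<ge> 1" using vdim_less[OF _ assms] by fastforce
qed

lemma subspace_eq_insert:
  assumes "is_subspace N U" "is_subspace N M" "U \<subseteq> M" "vdim M = vdim U + 1" "x \<in> M" "x \<notin> U"
  shows "M = lspan (insert x U)"
proof -
  have x: "x \<in> vecs N" using assms by (auto simp: is_subspace_iff)
  have "lspan (insert x U) \<subseteq> M" unfolding lspan_subset_iff[OF is_subspaceD(1)[OF assms(2)]] using assms by auto
  moreover have "is_subspace N (lspan (insert x U))"
    using x assms(1) by (intro is_subspace_lspan) (auto simp: is_subspace_iff)
  ultimately show ?thesis using vdim_equal[of N "lspan (insert x U)" M] vdim_insert[OF assms(1) x assms(6)] assms by simp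
qed

section \<open>Kernels of functionals, planes and pencils of hyperplanes\<close>

lemma functional_zero:
  fixes f :: "'k::division_ring vec \<Rightarrow> 'k"
  assumes "\<And>u v. f (u + v) = f u + f v"
  shows "f 0 = 0"
  using assms[of 0 0] by simp

lemma functional_kernel:
  fixes f :: "'k::division_ring vec \<Rightarrow> 'k"
  assumes "is_subspace N Y" "\<And>u v. f (u + v) = f u + f v" "\<And>u a. f (u \<star> a) = f u * a"
  shows "is_subspace N {x\<in>Y. f x = 0}"
proof -
  have "f 0 = 0" using functional_zero assms(2) by metis
  then show ?thesis using assms(1) by (auto simp: is_subspace_iff lsub_def assms(2,3))
qed

text \<open>If \<open>f y \<noteq> 0\<close>, subtracting
  \<open>y \<star> (inverse (f y) * f x)\<close> moves any \<open>x\<close> into the kernel, so the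
  kernel and \<open>y\<close> span \<open>Y\<close>.\<close>

lemma vdim_kernel:
  fixes f :: "'k::division_ring vec \<Rightarrow> 'k"
  assumes Y: "is_subspace N Y" and f_add: "\<And>u v. f (u + v) = f u + f v"
    and f_scl: "\<And>u a. f (u \<star> a) = f u * a"
  shows "vdim Y \<le> vdim {x\<in>Y. f x = 0} + 1"
proof (cases "\<forall>y\<in>Y. f y = 0")
  case True
  then have "{x\<in>Y. f x = 0} = Y" by auto
  then show ?thesis by simp
next
  case False
  then obtain y where y: "y \<in> Y" "f y \<noteq> 0" by auto
  let ?K = "{x\<in>Y. f x = 0}"
  note K = functional_kernel[OF Y, of f, OF f_add f_scl]
  have yv: "y \<in> vecs N" using Y y by (auto simp: is_subspace_iff)
  have "Y \<subseteq> lspan (insert y ?K)"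
  proof
    fix x assume x: "x \<in> Y"
    let ?z = "x - y \<star> (inverse (f y) * f x)"
    have "?z \<in> Y" using x y is_subspaceD(1)[OF Y] by (auto intro: lsub_diff lsubD)
    moreover have "f x = f ?z + f y * (inverse (f y) * f x)"
      using f_add[of ?z "y \<star> (inverse (f y) * f x)"] f_scl by simp
    then have "f ?z = 0" using y by (simp flip: mult.assoc)
    ultimately have "?z \<in> lspan ?K" by (simp add: lspan_inc)
    then show "x \<in> lspan (insert y ?K)" unfolding lspan_insert_iff by blast
  qed
  moreover have "is_subspace N (lspan (insert y ?K))"
    using K yv by (intro is_subspace_lspan) (auto simp: is_subspace_iff)
  ultimately have "vdim Y \<le> vdim (lspan (insert y ?K))" using vdim_mono Y by blast
  also have "\<dots> \<le> vdim ?K + 1" by (rule vdim_insert_le[OF K yv])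
  finally show ?thesis .
qed

lemma vdim_line:
  assumes "v \<in> vecs N" "v \<noteq> 0"
  shows "vdim (lspan {v}) = 1"
proof -
  have "vdim (lspan {v}) \<le> 1" using vdim_lspan_le[of "{v}" N] assms by simp
  moreover have "vdim (lspan {v}) \<ge> 1"
    using vdim_pos_iff[OF is_subspace_lspan[of "{v}" N]] assms lspan_inc[of v "{v}"] by blast
  ultimately show ?thesis by simp
qed

text \<open>On a line along which the 1-dimensional element moves, this puts a third point into any
  join that contains the first two.\<close>

lemma plane_span:
  assumes "is_subspace N p" "is_subspace N q" "is_subspace N W"
    and "vdim p = 1" "vdim q = 1" "vdim W = 2" "p \<noteq> q" "p \<subseteq> W" "q \<subseteq> W"
  shows "W = lspan (p \<union> q)"
proof -
  let ?S = "lspan (p \<union> q)"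
  have S: "is_subspace N ?S" using assms(1,2) by (intro is_subspace_lspan) (auto simp: is_subspace_iff)
  have "?S \<subseteq> W" unfolding lspan_subset_iff[OF is_subspaceD(1)[OF assms(3)]] using assms by auto
  moreover have "p \<union> q \<subseteq> ?S" by (simp add: hull_subset)
  then have "p \<subset> ?S" using vdim_equal[OF assms(2,1)] assms(4,5,7) by auto
  then have "vdim W \<le> vdim ?S" using vdim_less[OF assms(1) S] assms by simp
  ultimately show ?thesis using vdim_equal[OF S assms(3)] by simp
qed

text \<open>The dual fact for a line along which the largest element moves:
  \<open>H \<inter> H'\<close> is strictly smaller than \<open>H\<close> and contains
  \<open>K\<close>, which leaves no room for anything but \<open>K\<close>.\<close>

lemma hyperplanes_Int:
  assumes "is_subspace N H" "is_subspace N H'" "is_subspace N K"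
    and "vdim H' = vdim H" "vdim H \<le> vdim K + 1" "H \<noteq> H'" "K \<subseteq> H" "K \<subseteq> H'"
  shows "H \<inter> H' = K"
proof -
  note I = is_subspace_Int[OF assms(1,2)]
  have "H \<inter> H' \<noteq> H" using vdim_equal[OF assms(1,2)] assms(4,6) by auto
  then have "vdim (H \<inter> H') < vdim H" by (intro vdim_less[OF I assms(1)]) auto
  then show ?thesis using vdim_equal[OF assms(3) I] assms(5,7,8) by auto
qed


section \<open>Rational subspaces\<close>

locale division_subring =
  fixes K0 :: "'k::division_ring set"
  assumes sub: "sub_division_ring K0"
begin

lemma K0_one: "1 \<in> K0"
  and K0_diff: "x \<in> K0 \<Longrightarrow> y \<in> K0 \<Longrightarrow> x - y \<in> K0"
  and K0_mult: "x \<in> K0 \<Longrightarrow> y \<in> K0 \<Longrightarrow> x * y \<in> K0"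
  and K0_inverse: "x \<in> K0 \<Longrightarrow> inverse x \<in> K0"
  using sub by (auto simp: sub_division_ring_def)

lemma K0_zero: "0 \<in> K0"
  using K0_diff[OF K0_one K0_one] by simp

lemma K0_uminus: "x \<in> K0 \<Longrightarrow> - x \<in> K0"
  using K0_diff[OF K0_zero] by simp

lemma K0_add: "x \<in> K0 \<Longrightarrow> y \<in> K0 \<Longrightarrow> x + y \<in> K0"
  using K0_diff[of x "- y"] K0_uminus by simp

lemma K0_sum: "(\<And>i. i \<in> A \<Longrightarrow> f i \<in> K0) \<Longrightarrow> (\<Sum>i\<in>A. f i) \<in> K0"
  by (induction A rule: infinite_finite_induct) (auto intro: K0_zero K0_add)

lemma rational_vec_iff: "rational_vec K0 N v \<longleftrightarrow> v \<in> vecs N \<and> (\<forall>i. v i \<in> K0)"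
proof -
  have eq: "lincomb (std_basis N) c = (\<lambda>i. if i \<in> {1..N} then c (unit_vec i) else 0)" for c :: "'k vec \<Rightarrow> 'k"
  proof
    fix i
    have "lincomb (std_basis N) c i = (\<Sum>j\<in>{1..N}. unit_vec j i * c (unit_vec j))"
      unfolding lincomb_def std_basis_def by (subst sum.reindex) (auto intro: inj_onI)
    also have "\<dots> = (\<Sum>j\<in>{1..N}. if j = i then c (unit_vec i) else 0)"
      by (rule sum.cong) (auto simp: unit_vec_def)
    also have "\<dots> = (if i \<in> {1..N} then c (unit_vec i) else 0)" by simp
    finally show "lincomb (std_basis N) c i = (if i \<in> {1..N} then c (unit_vec i) else 0)" .
  qed
  show ?thesis
  proof
    assume "rational_vec K0 N v"
    then obtain c where c: "v = lincomb (std_basis N) c" "\<forall>b\<in>std_basis N. c b \<in> K0"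
      by (auto simp: rational_vec_def combs_def)
    then show "v \<in> vecs N \<and> (\<forall>i. v i \<in> K0)"
      unfolding c(1) eq by (auto simp: vecs_def std_basis_def K0_zero)
  next
    assume v: "v \<in> vecs N \<and> (\<forall>i. v i \<in> K0)"
    \<comment> \<open>\<open>lincomb\<close> attaches coefficients to vectors, so the index has to
      be read back from the unit vector.\<close>
    define c where "c b = v (THE i. b = unit_vec i)" for b :: "'k vec"
    have c: "c (unit_vec i) = v i" for i by (simp add: c_def)
    have "v = lincomb (std_basis N) c"
      using v by (auto simp: eq c vecs_def fun_eq_iff)
    moreover have "\<forall>b\<in>std_basis N. c b \<in> K0" using v by (auto simp: std_basis_def c)
    ultimately show "rational_vec K0 N v" by (auto simp: rational_vec_def combs_def)
  qed
qed

abbreviation rat :: "nat \<Rightarrow> 'k vec set \<Rightarrow> bool" where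
  "rat \<equiv> rational_subspace K0"

section \<open>Spans, joins and inclusions of rational subspaces\<close>

lemma rational_lspan:
  assumes "\<And>v. v \<in> S \<Longrightarrow> rational_vec K0 N v"
  shows "rat N (lspan S)"
proof -
  have "S \<subseteq> vecs N" using assms by (auto simp: rational_vec_iff)
  then obtain B where "B \<subseteq> S" "finite B" "indep B" "lspan B = lspan S"
    using basis_exists[of S N "{}"] by auto
  then show ?thesis using assms unfolding rational_subspace_def is_basis_iff by blast
qed

lemma rational_subspace_iff:
  "rat N U \<longleftrightarrow> is_subspace N U \<and> lspan {v\<in>U. rational_vec K0 N v} = U"
proof
  assume "rat N U"
  then obtain B where B: "finite B" "lspan B = U" "\<forall>b\<in>B. rational_vec K0 N b"
    by (auto simp: rational_subspace_def is_basis_iff)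
  then have U: "is_subspace N U" using is_subspace_lspan[of B N] by (auto simp: rational_vec_iff)
  have "B \<subseteq> {v\<in>U. rational_vec K0 N v}" using B by (auto simp: lspan_inc)
  then have "U \<subseteq> lspan {v\<in>U. rational_vec K0 N v}" using B(2) hull_mono by metis
  moreover have "lspan {v\<in>U. rational_vec K0 N v} \<subseteq> U"
    using lspan_subset_iff[OF is_subspaceD(1)[OF U]] by auto
  ultimately show "is_subspace N U \<and> lspan {v\<in>U. rational_vec K0 N v} = U" using U by auto
next
  assume "is_subspace N U \<and> lspan {v\<in>U. rational_vec K0 N v} = U"
  then show "rat N U" using rational_lspan[of "{v\<in>U. rational_vec K0 N v}" N] by auto
qed

lemma rational_is_subspace: "rat N U \<Longrightarrow> is_subspace N U"
  by (simp add: rational_subspace_iff)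

text \<open>Mostly used contrapositively: a rational subspace that is not inside \<open>W\<close>
  contains a rational vector outside \<open>W\<close>.\<close>

lemma rational_subset:
  assumes "rat N U" "lsub W" "\<And>v. v \<in> U \<Longrightarrow> rational_vec K0 N v \<Longrightarrow> v \<in> W"
  shows "U \<subseteq> W"
proof -
  have "lspan {v\<in>U. rational_vec K0 N v} \<subseteq> W"
    unfolding lspan_subset_iff[OF assms(2)] using assms(3) by auto
  then show ?thesis using assms(1) by (simp add: rational_subspace_iff)
qed

lemma rational_Un:
  assumes "rat N U" "rat N W"
  shows "rat N (lspan (U \<union> W))"
proof -
  let ?S = "{v\<in>U. rational_vec K0 N v} \<union> {v\<in>W. rational_vec K0 N v}"
  have "lspan ?S = lspan (U \<union> W)"
    using assms hull_Un[of lsub "{v\<in>U. rational_vec K0 N v}" "{v\<in>W. rational_vec K0 N v}"]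
    by (auto simp: rational_subspace_iff lsub_Inter)
  then show ?thesis using rational_lspan[of ?S N] by auto
qed

lemma rational_insert:
  assumes "rat N U" "rational_vec K0 N v"
  shows "rat N (lspan (insert v U))"
  using rational_Un[OF rational_lspan[of "{v}" N] assms(1)] assms(2) hull_Un_left[of lsub "{v}" U]
  by simp

lemma rational_vecs: "rat N (vecs N)"
proof -
  have "rat N (lspan (std_basis N))"
    by (rule rational_lspan)
      (auto simp: rational_vec_iff std_basis_def vecs_def unit_vec_def K0_zero K0_one)
  then show ?thesis by (simp add: std_basis_span)
qed

section \<open>Left independence over \<open>K0\<close> and the rational components of a
  vector\<close>

definition left_indep :: "'k set \<Rightarrow> bool" where
  "left_indep L \<longleftrightarrow> (\<forall>c. (\<forall>l\<in>L. c l \<in> K0) \<longrightarrow> (\<Sum>l\<in>L. c l * l) = 0 \<longrightarrow> (\<forall>l\<in>L. c l = 0))"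

definition left_span :: "'k set \<Rightarrow> 'k set" where
  "left_span L = {\<Sum>l\<in>L. c l * l | c. \<forall>l\<in>L. c l \<in> K0}"

lemma left_span_mono:
  assumes "finite L'" "L \<subseteq> L'"
  shows "left_span L \<subseteq> left_span L'"
proof
  fix x assume "x \<in> left_span L"
  then obtain c where c: "x = (\<Sum>l\<in>L. c l * l)" "\<forall>l\<in>L. c l \<in> K0" by (auto simp: left_span_def)
  let ?d = "\<lambda>l. if l \<in> L then c l else 0"
  have "x = (\<Sum>l\<in>L'. ?d l * l)"
    unfolding c(1) using assms by (intro sum.mono_neutral_cong_left) auto
  moreover have "\<forall>l\<in>L'. ?d l \<in> K0" using c(2) K0_zero by auto
  ultimately show "x \<in> left_span L'" unfolding left_span_def
    by (intro CollectI exI[of _ ?d] conjI)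
qed

lemma left_span_inc: "finite L \<Longrightarrow> m \<in> L \<Longrightarrow> m \<in> left_span L"
proof -
  assume "finite L" "m \<in> L"
  then have "(\<Sum>l\<in>L. (if l = m then 1 else 0) * l) = m"
    by (simp add: if_distrib[of "\<lambda>x. x * _"] cong: if_cong)
  then show ?thesis
    unfolding left_span_def using K0_zero K0_one
    by (intro CollectI exI[of _ "\<lambda>l. if l = m then 1 else 0"]) auto
qed

lemma left_indep_insert:
  assumes "finite L" "left_indep L" "m \<notin> left_span L"
  shows "left_indep (insert m L)"
  unfolding left_indep_def
proof (intro allI impI)
  fix c assume c: "\<forall>l\<in>insert m L. c l \<in> K0" "(\<Sum>l\<in>insert m L. c l * l) = 0"
  have "m \<notin> L" using assms left_span_inc by blast
  then have s: "c m * m + (\<Sum>l\<in>L. c l * l) = 0" using c(2) assms(1) by simp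
  have "c m = 0"
  proof (rule ccontr)
    assume nz: "c m \<noteq> 0"
    have "m = inverse (c m) * (c m * m)" using nz by (simp flip: mult.assoc)
    also have "c m * m = - (\<Sum>l\<in>L. c l * l)" using s by (simp add: eq_neg_iff_add_eq_0)
    also have "inverse (c m) * \<dots> = - inverse (c m) * (\<Sum>l\<in>L. c l * l)" by simp
    also have "\<dots> = (\<Sum>l\<in>L. (- inverse (c m) * c l) * l)" by (simp add: sum_distrib_left mult.assoc)
    finally have "m = (\<Sum>l\<in>L. (- inverse (c m) * c l) * l)" .
    moreover have "\<forall>l\<in>L. - inverse (c m) * c l \<in> K0"
      using c(1) by (auto intro!: K0_mult K0_uminus K0_inverse simp del: mult_minus_left)
    ultimately have "m \<in> left_span L" unfolding left_span_def
      by (intro CollectI exI[of _ "\<lambda>l. - inverse (c m) * c l"] conjI)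
    with assms(3) show False by simp
  qed
  then show "\<forall>l\<in>insert m L. c l = 0" using s assms(2) c(1) unfolding left_indep_def by auto
qed

text \<open>Elements of \<open>F\<close> outside the current left span are added one at a time. That
  the old set \<open>L\<close> survives is essential for comparing two expansions later.\<close>

lemma left_indep_extend:
  assumes "finite L" "left_indep L" "finite F"
  obtains L' where "finite L'" "left_indep L'" "L \<subseteq> L'" "F \<subseteq> left_span L'"
  using assms(3,1,2)
proof (induction F arbitrary: thesis)
  case empty
  then show ?case by blast
next
  case (insert m F)
  obtain L' where L': "finite L'" "left_indep L'" "L \<subseteq> L'" "F \<subseteq> left_span L'"
    using insert.IH insert.prems by blast
  show ?case
  proof (cases "m \<in> left_span L'")
    case True
    with L' insert.prems show ?thesis by blast
  next
    case False
    have "insert m F \<subseteq> left_span (insert m L')"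
      using L' left_span_mono[of "insert m L'" L'] left_span_inc[of "insert m L'" m] by auto
    then show ?thesis
      using insert.prems(1)[of "insert m L'"] left_indep_insert[OF L'(1,2) False] L' by auto
  qed
qed

text \<open>Write \<open>x\<close> in a rational basis \<open>B\<close> of \<open>U\<close>, expand
  each coefficient over a left independent \<open>L'\<close>, and collect the terms belonging to the
  same \<open>l\<close>: their rational factors form the vector \<open>r l\<close>, a
  \<open>K0\<close>-combination of \<open>B\<close>. The scalars \<open>l\<close> act from the
  right, so the rational coordinates stand on their left; hence left independence.\<close>

lemma rational_decomposition:
  assumes "rat N U" "x \<in> U" "finite L" "left_indep L"
  obtains L' r where "finite L'" "left_indep L'" "L \<subseteq> L'" "x = (\<Sum>l\<in>L'. r l \<star> l)"
    "\<And>l. l \<in> L' \<Longrightarrow> r l \<in> U \<and> rational_vec K0 N (r l)"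
proof -
  obtain B where B: "finite B" "lspan B = U" "\<forall>b\<in>B. rational_vec K0 N b"
    using assms(1) by (auto simp: rational_subspace_def is_basis_iff)
  then obtain m where m: "x = (\<Sum>b\<in>B. b \<star> m b)"
    using assms(2) combs_UNIV[OF B(1)] by (auto simp: combs_def lincomb_eq)
  obtain L' where L': "finite L'" "left_indep L'" "L \<subseteq> L'" "m ` B \<subseteq> left_span L'"
    using left_indep_extend[OF assms(3,4), of "m ` B"] B(1) by blast
  have "\<forall>b\<in>B. \<exists>k. m b = (\<Sum>l\<in>L'. k l * l) \<and> (\<forall>l\<in>L'. k l \<in> K0)"
    using L'(4) by (auto simp: left_span_def)
  then obtain k where k: "\<And>b. b \<in> B \<Longrightarrow> m b = (\<Sum>l\<in>L'. k b l * l)"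
    "\<And>b l. b \<in> B \<Longrightarrow> l \<in> L' \<Longrightarrow> k b l \<in> K0"
    unfolding bchoice_iff by blast
  define r where "r l = (\<Sum>b\<in>B. b \<star> k b l)" for l
  have "x = (\<Sum>b\<in>B. \<Sum>l\<in>L'. b \<star> (k b l * l))"
    unfolding m using k(1) by (intro sum.cong) (auto simp: scl_sum)
  also have "\<dots> = (\<Sum>l\<in>L'. \<Sum>b\<in>B. b \<star> (k b l * l))" by (rule sum.swap)
  also have "\<dots> = (\<Sum>l\<in>L'. r l \<star> l)" by (simp add: r_def scl_sum)
  finally have "x = (\<Sum>l\<in>L'. r l \<star> l)" .
  moreover have "r l \<in> U \<and> rational_vec K0 N (r l)" if "l \<in> L'" for l
  proof
    show *: "r l \<in> U" using lspan_sum_scl[of B B] B(2) by (auto simp: r_def)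
    have "r l i \<in> K0" for i
      using B(3) k(2) that by (auto simp: r_def sum_fun_apply rational_vec_iff intro!: K0_sum K0_mult)
    then show "rational_vec K0 N (r l)"
      using * rational_is_subspace[OF assms(1)] by (auto simp: rational_vec_iff is_subspace_iff)
  qed
  ultimately show ?thesis using L' that by blast
qed

text \<open>The components are fixed once, by an expansion in the whole space. A rational
  \<open>U\<close> containing \<open>x\<close> gives a second expansion over some
  \<open>L' \<supseteq> L\<close>, and uniqueness of coefficients over \<open>L'\<close> identifies
  the two. The components therefore do not depend on \<open>U\<close> and lie in all such
  \<open>U\<close> at once.\<close>

lemma rational_components:
  assumes "x \<in> vecs N"
  obtains L r where "finite L" "left_indep L" "x = (\<Sum>l\<in>L. r l \<star> l)"
    "\<And>l. l \<in> L \<Longrightarrow> rational_vec K0 N (r l)"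
    "\<And>U l. rat N U \<Longrightarrow> x \<in> U \<Longrightarrow> l \<in> L \<Longrightarrow> r l \<in> U"
proof -
  have "left_indep {}" by (simp add: left_indep_def)
  from rational_decomposition[OF rational_vecs assms _ this]
  obtain L r where L: "finite L" "left_indep L" "x = (\<Sum>l\<in>L. r l \<star> l)"
    "\<And>l. l \<in> L \<Longrightarrow> rational_vec K0 N (r l)" by (metis finite.emptyI)
  have "r l \<in> U" if U: "rat N U" "x \<in> U" and l: "l \<in> L" for U l
  proof -
    from rational_decomposition[OF U L(1,2)] obtain L' r' where L':
      "finite L'" "left_indep L'" "L \<subseteq> L'" "x = (\<Sum>l\<in>L'. r' l \<star> l)"
      "\<And>l. l \<in> L' \<Longrightarrow> r' l \<in> U \<and> rational_vec K0 N (r' l)" by blast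
    have "r l i = r' l i" for i
    proof -
      \<comment> \<open>The first expansion is continued by 0 on \<open>L' - L\<close>, so both can
        be compared over \<open>L'\<close>.\<close>
      let ?c = "\<lambda>l. r' l i - (if l \<in> L then r l i else 0)"
      have "(\<Sum>l\<in>L'. ?c l * l) = (\<Sum>l\<in>L'. r' l i * l) - (\<Sum>l\<in>L'. (if l \<in> L then r l i else 0) * l)"
        by (simp add: sum_subtractf left_diff_distrib)
      also have "(\<Sum>l\<in>L'. (if l \<in> L then r l i else 0) * l) = (\<Sum>l\<in>L. r l i * l)"
        using L'(1,3) by (intro sum.mono_neutral_cong_right) auto
      also have "\<dots> = x i" unfolding L(3) by (simp add: sum_fun_apply)
      also have "(\<Sum>l\<in>L'. r' l i * l) = x i" unfolding L'(4) by (simp add: sum_fun_apply)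
      finally have "(\<Sum>l\<in>L'. ?c l * l) = 0" by simp
      moreover have "\<forall>l\<in>L'. ?c l \<in> K0"
        using L(4) L'(5) by (auto simp: rational_vec_iff intro: K0_diff)
      ultimately have "\<forall>l\<in>L'. ?c l = 0" using L'(2)[unfolded left_indep_def, rule_format, of ?c] by blast
      then have "?c l = 0" using L'(3) l by blast
      then show ?thesis using l by simp
    qed
    then have "r l = r' l" by auto
    then show ?thesis using L' l by auto
  qed
  with L that show ?thesis by blast
qed

text \<open>A subspace containing the components of all its vectors is spanned by rational vectors.
  The premise offers that the components of \<open>x\<close> lie in every rational subspace through
  \<open>x\<close>, which settles intersections at once.\<close>

lemma rationalI:
  assumes U: "is_subspace N U"
    and comp: "\<And>x L r l. \<lbrakk>x \<in> U; finite L; left_indep L; x = (\<Sum>l\<in>L. r l \<star> l);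
      \<And>l. l \<in> L \<Longrightarrow> rational_vec K0 N (r l); \<And>W l. rat N W \<Longrightarrow> x \<in> W \<Longrightarrow> l \<in> L \<Longrightarrow> r l \<in> W;
      l \<in> L\<rbrakk> \<Longrightarrow> r l \<in> U"
  shows "rat N U"
proof -
  let ?S = "{v\<in>U. rational_vec K0 N v}"
  have "x \<in> lspan ?S" if x: "x \<in> U" for x
  proof -
    have "x \<in> vecs N" using U x by (auto simp: is_subspace_iff)
    from rational_components[OF this] obtain L r where L: "finite L" "left_indep L" "x = (\<Sum>l\<in>L. r l \<star> l)"
      "\<And>l. l \<in> L \<Longrightarrow> rational_vec K0 N (r l)"
      "\<And>U l. rat N U \<Longrightarrow> x \<in> U \<Longrightarrow> l \<in> L \<Longrightarrow> r l \<in> U" by blast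
    then have "r l \<in> ?S" if "l \<in> L" for l using comp[OF x L(1-3)] that by blast
    then show ?thesis unfolding L(3) by (intro lsub_sum lsubD(3) lsub_lspan lspan_inc)
  qed
  moreover have "lspan ?S \<subseteq> U" using lspan_subset_iff[OF is_subspaceD(1)[OF U]] by auto
  ultimately show ?thesis using U by (auto simp: rational_subspace_iff)
qed

lemma rational_Int:
  assumes "rat N U" "rat N W"
  shows "rat N (U \<inter> W)"
proof (rule rationalI)
  show "is_subspace N (U \<inter> W)" using assms by (simp add: is_subspace_Int rational_is_subspace)
qed (use assms in blast)

lemma functional_sum:
  fixes f :: "'k vec \<Rightarrow> 'k"
  assumes f_add: "\<And>u v. f (u + v) = f u + f v" and f_scl: "\<And>u a. f (u \<star> a) = f u * a"
  shows "f (\<Sum>l\<in>L. r l \<star> g l) = (\<Sum>l\<in>L. f (r l) * g l)"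
proof -
  have f0: "f 0 = 0" using f_add[of 0 0] by simp
  show ?thesis
  proof (induction L rule: infinite_finite_induct)
    case (insert l L)
    show ?case
      unfolding sum.insert[OF insert.hyps] by (simp only: f_add f_scl insert.IH)
  qed (simp_all only: sum.infinite sum.empty f0 not_False_eq_True)
qed

text \<open>By right linearity \<open>f x\<close> is the sum of the \<open>f (r l) * l\<close>,
  whose factors \<open>f (r l)\<close> lie in \<open>K0\<close>. If it vanishes, left independence
  makes every \<open>f (r l)\<close> vanish, so the kernel contains the components of
  \<open>x\<close>.\<close>

lemma rational_kernel:
  fixes f :: "'k vec \<Rightarrow> 'k"
  assumes "rat N U" and f_add: "\<And>u v. f (u + v) = f u + f v" and f_scl: "\<And>u a. f (u \<star> a) = f u * a"
    and K0: "\<And>v. rational_vec K0 N v \<Longrightarrow> f v \<in> K0"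
  shows "rat N {x\<in>U. f x = 0}"
proof (rule rationalI)
  have f0: "f 0 = 0" using f_add[of 0 0] by simp
  show "is_subspace N {x\<in>U. f x = 0}"
    using rational_is_subspace[OF assms(1)] f0 by (auto simp: is_subspace_iff lsub_def f_add f_scl)
  fix x L r l
  assume x: "x \<in> {x\<in>U. f x = 0}" and L: "finite L" "left_indep L" "x = (\<Sum>l\<in>L. r l \<star> l)"
    and r: "\<And>l. l \<in> L \<Longrightarrow> rational_vec K0 N (r l)"
    and W: "\<And>W l. rat N W \<Longrightarrow> x \<in> W \<Longrightarrow> l \<in> L \<Longrightarrow> r l \<in> W" and l: "l \<in> L"
  have "f (\<Sum>l\<in>L. r l \<star> l) = (\<Sum>l\<in>L. f (r l) * l)"
    using f_add f_scl by (rule functional_sum)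
  then have "(\<Sum>l\<in>L. f (r l) * l) = 0" using x L(3) by simp
  then have "f (r l) = 0"
    using L(2)[unfolded left_indep_def, rule_format, of "\<lambda>l. f (r l)"] K0 r l by blast
  then show "r l \<in> {x\<in>U. f x = 0}" using W[OF assms(1)] x l by auto
qed

end

section \<open>Grassmannians of flags\<close>

text \<open>The condition on types in \<open>flags_of_type\<close> allows several elements of the
  same type; this property excludes it and is checked separately for the buildings of types A and
  D.\<close>

definition type_separated :: "('e, 't) geometry \<Rightarrow> bool" where
  "type_separated X \<longleftrightarrow>
    (\<forall>x\<in>elems X. \<forall>y\<in>elems X. inc X x y \<longrightarrow> etype X x = etype X y \<longrightarrow> x = y)"

lemma flag_type_unique:
  assumes "type_separated X" "is_flag X F" "x \<in> F" "y \<in> F" "etype X x = etype X y"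
  shows "x = y"
  using assms unfolding type_separated_def is_flag_def pairwise_def by blast

lemma flagD:
  assumes "is_flag X F" "x \<in> F" "y \<in> F" "x \<noteq> y"
  shows "inc X x y"
  using assms by (auto simp: is_flag_def pairwise_def)

text \<open>Both orders of \<open>inc\<close> appear because \<open>pairwise\<close> demands both
  and the record \<open>geometry\<close> carries no symmetry axiom.\<close>

lemma flags_of_type2:
  assumes "type_separated X" "a \<noteq> b"
  shows "F \<in> flags_of_type X {a, b} \<longleftrightarrow>
    (\<exists>x y. F = {x, y} \<and> x \<in> elems X \<and> y \<in> elems X \<and> etype X x = a \<and> etype X y = b \<and>
      inc X x y \<and> inc X y x)" (is "?L \<longleftrightarrow> ?R")
proof
  assume L: ?L
  then have F: "is_flag X F" "etype X ` F = {a, b}" by (auto simp: flags_of_type_def)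
  then obtain x y where xy: "x \<in> F" "y \<in> F" "etype X x = a" "etype X y = b" by (metis imageE insertI1 insert_commute)
  have "F \<subseteq> {x, y}"
  proof
    fix z assume "z \<in> F"
    moreover from this have "etype X z = a \<or> etype X z = b" using F(2) by auto
    ultimately show "z \<in> {x, y}" using flag_type_unique[OF assms(1) F(1)] xy by blast
  qed
  with xy have "F = {x, y}" by auto
  moreover have "x \<noteq> y" using xy assms(2) by auto
  ultimately show ?R using xy F(1) flagD[OF F(1)] unfolding is_flag_def by blast
next
  assume ?R
  then show ?L by (auto simp: flags_of_type_def is_flag_def pairwise_def)
qed

lemma flags_of_type3:
  assumes "type_separated X" "a \<noteq> b" "a \<noteq> c" "b \<noteq> c"
  shows "F \<in> flags_of_type X {a, b, c} \<longleftrightarrow>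
    (\<exists>x y z. F = {x, y, z} \<and> x \<in> elems X \<and> y \<in> elems X \<and> z \<in> elems X \<and>
      etype X x = a \<and> etype X y = b \<and> etype X z = c \<and>
      inc X x y \<and> inc X y x \<and> inc X x z \<and> inc X z x \<and> inc X y z \<and> inc X z y)" (is "?L \<longleftrightarrow> ?R")
proof
  assume L: ?L
  then have F: "is_flag X F" "etype X ` F = {a, b, c}" by (auto simp: flags_of_type_def)
  then obtain x where x: "x \<in> F" "etype X x = a" by (metis imageE insertI1)
  obtain y where y: "y \<in> F" "etype X y = b" using F(2) by (metis imageE insertI1 insert_commute)
  obtain z where z: "z \<in> F" "etype X z = c" using F(2) by (metis imageE insertI1 insert_commute)
  have "F \<subseteq> {x, y, z}"
  proof
    fix w assume "w \<in> F"
    moreover from this have "etype X w = a \<or> etype X w = b \<or> etype X w = c" using F(2) by auto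
    ultimately show "w \<in> {x, y, z}" using flag_type_unique[OF assms(1) F(1)] x y z by blast
  qed
  with x y z have "F = {x, y, z}" by auto
  moreover have "x \<noteq> y" "x \<noteq> z" "y \<noteq> z" using x y z assms(2-4) by auto
  ultimately show ?R using x y z F(1) flagD[OF F(1)] unfolding is_flag_def by blast
next
  assume ?R
  then show ?L by (auto simp: flags_of_type_def is_flag_def pairwise_def)
qed

text \<open>
  A line of type \<open>(J - {j}) \<union> fr(j)\<close> fixes the part of its points of type \<open>J - {j}\<close>, so its points
  differ only in their element of type \<open>j\<close>.
\<close>

lemma gr_subspaceI:
  assumes sep: "type_separated X" and S: "S \<subseteq> gr_points X J"
    and line: "\<And>j L L0 p q r. \<lbrakk>j \<in> J; L \<in> flags_of_type X ((J - {j}) \<union> fr X j);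
      L0 = {h\<in>L. etype X h \<in> J - {j}};
      is_flag X (insert p L); etype X p = j; is_flag X (insert q L); etype X q = j;
      is_flag X (insert r L); etype X r = j; p \<noteq> q;
      insert p L0 \<in> S; insert q L0 \<in> S\<rbrakk> \<Longrightarrow> insert r L0 \<in> S"
  shows "gr_subspace X J S"
  unfolding gr_subspace_def
proof (intro conjI ballI impI S subsetI)
  fix L R
  assume "L \<in> gr_lines X J"
    and "\<exists>P\<in>S \<inter> points_on X J L. \<exists>Q\<in>S \<inter> points_on X J L. P \<noteq> Q"
    and R: "R \<in> points_on X J L"
  then obtain j P Q where j: "j \<in> J" and L: "L \<in> flags_of_type X ((J - {j}) \<union> fr X j)"
    and P: "P \<in> S" "P \<in> points_on X J L" and Q: "Q \<in> S" "Q \<in> points_on X J L" and "P \<noteq> Q"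
    by (auto simp: gr_lines_def)
  define L0 where "L0 = {h\<in>L. etype X h \<in> J - {j}}"
  have *: "\<exists>p. is_flag X (insert p L) \<and> etype X p = j \<and> T = insert p L0" if T: "T \<in> points_on X J L" for T
  proof -
    have f: "is_flag X (T \<union> L)" and T': "etype X ` T = J"
      using T by (auto simp: points_on_def gr_points_def flags_of_type_def)
    have L': "J - {j} \<subseteq> etype X ` L" using L by (auto simp: flags_of_type_def)
    obtain p where p: "p \<in> T" "etype X p = j" using T' j by auto
    note u = flag_type_unique[OF sep f]
    have "x \<in> T \<longleftrightarrow> x \<in> insert p L0" for x
    proof
      assume x: "x \<in> T"
      show "x \<in> insert p L0"
      proof (cases "etype X x = j")
        case True
        then show ?thesis using u x p by auto
      next
        case False
        then have "etype X x \<in> J - {j}" using x T' by auto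
        moreover from this obtain h where "h \<in> L" "etype X h = etype X x" using L' by (metis imageE subsetD)
        ultimately show ?thesis using u[of h x] x by (auto simp: L0_def)
      qed
    next
      assume x: "x \<in> insert p L0"
      show "x \<in> T"
      proof (cases "x = p")
        case False
        then have x: "x \<in> L" "etype X x \<in> J" using x by (auto simp: L0_def)
        then obtain y where "y \<in> T" "etype X y = etype X x" using T' by (metis imageE)
        then show ?thesis using u[of y x] x by auto
      qed (use p in simp)
    qed
    moreover have "is_flag X (insert p L)"
      using f p by (auto simp: is_flag_def pairwise_def)
    ultimately show ?thesis using p(2) by blast
  qed
  obtain p q r where "is_flag X (insert p L)" "etype X p = j" "P = insert p L0"
    "is_flag X (insert q L)" "etype X q = j" "Q = insert q L0"
    "is_flag X (insert r L)" "etype X r = j" "R = insert r L0"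
    using *[OF P(2)] *[OF Q(2)] *[OF R] by blast
  then show "R \<in> S" using line[OF j L L0_def] P(1) Q(1) \<open>P \<noteq> Q\<close> by blast
qed

text \<open>\<open>I\<close> is a union of components of the diagram without \<open>t\<close>, up to
  nodes outside it, and it separates two members of \<open>J\<close>; hence no component contains
  \<open>J\<close>.\<close>

lemma splitsI:
  assumes "t \<in> nodes X" "t \<notin> J" "a \<in> J" "b \<in> J" "a \<in> I" "b \<notin> I"
    and inv: "\<And>x y. \<lbrakk>x \<in> nodes X; y \<in> nodes X; x \<noteq> t; y \<noteq> t; adj X x y\<rbrakk> \<Longrightarrow> x \<in> I \<longleftrightarrow> y \<in> I"
  shows "splits X t J"
proof -
  define R where "R = {(a, b). a \<in> nodes X - {t} \<and> b \<in> nodes X - {t} \<and> adj X a b}"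
  have *: "x \<in> I \<longleftrightarrow> y \<in> I" if "(x, y) \<in> R\<^sup>*" for x y
    using that by induction (use inv in \<open>auto simp: R_def\<close>)
  have "\<not> J \<subseteq> {y. (x, y) \<in> R\<^sup>*}" for x
    using *[of x a] *[of x b] assms(3-6) by blast
  then show ?thesis
    using assms(1,2) by (auto simp: splits_def components_without_def Let_def R_def)
qed

lemma not_splitsI:
  assumes "a \<in> nodes X" "a \<noteq> t"
    and "\<And>b. b \<in> J \<Longrightarrow> (a, b) \<in> {(a, b). a \<in> nodes X - {t} \<and> b \<in> nodes X - {t} \<and> adj X a b}\<^sup>*"
  shows "\<not> splits X t J"
  using assms by (auto simp: splits_def components_without_def Let_def)


section \<open>The building of type A\<close>

lemma A_simps [simp]:
  "elems (A_building n) = {U. is_subspace (n + 1) U \<and> vdim U \<in> {1..n}}"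
  "etype (A_building n) = vdim"
  "inc (A_building n) X Y \<longleftrightarrow> X \<subseteq> Y \<or> Y \<subseteq> X"
  "nodes (A_building n) = {1..n}"
  "adj (A_building n) i j \<longleftrightarrow> j = i + 1 \<or> i = j + 1"
  by (simp_all add: A_building_def)

lemma A_type_separated: "type_separated (A_building n)"
proof -
  have "x = y" if "is_subspace (n + 1) x" "is_subspace (n + 1) y" "x \<subseteq> y \<or> y \<subseteq> x" "vdim x = vdim y"
    for x y :: "'a vec set"
    using that vdim_equal[OF that(1,2)] vdim_equal[OF that(2,1)] by auto
  then show ?thesis unfolding type_separated_def by (simp only: A_simps mem_Collect_eq) blast
qed

lemma A_points:
  assumes "n \<ge> 2"
  shows "F \<in> gr_points (A_building n) {1, n} \<longleftrightarrow>
    (\<exists>p H. F = {p, H} \<and> is_subspace (n + 1) p \<and> is_subspace (n + 1) H \<and> vdim p = 1 \<and> vdim H = n \<and> p \<subseteq> H)"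
proof -
  have dims: "\<not> H \<subseteq> p" if "is_subspace (n + 1) p" "is_subspace (n + 1) H" "vdim p = 1" "vdim H = n"
    for p H :: "'a vec set"
    using vdim_mono[OF that(2,1)] that assms by auto
  have "1 \<noteq> n" using assms by simp
  have "F \<in> gr_points (A_building n) {1, n} \<longleftrightarrow>
    (\<exists>p H. F = {p, H} \<and> is_subspace (n + 1) p \<and> is_subspace (n + 1) H \<and> vdim p = 1 \<and> vdim H = n \<and>
      (p \<subseteq> H \<or> H \<subseteq> p))"
    using assms unfolding gr_points_def flags_of_type2[OF A_type_separated \<open>1 \<noteq> n\<close>] A_simps mem_Collect_eq
    by (intro iff_exI) auto
  then show ?thesis using dims by metis
qed

context division_subring
begin

text \<open>A rational \<open>U\<close> of dimension 1 or \<open>n\<close> is \<open>p\<close> or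
  \<open>H\<close> itself, and every dimension in between is an inner node of the path and splits
  its two ends. Conversely, an incident \<open>y\<close> has dimension between 1 and
  \<open>n\<close>, which forces it to lie between \<open>p\<close> and \<open>H\<close>.\<close>

lemma Omega_A_iff:
  assumes n: "n \<ge> 2" and p: "is_subspace (n + 1) p" "vdim p = 1" and H: "is_subspace (n + 1) H" "vdim H = n"
    and "p \<subseteq> H"
  shows "{p, H} \<in> Omega_A K0 n {1, n} \<longleftrightarrow> (\<exists>U. rat (n + 1) U \<and> p \<subseteq> U \<and> U \<subseteq> H)"
proof
  assume "{p, H} \<in> Omega_A K0 n {1, n}"
  then consider "rat (n + 1) p" | "rat (n + 1) H"
    | y where "is_subspace (n + 1) y" "vdim y \<in> {1..n}" "rat (n + 1) y" "y \<subseteq> p \<or> p \<subseteq> y" "y \<subseteq> H \<or> H \<subseteq> y"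
    unfolding Omega_A_def nearly_rational_points_def by auto
  then show "\<exists>U. rat (n + 1) U \<and> p \<subseteq> U \<and> U \<subseteq> H"
  proof cases
    case (3 y)
    have "p \<subseteq> y" using 3 vdim_equal[OF 3(1) p(1)] p(2) by auto
    moreover have "y \<subseteq> H" using 3 vdim_equal[OF H(1) 3(1)] H(2) by auto
    ultimately show ?thesis using 3 by blast
  qed (use assms in blast)+
next
  assume "\<exists>U. rat (n + 1) U \<and> p \<subseteq> U \<and> U \<subseteq> H"
  then obtain U where U: "rat (n + 1) U" "p \<subseteq> U" "U \<subseteq> H" by blast
  note sU = rational_is_subspace[OF U(1)]
  have dim: "1 \<le> vdim U" "vdim U \<le> n" using vdim_mono[OF p(1) sU U(2)] vdim_mono[OF sU H(1) U(3)] p H by auto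
  have pt: "{p, H} \<in> gr_points (A_building n) {1, n}" using A_points[OF n] assms by blast
  consider "vdim U = 1" | "vdim U = n" | "2 \<le> vdim U" "vdim U < n" using dim by linarith
  then show "{p, H} \<in> Omega_A K0 n {1, n}"
  proof cases
    case 1
    then have "U = p" using vdim_equal[OF p(1) sU U(2)] p(2) by simp
    then show ?thesis using pt U by (auto simp: Omega_A_def nearly_rational_points_def)
  next
    case 2
    then have "U = H" using vdim_equal[OF sU H(1) U(3)] H(2) by simp
    then show ?thesis using pt U by (auto simp: Omega_A_def nearly_rational_points_def)
  next
    case 3
    \<comment> \<open>Deleting an inner node cuts the path; \<open>{..<vdim U}\<close> is the side
      of node 1.\<close>
    have "splits (A_building n) (vdim U) {1, n}"
      by (rule splitsI[of _ _ _ 1 n "{..<vdim U}"]) (use 3 in auto)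
    then show ?thesis using pt U sU dim unfolding Omega_A_def nearly_rational_points_def by auto
  qed
qed

lemma A_subspace:
  assumes n: "n \<ge> 3"
  shows "gr_subspace (A_building n) {1, n} (Omega_A K0 n {1, n})"
proof (rule gr_subspaceI[OF A_type_separated])
  show "Omega_A K0 n {1, n} \<subseteq> gr_points (A_building n) {1, n}"
    by (auto simp: Omega_A_def nearly_rational_points_def)
next
  fix j L L0 p q r
  let ?X = "A_building n :: ('k vec set, nat) geometry" and ?S = "Omega_A K0 n {1, n}"
  assume j: "j \<in> {1, n}" and L: "L \<in> flags_of_type ?X ({1, n} - {j} \<union> fr ?X j)"
    and L0: "L0 = {h \<in> L. etype ?X h \<in> {1, n} - {j}}"
    and p: "is_flag ?X (insert p L)" "etype ?X p = j" and q: "is_flag ?X (insert q L)" "etype ?X q = j"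
    and r: "is_flag ?X (insert r L)" "etype ?X r = j" and "p \<noteq> q"
    and S: "insert p L0 \<in> ?S" "insert q L0 \<in> ?S"
  have sub: "is_subspace (n + 1) p" "is_subspace (n + 1) q" "is_subspace (n + 1) r"
    using p q r by (auto simp: is_flag_def)
  from j consider "j = 1" | "j = n" by blast
  then show "insert r L0 \<in> ?S"
  proof cases
    case 1
    \<comment> \<open>On such a line \<open>H\<close> is fixed and the 1-dimensional element runs
      through the plane \<open>W\<close>.\<close>
    have "fr ?X 1 = {2}" using n by (auto simp: fr_def)
    moreover have "{1, n} - {1} = {n}" using n by auto
    ultimately have "L \<in> flags_of_type ?X {n, 2}" using L 1 by (simp add: insert_commute)
    then obtain H W where HW: "L = {H, W}" "is_subspace (n + 1) H" "is_subspace (n + 1) W" "vdim H = n" "vdim W = 2"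
      using n by (subst (asm) flags_of_type2[OF A_type_separated]) auto
    have L0: "L0 = {H}" using n by (auto simp: L0 HW 1)
    have sub1: "x \<subseteq> W \<and> x \<subseteq> H" if "is_flag ?X (insert x L)" "vdim x = 1" "is_subspace (n + 1) x" for x
    proof -
      have "\<not> W \<subseteq> x" "\<not> H \<subseteq> x" 
        using vdim_mono[OF HW(3) that(3)] vdim_mono[OF HW(2) that(3)] HW(4,5) that(2) n by auto
      moreover have "x \<noteq> W" "x \<noteq> H" using that HW n by auto
      ultimately show ?thesis using flagD[OF that(1), of x W] flagD[OF that(1), of x H] HW by auto
    qed
    note p' = sub1[OF p(1) _ sub(1)] and q' = sub1[OF q(1) _ sub(2)] and r' = sub1[OF r(1) _ sub(3)]
    have dims: "vdim p = 1" "vdim q = 1" "vdim r = 1" using p q r 1 by auto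
    have iff: "insert x L0 \<in> ?S \<longleftrightarrow> (\<exists>U. rat (n + 1) U \<and> x \<subseteq> U \<and> U \<subseteq> H)"
      if "is_subspace (n + 1) x" "vdim x = 1" "x \<subseteq> H" for x
      using Omega_A_iff[of n x H] that HW n by (simp add: L0)
    obtain U U' where U: "rat (n + 1) U" "p \<subseteq> U" "U \<subseteq> H" "rat (n + 1) U'" "q \<subseteq> U'" "U' \<subseteq> H"
    proof -
      have "\<exists>U. rat (n + 1) U \<and> p \<subseteq> U \<and> U \<subseteq> H" using iff[OF sub(1) dims(1)] S(1) p' dims by simp
      moreover have "\<exists>U. rat (n + 1) U \<and> q \<subseteq> U \<and> U \<subseteq> H" using iff[OF sub(2) dims(2)] S(2) q' dims by simp
      ultimately show ?thesis using that by blast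
    qed
    have "W = lspan (p \<union> q)"
      using plane_span[OF sub(1,2) HW(3) dims(1,2) HW(5)] \<open>p \<noteq> q\<close> p' q' dims by auto
    also have "\<dots> \<subseteq> lspan (U \<union> U')" using U by (intro hull_mono) auto
    finally have "r \<subseteq> lspan (U \<union> U')" using r' dims by auto
    moreover have "lspan (U \<union> U') \<subseteq> H"
      unfolding lspan_subset_iff[OF is_subspaceD(1)[OF HW(2)]] using U by auto
    ultimately show ?thesis using iff[OF sub(3) dims(3)] rational_Un[OF U(1,4)] r' dims by auto
  next
    case 2
    \<comment> \<open>The dual kind of line: \<open>x\<close> is fixed and the hyperplane runs
      through the pencil with axis \<open>K\<close>.\<close>
    have "fr ?X n = {n - 1}" using n by (auto simp: fr_def)
    moreover have "{1, n} - {n} = {1}" using n by auto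
    ultimately have "L \<in> flags_of_type ?X {1, n - 1}" using L 2 by (simp add: insert_commute)
    then obtain x K where xK: "L = {x, K}" "is_subspace (n + 1) x" "is_subspace (n + 1) K" "vdim x = 1"
        "vdim K = n - 1" "x \<subseteq> K \<or> K \<subseteq> x"
      using n by (subst (asm) flags_of_type2[OF A_type_separated]) auto
    have L0: "L0 = {x}" using n by (auto simp: L0 xK 2)
    have "x \<subseteq> K" using xK vdim_mono[OF xK(3,2)] n by auto
    have sub1: "K \<subseteq> H" if "is_flag ?X (insert H L)" "vdim H = n" "is_subspace (n + 1) H" for H
    proof -
      have "\<not> H \<subseteq> K" using vdim_mono[OF that(3) xK(3)] xK(5) that(2) n by auto
      moreover have "H \<noteq> K" using that xK n by auto
      ultimately show ?thesis using flagD[OF that(1), of H K] xK by auto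
    qed
    note p' = sub1[OF p(1) _ sub(1)] and q' = sub1[OF q(1) _ sub(2)] and r' = sub1[OF r(1) _ sub(3)]
    have dims: "vdim p = n" "vdim q = n" "vdim r = n" using p q r 2 by auto
    have iff: "insert H L0 \<in> ?S \<longleftrightarrow> (\<exists>U. rat (n + 1) U \<and> x \<subseteq> U \<and> U \<subseteq> H)"
      if "is_subspace (n + 1) H" "vdim H = n" "K \<subseteq> H" for H
      using Omega_A_iff[of n x H] that xK n \<open>x \<subseteq> K\<close> by (simp add: L0 insert_commute)
    obtain U U' where U: "rat (n + 1) U" "x \<subseteq> U" "U \<subseteq> p" "rat (n + 1) U'" "x \<subseteq> U'" "U' \<subseteq> q"
    proof -
      have "\<exists>U. rat (n + 1) U \<and> x \<subseteq> U \<and> U \<subseteq> p" using iff[OF sub(1) dims(1)] S(1) p' dims by simp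
      moreover have "\<exists>U. rat (n + 1) U \<and> x \<subseteq> U \<and> U \<subseteq> q" using iff[OF sub(2) dims(2)] S(2) q' dims by simp
      ultimately show ?thesis using that by blast
    qed
    have "p \<inter> q = K"
      by (rule hyperplanes_Int[OF sub(1,2) xK(3)]) (use \<open>p \<noteq> q\<close> p' q' dims xK in auto)
    then have "U \<inter> U' \<subseteq> r" using U r' dims by auto
    moreover have "x \<subseteq> U \<inter> U'" using U by blast
    ultimately show ?thesis using iff[OF sub(3) dims(3)] rational_Int[OF U(1,4)] r' dims by auto
  qed
qed

text \<open>The hyperplane \<open>H\<close> given by \<open>x 2 = a * x 1\<close> contains the point
  spanned by \<open>v = unit_vec 1 + unit_vec 2 \<star> a\<close>. A rational vector of
  \<open>H\<close> with \<open>x 1 \<noteq> 0\<close> would give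
  \<open>a = x 2 * inverse (x 1)\<close>, an element of \<open>K0\<close>; so rational subspaces of
  \<open>H\<close> satisfy \<open>x 1 = 0\<close> and miss \<open>v\<close>. The factor
  \<open>a\<close> stands on the left in the equation to make it right linear.\<close>

lemma A_proper:
  assumes n: "n \<ge> 3" and "a \<notin> K0"
  shows "Omega_A K0 n {1, n} \<noteq> gr_points (A_building n) {1, n}"
proof -
  let ?f = "\<lambda>x :: 'k vec. x 2 - a * x 1"
  define v :: "'k vec" where "v = unit_vec 1 + unit_vec 2 \<star> a"
  define H where "H = {x \<in> vecs (n + 1). ?f x = 0}"
  have f: "?f (x + y) = ?f x + ?f y" "?f (x \<star> b) = ?f x * b" for x y b
    by (simp_all add: algebra_simps)
  have sH: "is_subspace (n + 1) H"
    unfolding H_def by (rule functional_kernel[OF is_subspace_vecs f])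
  have "vdim (vecs (n + 1) :: 'k vec set) \<le> vdim H + 1"
    unfolding H_def by (rule vdim_kernel[OF is_subspace_vecs f])
  moreover have "unit_vec 2 \<in> vecs (n + 1) - H" using n by (auto simp: H_def vecs_def unit_vec_def)
  then have "H \<subset> vecs (n + 1)" by (auto simp: H_def)
  then have "vdim H < vdim (vecs (n + 1) :: 'k vec set)" by (rule vdim_less[OF sH is_subspace_vecs])
  ultimately have dH: "vdim H = n" by simp
  have v: "v \<in> vecs (n + 1)" "v \<in> H"
    using n by (auto simp: v_def H_def vecs_def unit_vec_def)
  have "v 1 = 1" by (simp add: v_def unit_vec_def)
  then have "v \<noteq> 0" by auto
  define p where "p = lspan {v}"
  have sp: "is_subspace (n + 1) p" unfolding p_def using v by (intro is_subspace_lspan) auto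
  have dp: "vdim p = 1" unfolding p_def using vdim_line v \<open>v \<noteq> 0\<close> by blast
  have "p \<subseteq> H" unfolding p_def lspan_subset_iff[OF is_subspaceD(1)[OF sH]] using v by simp
  then have "{p, H} \<in> gr_points (A_building n) {1, n}" using A_points[of n "{p, H}"] n sp sH dp dH by auto
  moreover have "{p, H} \<notin> Omega_A K0 n {1, n}"
  proof
    assume "{p, H} \<in> Omega_A K0 n {1, n}"
    then obtain U where U: "rat (n + 1) U" "p \<subseteq> U" "U \<subseteq> H"
      using Omega_A_iff[OF _ sp dp sH dH \<open>p \<subseteq> H\<close>] n by auto
    have "U \<subseteq> {x. x 1 = 0}"
    proof (rule rational_subset[OF U(1)])
      fix x assume x: "x \<in> U" "rational_vec K0 (n + 1) x"
      then have "x 2 = a * x 1" using U by (auto simp: H_def)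
      show "x \<in> {x. x 1 = 0}"
      proof (rule ccontr)
        assume "x \<notin> {x. x 1 = 0}"
        then have "a = x 2 * inverse (x 1)" using \<open>x 2 = a * x 1\<close> by (simp add: mult.assoc)
        then show False using assms(2) x(2) by (auto simp: rational_vec_iff intro: K0_mult K0_inverse)
      qed
    qed (auto simp: lsub_def)
    moreover have "v \<in> U" using U(2) by (auto simp: p_def lspan_inc)
    ultimately show False by (auto simp: v_def unit_vec_def)
  qed
  ultimately show ?thesis by blast
qed

lemma A_proper_gr_subspace:
  assumes "a \<notin> K0" "n \<ge> 3"
  shows "proper_gr_subspace (A_building n) {1, n} (Omega_A K0 n {1, n})"
  unfolding proper_gr_subspace_def using A_subspace A_proper assms by blast

end

section \<open>The hyperbolic quadric\<close>

text \<open>The polar form of \<open>quad\<close>, as \<open>quad_add\<close> shows under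
  commutativity.\<close>

definition bil :: "nat \<Rightarrow> 'k::division_ring vec \<Rightarrow> 'k vec \<Rightarrow> 'k" where
  "bil n x y = (\<Sum>i=1..n. x (2 * i - 1) * y (2 * i) + x (2 * i) * y (2 * i - 1))"

text \<open>The varying vector is the second argument of \<open>bil\<close>, in which the form is
  right linear over any division ring, so this is always a subspace.\<close>

definition perp :: "nat \<Rightarrow> 'k::division_ring vec set \<Rightarrow> 'k vec set" where
  "perp n X = {x \<in> vecs (2 * n). \<forall>b\<in>X. bil n b x = 0}"

lemma bil_linear:
  "bil n b (x + y) = bil n b x + bil n b y"
  "bil n b (x \<star> a) = bil n b x * a"
  "bil n (b + c) x = bil n b x + bil n c x"
  by (simp_all add: bil_def sum_distrib_right sum.distrib algebra_simps)

lemma bil_0 [simp]: "bil n b 0 = 0" "bil n 0 b = 0"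
  by (simp_all add: bil_def)

lemma bil_unit_vec:
  assumes i: "i \<in> {1..n}"
  shows "bil n (unit_vec (2 * i - 1)) x = x (2 * i)" "bil n (unit_vec (2 * i)) x = x (2 * i - 1)"
proof -
  have idx: "2 * j - 1 = 2 * i - 1 \<longleftrightarrow> j = i" "2 * j \<noteq> 2 * i - 1" "2 * j - 1 \<noteq> 2 * i" if "j \<in> {1..n}" for j
    using that i by (simp, presburger)+
  have "bil n (unit_vec (2 * i - 1)) x = (\<Sum>j=1..n. if j = i then x (2 * i) else 0)"
    unfolding bil_def by (rule sum.cong)
      (auto simp only: unit_vec_def idx if_True if_False mult_1 mult_zero_left add_0 add_0_right
        mult_cancel1 zero_neq_numeral split: if_splits)
  then show "bil n (unit_vec (2 * i - 1)) x = x (2 * i)" using i by simp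
  have "bil n (unit_vec (2 * i)) x = (\<Sum>j=1..n. if j = i then x (2 * i - 1) else 0)"
    unfolding bil_def by (rule sum.cong)
      (auto simp only: unit_vec_def idx if_True if_False mult_1 mult_zero_left add_0 add_0_right
        mult_cancel1 zero_neq_numeral split: if_splits)
  then show "bil n (unit_vec (2 * i)) x = x (2 * i - 1)" using i by simp
qed

section \<open>Orthogonal spaces and the number of linear conditions they impose\<close>

lemma perp_subset_vecs: "perp n X \<subseteq> vecs (2 * n)"
  by (auto simp: perp_def)

lemma perp_anti: "X \<subseteq> Y \<Longrightarrow> perp n Y \<subseteq> perp n X"
  by (auto simp: perp_def)

lemma perp_Un: "perp n (X \<union> Y) = perp n X \<inter> perp n Y"
  by (auto simp: perp_def)

lemma Int_perp_insert: "Y \<inter> perp n (insert b F) = {x \<in> Y \<inter> perp n F. bil n b x = 0}"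
  by (auto simp: perp_def)

lemma is_subspace_perp [simp]: "is_subspace (2 * n) (perp n X)"
  by (auto simp: is_subspace_iff lsub_def perp_def vecs_def bil_linear)

lemma vdim_Int_perp:
  assumes "is_subspace (2 * n) Y" "finite F"
  shows "vdim Y \<le> vdim (Y \<inter> perp n F) + card F"
  using assms(2)
proof induction
  case empty
  have "Y \<inter> perp n {} = Y" using assms(1) by (auto simp: perp_def is_subspace_iff)
  then show ?case by simp
next
  case (insert b F)
  have "is_subspace (2 * n) (Y \<inter> perp n F)" using assms(1) by (simp add: is_subspace_Int)
  then have "vdim (Y \<inter> perp n F) \<le> vdim (Y \<inter> perp n (insert b F)) + 1"
    unfolding Int_perp_insert by (rule vdim_kernel) (simp_all add: bil_linear)
  then show ?case using insert by simp
qed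

lemma perp_vecs: "perp n (vecs (2 * n)) = {0 :: 'k::division_ring vec}"
proof -
  have "x = 0" if x: "x \<in> perp n (vecs (2 * n))" for x :: "'k vec"
  proof
    fix j show "x j = 0 j"
    proof (cases "j \<in> {1..2 * n}")
      case False
      then show ?thesis using x by (auto simp: perp_def vecs_def)
    next
      case True
      \<comment> \<open>The index of the hyperbolic pair that contains coordinate
        \<open>j\<close>.\<close>
      define i where "i = (j + 1) div 2"
      have i: "i \<in> {1..n}" and "j = 2 * i - 1 \<or> j = 2 * i" using True by (auto simp: i_def)
      moreover have "unit_vec (2 * i) \<in> vecs (2 * n)" "unit_vec (2 * i - 1) \<in> vecs (2 * n)"
        using i by (auto simp: vecs_def unit_vec_def)
      ultimately show ?thesis using x bil_unit_vec[OF i, of x] by (auto simp: perp_def)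
    qed
  qed
  then show ?thesis by (auto simp: perp_def vecs_def)
qed

text \<open>Commutativity is a locale assumption instead of a type class, so that all results on
  rational subspaces apply to the same scalar type.\<close>

locale comm_division_subring = division_subring +
  assumes comm: "(x :: 'a) * y = y * x"
begin

lemma bil_sym: "bil n x y = bil n y (x :: 'a vec)"
  by (simp add: bil_def add.commute comm)

lemma bil_scl_left: "bil n (b \<star> a) x = bil n b x * (a :: 'a)"
  by (metis bil_sym bil_linear(2))

lemma quad_add: "quad n (x + y) = quad n x + quad n y + bil n x (y :: 'a vec)"
proof -
  have "(x (2 * i - 1) + y (2 * i - 1)) * (x (2 * i) + y (2 * i)) =
      x (2 * i - 1) * x (2 * i) + y (2 * i - 1) * y (2 * i) +
      (x (2 * i - 1) * y (2 * i) + x (2 * i) * y (2 * i - 1))" for i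
    using comm[of "y (2 * i - 1)" "x (2 * i)"] by (simp add: algebra_simps)
  then show ?thesis by (simp add: quad_def bil_def sum.distrib)
qed

lemma quad_scl: "quad n (x \<star> a) = quad n x * (a * a :: 'a)"
proof -
  have "x i * a * (x j * a) = x i * x j * (a * a)" for i j
    by (metis comm mult.assoc)
  then show ?thesis by (simp add: quad_def sum_distrib_right)
qed

lemma bil_self: "bil n x x = quad n x + quad n (x :: 'a vec)"
  by (simp add: bil_def quad_def sum.distrib comm)

lemma perp_lspan: "perp n (lspan S) = perp n (S :: 'a vec set)"
proof
  show "perp n S \<subseteq> perp n (lspan S)"
  proof
    fix x assume x: "x \<in> perp n S"
    have "lsub {b. bil n b x = 0}" by (auto simp: lsub_def bil_linear bil_scl_left)
    then have "lspan S \<subseteq> {b. bil n b x = 0}" using x by (simp add: lspan_subset_iff) (auto simp: perp_def)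
    then show "x \<in> perp n (lspan S)" using x by (auto simp: perp_def)
  qed
qed (rule perp_anti[OF hull_subset])

text \<open>Two counts of conditions. A basis \<open>B\<close> of \<open>U\<close> cuts the whole
  space down by at most \<open>vdim U\<close>. The remaining vectors \<open>C - B\<close> of a basis
  of the whole space cut \<open>perp n U\<close> down to 0 by nondegeneracy, so
  \<open>vdim (perp n U)\<close> is at most \<open>2 * n - vdim U\<close>.\<close>

lemma vdim_perp:
  assumes "is_subspace (2 * n) (U :: 'a vec set)"
  shows "vdim (perp n U) + vdim U = 2 * n"
proof -
  obtain B where B: "is_basis B U" "card B = vdim U" using subspace_basis[OF assms] by metis
  have UB: "perp n U = perp n B" using B perp_lspan by (metis is_basis_iff)
  obtain C where C: "B \<subseteq> C" "is_basis C (vecs (2 * n))" "card C = vdim (vecs (2 * n) :: 'a vec set)"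
    using basis_extend[OF assms is_subspace_vecs _ B(1)] assms by (auto simp: is_subspace_iff)
  have fin: "finite B" "finite C" using B C by (auto simp: is_basis_iff)
  have "vdim (vecs (2 * n) :: 'a vec set) \<le> vdim (vecs (2 * n) \<inter> perp n B) + card B"
    by (rule vdim_Int_perp) (use fin in auto)
  moreover have "vecs (2 * n) \<inter> perp n B = perp n B" by (auto simp: perp_def)
  ultimately have "2 * n \<le> vdim (perp n U) + vdim U" using UB B by simp
  moreover have "vdim (perp n B) \<le> vdim (perp n B \<inter> perp n (C - B)) + card (C - B)"
    by (rule vdim_Int_perp) (use fin in auto)
  moreover have "perp n B \<inter> perp n (C - B) = perp n (lspan C)"
    using C(1) by (simp add: perp_lspan flip: perp_Un) (simp add: Un_absorb1)
  then have "perp n B \<inter> perp n (C - B) = {0}" using C(2) by (simp add: is_basis_iff perp_vecs)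
  moreover have "vdim {0 :: 'a vec} = 0"
    using vdim_pos_iff[of "2 * n" "{0 :: 'a vec}"] is_subspace_perp[of n "vecs (2 * n) :: 'a vec set"]
    by (auto simp: perp_vecs)
  moreover have "card (C - B) = 2 * n - vdim U" "vdim U \<le> 2 * n"
    using C B fin card_mono[OF fin(2) C(1)] by (auto simp: card_Diff_subset)
  ultimately show ?thesis using UB by simp
qed

lemma tot_singular_perp:
  assumes "tot_singular n (U :: 'a vec set)"
  shows "U \<subseteq> perp n U"
proof
  fix x assume x: "x \<in> U"
  have U: "is_subspace (2 * n) U" "\<And>u. u \<in> U \<Longrightarrow> quad n u = 0" using assms by (auto simp: tot_singular_def)
  have "bil n b x = 0" if b: "b \<in> U" for b
  proof -
    have "b + x \<in> U" using b x U(1) by (simp add: is_subspaceD(1) lsubD(2))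
    then show ?thesis using quad_add[of n b x] U(2) b x by simp
  qed
  then show "x \<in> perp n U" using x U(1) by (auto simp: perp_def is_subspace_iff)
qed

lemma tot_singular_vdim:
  assumes "tot_singular n (U :: 'a vec set)"
  shows "vdim U \<le> n"
proof -
  have U: "is_subspace (2 * n) U" using assms by (simp add: tot_singular_def)
  have "vdim U \<le> vdim (perp n U)"
    using vdim_mono[OF U is_subspace_perp tot_singular_perp[OF assms]] .
  then show ?thesis using vdim_perp[OF U] by simp
qed

lemma tot_singular_insert:
  assumes "tot_singular n U" "w \<in> perp n U" "quad n w = (0 :: 'a)"
  shows "tot_singular n (lspan (insert w U))"
proof -
  have U: "is_subspace (2 * n) U" "\<And>u. u \<in> U \<Longrightarrow> quad n u = 0" using assms(1) by (auto simp: tot_singular_def)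
  have "quad n x = 0" if "x \<in> lspan (insert w U)" for x
  proof -
    obtain a where a: "x - w \<star> a \<in> U"
      using \<open>x \<in> lspan (insert w U)\<close> lspan_lsub[OF is_subspaceD(1)[OF U(1)]]
      by (auto simp: lspan_insert_iff)
    have "bil n (x - w \<star> a) (w \<star> a) = 0" using a assms(2) by (simp add: bil_linear perp_def)
    then show ?thesis
      using quad_add[of n "x - w \<star> a" "w \<star> a"] U(2)[OF a] by (simp add: quad_scl assms(3))
  qed
  moreover have "is_subspace (2 * n) (lspan (insert w U))"
    using U(1) assms(2) by (intro is_subspace_lspan) (auto simp: is_subspace_iff perp_def)
  ultimately show ?thesis by (simp add: tot_singular_def)
qed

lemma max_singularD:
  assumes "M \<in> max_singular n"
  shows "tot_singular n M" "is_subspace (2 * n) M" "lsub M" "vdim M = n"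
    "\<And>u. u \<in> M \<Longrightarrow> quad n u = 0"
  using assms by (auto simp: max_singular_def tot_singular_def is_subspace_iff)

text \<open>Otherwise \<open>w\<close> and \<open>M\<close> would span a totally singular subspace
  of dimension \<open>n + 1\<close>.\<close>

lemma max_singular_absorb:
  assumes M: "M \<in> max_singular n" and "w \<in> perp n M" "quad n w = (0 :: 'a)"
  shows "w \<in> M"
proof (rule ccontr)
  assume "w \<notin> M"
  moreover have "w \<in> vecs (2 * n)" using assms(2) by (auto simp: perp_def)
  ultimately have "vdim (lspan (insert w M)) = n + 1"
    using vdim_insert[OF max_singularD(2)[OF M]] max_singularD(4)[OF M] by simp
  moreover have "tot_singular n (lspan (insert w M))"
    using tot_singular_insert max_singularD(1)[OF M] assms by blast
  ultimately show False using tot_singular_vdim by fastforce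
qed

section \<open>Rationality of orthogonal spaces and of maximal totally singular subspaces\<close>

lemma rational_Int_perp:
  assumes "rat (2 * n) Y" "finite F" "\<And>b. b \<in> F \<Longrightarrow> rational_vec K0 (2 * n) b"
  shows "rat (2 * n) (Y \<inter> perp n F)"
  using assms(2,3)
proof (induction F)
  case empty
  have "Y \<inter> perp n {} = Y" using rational_is_subspace[OF assms(1)] by (auto simp: perp_def is_subspace_iff)
  then show ?case using assms(1) by simp
next
  case (insert b F)
  then have "rat (2 * n) (Y \<inter> perp n F)" by simp
  moreover have "bil n b v \<in> K0" if "rational_vec K0 (2 * n) v" for v
    using that insert.prems[of b] by (auto simp: bil_def rational_vec_iff intro!: K0_sum K0_add K0_mult)
  ultimately show ?case
    unfolding Int_perp_insert by (intro rational_kernel) (simp_all add: bil_linear)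
qed

lemma rational_perp:
  assumes "rat (2 * n) U"
  shows "rat (2 * n) (perp n U)"
proof -
  obtain B where B: "finite B" "lspan B = U" "\<forall>b\<in>B. rational_vec K0 (2 * n) b"
    using assms by (auto simp: rational_subspace_def is_basis_iff)
  then have "rat (2 * n) (vecs (2 * n) \<inter> perp n B)" by (intro rational_Int_perp rational_vecs) auto
  moreover have "vecs (2 * n) \<inter> perp n B = perp n U" using perp_lspan[of n B] B(2) by (auto simp: perp_def)
  ultimately show ?thesis by simp
qed

text \<open>
  The first rational singular vector outside \<open>U\<close> and orthogonal to it comes from the rational
  maximal singular subspace on which all even coordinates vanish.
\<close>

lemma rational_singular_extension:
  assumes U: "rat (2 * n) U" "vdim U < n"
  obtains w where "rational_vec K0 (2 * n) w" "w \<in> perp n U" "w \<notin> U" "quad n w = 0"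
proof -
  define odds where "odds = ((\<lambda>i. unit_vec (2 * i - 1)) ` {1..n} :: 'a vec set)"
  define E where "E = perp n odds"
  have odds: "finite odds" "\<And>b. b \<in> odds \<Longrightarrow> rational_vec K0 (2 * n) b"
    by (auto simp: odds_def rational_vec_iff vecs_def unit_vec_def K0_zero K0_one)
  have E0: "x (2 * i) = 0" if "x \<in> E" "i \<in> {1..n}" for x i
  proof -
    have "unit_vec (2 * i - 1) \<in> odds" using that(2) unfolding odds_def by blast
    then have "bil n (unit_vec (2 * i - 1)) x = 0" using that(1) unfolding E_def perp_def by blast
    then show ?thesis using bil_unit_vec(1)[OF that(2)] by metis
  qed
  then have qE: "quad n x = 0" if "x \<in> E" for x
    unfolding quad_def using E0[OF that] by (intro sum.neutral) auto
  have sE: "is_subspace (2 * n) E" by (simp add: E_def)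
  have rE: "rat (2 * n) E"
  proof -
    have "rat (2 * n) (vecs (2 * n) \<inter> perp n odds)" by (rule rational_Int_perp[OF rational_vecs odds])
    moreover have "vecs (2 * n) \<inter> perp n odds = E" by (auto simp: E_def perp_def)
    ultimately show ?thesis by simp
  qed
  have "vdim E \<le> n" using tot_singular_vdim[of n E] qE sE by (simp add: tot_singular_def)
  have "odds \<subseteq> E"
  proof
    fix b assume b: "b \<in> odds"
    then obtain j where j: "b = unit_vec (2 * j - 1)" "j \<in> {1..n}" by (auto simp: odds_def)
    have "bil n c b = 0" if "c \<in> odds" for c
    proof -
      obtain i where i: "c = unit_vec (2 * i - 1)" "i \<in> {1..n}" using \<open>c \<in> odds\<close> by (auto simp: odds_def)
      have "2 * i \<noteq> 2 * j - 1" using i j by simp presburger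
      then show ?thesis unfolding i(1) bil_unit_vec(1)[OF i(2)] by (simp add: j(1) unit_vec_def)
    qed
    then show "b \<in> E" using b odds(2) by (auto simp: E_def perp_def rational_vec_iff)
  qed
  then have EE: "perp n E \<subseteq> E" unfolding E_def by (rule perp_anti)
  note sU = rational_is_subspace[OF U(1)]
  let ?S = "lspan (U \<union> E)"
  let ?D = "perp n ?S"
  have D: "?D \<subseteq> perp n U" "?D \<subseteq> E" using EE by (auto simp: perp_lspan perp_Un)
  have rS: "rat (2 * n) ?S" by (rule rational_Un[OF U(1) rE])
  \<comment> \<open>If \<open>?D \<subseteq> U\<close>, then
    \<open>?D \<subseteq> U \<inter> E\<close>. But \<open>vdim ?D = 2 * n - vdim ?S\<close> is at
    least \<open>2 * n - vdim U - vdim E + vdim (U \<inter> E)\<close>, which exceeds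
    \<open>vdim (U \<inter> E)\<close> because \<open>vdim U < n\<close> and
    \<open>vdim E \<le> n\<close>.\<close>
  have "\<not> ?D \<subseteq> U"
  proof
    assume "?D \<subseteq> U"
    then have "vdim ?D \<le> vdim (U \<inter> E)"
      using D by (intro vdim_mono[OF is_subspace_perp is_subspace_Int[OF sU sE]]) auto
    moreover have "vdim ?D + vdim ?S = 2 * n" by (rule vdim_perp[OF rational_is_subspace[OF rS]])
    ultimately show False using vdim_Un_Int_le[OF sU sE] \<open>vdim E \<le> n\<close> U(2) by linarith
  qed
  then obtain w where "w \<in> ?D" "rational_vec K0 (2 * n) w" "w \<notin> U"
    using rational_subset[OF rational_perp[OF rS] is_subspaceD(1)[OF sU]] by blast
  then show ?thesis using that D qE by blast
qed

text \<open>
  A totally singular \<open>U\<close> of dimension \<open>n - 1\<close> lies in exactly two maximal totally singular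
  subspaces, because \<open>perp n U / U\<close> is a hyperbolic line; its two singular points are rational.
\<close>

lemma rational_max_singular:
  assumes U: "rat (2 * n) U" "vdim U = n - 1" "n \<ge> 1" and M: "M \<in> max_singular n" "U \<subseteq> (M :: 'a vec set)"
  shows "rat (2 * n) M"
proof -
  note sU = rational_is_subspace[OF U(1)] and sM = max_singularD[OF M(1)]
  have qU: "quad n u = 0" if "u \<in> U" for u using that sM(5) M(2) by auto
  have span: "M = lspan (insert x U)" if "x \<in> M" "x \<notin> U" for x
    using subspace_eq_insert[OF sU sM(2) M(2)] that U sM(4) by simp
  have MU: "M \<subseteq> perp n U" using tot_singular_perp[OF sM(1)] perp_anti[OF M(2)] by blast
  obtain w where w: "rational_vec K0 (2 * n) w" "w \<in> perp n U" "w \<notin> U" "quad n w = 0"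
    using rational_singular_extension[OF U(1)] U by auto
  show ?thesis
  proof (cases "w \<in> M")
    case True
    then show ?thesis using span w rational_insert U(1) by metis
  next
    case False
    then have "w \<notin> perp n M" using max_singular_absorb M(1) w(4) by blast
    moreover have wv: "w \<in> vecs (2 * n)" using w(2) perp_subset_vecs by blast
    ultimately obtain m where m: "m \<in> M" "bil n m w \<noteq> 0" by (auto simp: perp_def)
    \<comment> \<open>\<open>w\<close> gives one singular point of the hyperbolic line. To reach the
      other, take a rational \<open>v\<close> in \<open>perp n U\<close> that is not orthogonal to
      \<open>w\<close>; it exists because \<open>m\<close> is not orthogonal to \<open>w\<close> and
      \<open>perp n U\<close> is rational.\<close>
    have "\<not> perp n U \<subseteq> {x. bil n x w = 0}" using m MU by auto
    moreover have "lsub {x. bil n x w = 0}" by (auto simp: lsub_def bil_linear bil_scl_left)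
    ultimately obtain v where v: "v \<in> perp n U" "rational_vec K0 (2 * n) v" "bil n v w \<noteq> 0"
      using rational_subset[OF rational_perp[OF U(1)]] by blast
    \<comment> \<open>The solution of \<open>quad n v + bil n v w * c = 0\<close>, which makes
      \<open>v + w \<star> c\<close> singular; it lies in \<open>K0\<close> because \<open>v\<close>
      and \<open>w\<close> are rational.\<close>
    define c where "c = - (inverse (bil n v w) * quad n v)"
    define w' where "w' = v + w \<star> c"
    have "c \<in> K0"
      using v(2) w(1) unfolding c_def bil_def quad_def rational_vec_iff
      by (auto intro!: K0_uminus K0_mult K0_inverse K0_sum K0_add)
    then have rw': "rational_vec K0 (2 * n) w'"
      using v(2) w(1) unfolding w'_def rational_vec_iff
      by (auto simp: vecs_def intro!: K0_add K0_mult)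
    have ww: "bil n w w = 0" by (simp add: bil_self w(4))
    have w'w: "bil n w' w \<noteq> 0" using v(3) by (simp add: w'_def bil_linear bil_scl_left ww)
    have "quad n w' = quad n v + bil n v w * c" by (simp add: w'_def quad_add quad_scl w(4) bil_linear)
    also have "bil n v w * c = - quad n v" using v(3) by (simp add: c_def flip: mult.assoc)
    finally have qw': "quad n w' = 0" by simp
    have w'U: "w' \<in> perp n U"
      using v(1) w(2) is_subspaceD(1)[OF is_subspace_perp] unfolding w'_def by (metis lsubD(2,3))
    let ?T = "lspan (insert w U)" and ?T' = "lspan (insert w' (lspan (insert w U)))"
    have sT: "is_subspace (2 * n) ?T" using wv is_subspaceD(2)[OF sU] by (intro is_subspace_lspan) auto
    have uw: "bil n u w = 0" if "u \<in> U" for u using w(2) that by (auto simp: perp_def)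
    have "?T \<subseteq> {x. bil n x w = 0}"
      using \<open>lsub {x. bil n x w = 0}\<close> by (simp add: lspan_subset_iff) (use ww uw in auto)
    then have w'T: "w' \<notin> ?T" using w'w by auto
    have w'v: "w' \<in> vecs (2 * n)" using w'U perp_subset_vecs by blast
    have sT': "is_subspace (2 * n) ?T'" using w'v is_subspaceD(2)[OF sT] by (intro is_subspace_lspan) auto
    \<comment> \<open>\<open>U\<close>, \<open>w\<close> and \<open>w'\<close> together fill
      \<open>perp n U\<close>, so \<open>m\<close> can be expanded in them.\<close>
    have "vdim ?T' = n + 1" using vdim_insert[OF sT w'v w'T] vdim_insert[OF sU wv w(3)] U by simp
    moreover have "vdim (perp n U) = n + 1" using vdim_perp[OF sU] U by simp
    moreover have "?T' \<subseteq> perp n U"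
    proof -
      have "U \<subseteq> perp n U" using MU M(2) by blast
      then have "?T \<subseteq> perp n U" using w(2) by (simp add: lspan_subset_iff[OF is_subspaceD(1)[OF is_subspace_perp]])
      then show ?thesis using w'U by (simp add: lspan_subset_iff[OF is_subspaceD(1)[OF is_subspace_perp]])
    qed
    ultimately have "?T' = perp n U" using vdim_equal[OF sT' is_subspace_perp] by simp
    then have "m \<in> ?T'" using m(1) MU by auto
    then obtain b where b: "m - w' \<star> b \<in> ?T"
      unfolding lspan_insert_iff[of m] hull_hull by blast
    then obtain a where a: "m - w' \<star> b - w \<star> a \<in> U"
      unfolding lspan_insert_iff[of "m - w' \<star> b"] lspan_lsub[OF is_subspaceD(1)[OF sU]] by blast
    define u where "u = m - w' \<star> b - w \<star> a"
    have meq: "m = u + (w' \<star> b + w \<star> a)" by (simp add: u_def)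
    have uU: "u \<in> U" using a by (simp add: u_def)
    have "bil n u (w' \<star> b + w \<star> a) = 0" using uU w(2) w'U by (auto simp: bil_linear perp_def)
    \<comment> \<open>On the hyperbolic line the form is a multiple of the product
      \<open>a * b\<close>, so one coefficient of the singular vector \<open>m\<close> vanishes. As
      \<open>m\<close> is not orthogonal to \<open>w\<close>, it is \<open>a\<close>, and
      \<open>m\<close> is a multiple of \<open>w'\<close> modulo \<open>U\<close>.\<close>
    then have "quad n m = bil n w' w * a * b"
      using qU[OF uU] unfolding meq by (simp add: quad_add quad_scl qw' w(4) bil_linear bil_scl_left)
        (metis comm mult.assoc)
    moreover have "quad n m = 0" using sM(5) m(1) by blast
    moreover have "bil n m w = bil n w' w * b"
      unfolding meq by (simp add: bil_linear bil_scl_left ww uw[OF uU])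
    ultimately have "a = 0" "b \<noteq> 0" using w'w m(2) by auto
    then have "w' = (m - u) \<star> inverse b" by (simp add: meq)
    then have "w' \<in> M" using m(1) uU M(2) sM(3) by (auto intro!: lsubD(3) lsub_diff)
    moreover have "w' \<notin> U" using w'T by (auto simp: lspan_inc)
    ultimately show ?thesis using span rw' rational_insert U(1) by metis
  qed
qed

lemma rational_max_singular':
  assumes "rat (2 * n) U" "n - 1 \<le> vdim U" "n \<ge> 1" "M \<in> max_singular n" "U \<subseteq> (M :: 'a vec set)"
  shows "rat (2 * n) M"
proof (cases "vdim U = n - 1")
  case False
  note sM = max_singularD[OF assms(4)] and sU = rational_is_subspace[OF assms(1)]
  have "U = M" using vdim_equal[OF sU sM(2) assms(5)] False assms(2) sM(4) by simp
  then show ?thesis using assms(1) by simp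
qed (use assms rational_max_singular in blast)

text \<open>The vector \<open>u\<close> determines the common hyperplane:
  \<open>M \<inter> M'\<close> is the part of \<open>M\<close> orthogonal to \<open>u\<close>, since
  all of \<open>M'\<close> is orthogonal to \<open>u\<close> while \<open>M\<close> is not. That
  part is rational, and \<open>u\<close> completes it to \<open>M'\<close>.\<close>

lemma rational_adjacent_max_singular:
  assumes M: "M \<in> max_singular n" and M': "M' \<in> max_singular n" and "vdim (M \<inter> M') = n - 1" "n \<ge> 1"
    and "rat (2 * n) M" and u: "rational_vec K0 (2 * n) u" "u \<in> M'" "u \<notin> (M :: 'a vec set)"
  shows "rat (2 * n) M'"
proof -
  note sM = max_singularD[OF M] and sM' = max_singularD[OF M']
  let ?P = "M \<inter> perp n {u}"
  have I: "is_subspace (2 * n) (M \<inter> M')" using is_subspace_Int[OF sM(2) sM'(2)] .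
  have sP: "is_subspace (2 * n) ?P" using is_subspace_Int[OF sM(2) is_subspace_perp] .
  have uv: "u \<in> vecs (2 * n)" using u(1) by (simp add: rational_vec_iff)
  have "M \<inter> M' \<subseteq> ?P" using tot_singular_perp[OF sM'(1)] u(2) by (auto simp: perp_def)
  moreover have "?P \<noteq> M"
  proof
    assume "?P = M"
    then have "bil n b u = 0" if "b \<in> M" for b using that bil_sym[of n b u] by (auto simp: perp_def)
    then have "u \<in> perp n M" using uv by (auto simp: perp_def)
    then show False using max_singular_absorb[OF M] sM'(5)[OF u(2)] u(3) by blast
  qed
  then have "vdim ?P < n" using vdim_less[OF sP sM(2)] sM(4) by auto
  ultimately have "M \<inter> M' = ?P" using vdim_equal[OF I sP] assms(3) by simp
  moreover have "rat (2 * n) ?P" using rational_Int_perp[OF assms(5), of "{u}"] u(1) by simp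
  ultimately have "rat (2 * n) (lspan (insert u (M \<inter> M')))" using rational_insert u(1) by simp
  moreover have "M' = lspan (insert u (M \<inter> M'))"
    using subspace_eq_insert[OF I sM'(2) _ _ u(2)] assms(3,4) u(3) sM'(4) by simp
  ultimately show ?thesis by simp
qed

end

section \<open>The building of type D\<close>

lemma D_simps [simp]:
  "elems (D_building n Sp Sm) = {U. tot_singular n U \<and> vdim U \<in> {1..n - 2}} \<union> Sp \<union> Sm"
  "etype (D_building n Sp Sm) U = (if U \<in> Sp then TPlus else if U \<in> Sm then TMinus else TDim (vdim U))"
  "inc (D_building n Sp Sm) X Y \<longleftrightarrow>
    (if X \<in> Sp \<and> Y \<in> Sm \<or> X \<in> Sm \<and> Y \<in> Sp then vdim (X \<inter> Y) = n - 1 else X \<subseteq> Y \<or> Y \<subseteq> X)"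
  "nodes (D_building n Sp Sm) = TDim ` {1..n - 2} \<union> {TPlus, TMinus}"
  "adj (D_building n Sp Sm) (TDim i) (TDim j) \<longleftrightarrow> j = i + 1 \<or> i = j + 1"
  "adj (D_building n Sp Sm) (TDim i) TPlus \<longleftrightarrow> i = n - 2"
  "adj (D_building n Sp Sm) (TDim i) TMinus \<longleftrightarrow> i = n - 2"
  "adj (D_building n Sp Sm) TPlus (TDim i) \<longleftrightarrow> i = n - 2"
  "adj (D_building n Sp Sm) TMinus (TDim i) \<longleftrightarrow> i = n - 2"
  "\<not> adj (D_building n Sp Sm) TPlus TPlus" "\<not> adj (D_building n Sp Sm) TPlus TMinus"
  "\<not> adj (D_building n Sp Sm) TMinus TPlus" "\<not> adj (D_building n Sp Sm) TMinus TMinus"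
  by (simp_all add: D_building_def)

text \<open>Without node \<open>t\<close> the nodes below it are cut off from the branch node and
  hence from \<open>TMinus\<close>. Leaving \<open>J\<close> general covers both kinds of flags that
  contain a point.\<close>

lemma D_splits_TDim:
  assumes "2 \<le> t" "t \<le> n - 2" "TDim 1 \<in> J" "TMinus \<in> J" "TDim t \<notin> J"
  shows "splits (D_building n Sp Sm) (TDim t) J"
proof (rule splitsI[of _ _ _ "TDim 1" TMinus "TDim ` {..<t}"])
  fix x y
  assume "x \<in> nodes (D_building n Sp Sm)" "y \<in> nodes (D_building n Sp Sm)" "x \<noteq> TDim t" "y \<noteq> TDim t"
    "adj (D_building n Sp Sm) x y"
  then show "x \<in> TDim ` {..<t} \<longleftrightarrow> y \<in> TDim ` {..<t}"
    using assms(1,2) by (cases x; cases y) auto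
qed (use assms in auto)

text \<open>The two end nodes are joined only through the branch node \<open>n - 2\<close>. This is
  why a single dimension occurs in \<open>Omega_PM\<close>.\<close>

lemma D_splits_PM:
  assumes "n \<ge> 3"
  shows "splits (D_building n Sp Sm) (TDim t) {TPlus, TMinus} \<longleftrightarrow> t = n - 2"
proof
  assume "t = n - 2"
  show "splits (D_building n Sp Sm) (TDim t) {TPlus, TMinus}"
  proof (rule splitsI[of _ _ _ TPlus TMinus "{TPlus}"])
    fix x y
    assume "x \<in> nodes (D_building n Sp Sm)" "y \<in> nodes (D_building n Sp Sm)" "x \<noteq> TDim t" "y \<noteq> TDim t"
      "adj (D_building n Sp Sm) x y"
    then show "x \<in> {TPlus} \<longleftrightarrow> y \<in> {TPlus}"
      using \<open>t = n - 2\<close> by (cases x; cases y) auto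
  qed (use assms \<open>t = n - 2\<close> in auto)
next
  assume s: "splits (D_building n Sp Sm) (TDim t) {TPlus, TMinus}"
  show "t = n - 2"
  proof (rule ccontr)
    assume t: "t \<noteq> n - 2"
    let ?X = "D_building n Sp Sm"
    let ?R = "{(a, b). a \<in> nodes ?X - {TDim t} \<and> b \<in> nodes ?X - {TDim t} \<and> adj ?X a b}"
    have "(TPlus, TDim (n - 2)) \<in> ?R" "(TDim (n - 2), TMinus) \<in> ?R" using t assms by auto
    then have "(TPlus, TMinus) \<in> ?R\<^sup>*" by (meson converse_rtrancl_into_rtrancl r_into_rtrancl)
    then have "\<not> splits ?X (TDim t) {TPlus, TMinus}"
      by (intro not_splitsI[of TPlus]) auto
    then show False using s by simp
  qed
qed

text \<open>Deleting \<open>TPlus\<close> leaves a path from \<open>TMinus\<close> to node 1, so a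
  rational member of \<open>Sp\<close> never makes a flag of type \<open>{TDim 1, TMinus}\<close>
  nearly rational.\<close>

lemma D_not_splits_TPlus:
  assumes "n \<ge> 3"
  shows "\<not> splits (D_building n Sp Sm) TPlus {TDim 1, TMinus}"
proof -
  let ?X = "D_building n Sp Sm"
  let ?R = "{(a, b). a \<in> nodes ?X - {TPlus} \<and> b \<in> nodes ?X - {TPlus} \<and> adj ?X a b}"
  \<comment> \<open>\<open>k\<close> counts the steps down from the branch node, so node 1 is
    reached at \<open>k = n - 3\<close>.\<close>
  have path: "(TMinus, TDim (n - 2 - k)) \<in> ?R\<^sup>*" if "k < n - 2" for k
    using that
  proof (induction k)
    case 0
    have "(TMinus, TDim (n - 2)) \<in> ?R" using assms by auto
    then show ?case by auto
  next
    case (Suc k)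
    have "n - 2 - k \<in> {1..n - 2}" "n - 2 - Suc k \<in> {1..n - 2}" "n - 2 - k = n - 2 - Suc k + 1"
      using Suc.prems by auto
    then have "(TDim (n - 2 - k), TDim (n - 2 - Suc k)) \<in> ?R"
      by (auto simp del: diff_diff_left diff_Suc_eq_diff_pred diff_Suc)
    then show ?case using Suc by (meson Suc_lessD rtrancl.rtrancl_into_rtrancl)
  qed
  from path[of "n - 3"] have "(TMinus, TDim (n - 2 - (n - 3))) \<in> ?R\<^sup>*" using assms by linarith
  moreover have "n - 2 - (n - 3) = 1" using assms by auto
  ultimately have "(TMinus, TDim 1) \<in> ?R\<^sup>*" by (simp only:)
  then have R: "(TMinus, b) \<in> ?R\<^sup>*" if "b \<in> {TDim 1, TMinus}" for b
    using that by (elim insertE emptyE) (simp_all only: rtrancl.rtrancl_refl)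
  show ?thesis by (rule not_splitsI[of TMinus]) (simp, simp, rule R)
qed

text \<open>For \<open>n = 3\<close> node 1 is the branch node and its neighbours are
  \<open>TPlus\<close> and \<open>TMinus\<close>, hence the stronger bound in the first
  case.\<close>

lemma D_fr:
  shows "n \<ge> 4 \<Longrightarrow> fr (D_building n Sp Sm) (TDim 1) = {TDim 2}"
    and "n \<ge> 3 \<Longrightarrow> fr (D_building n Sp Sm) TPlus = {TDim (n - 2)}"
    and "n \<ge> 3 \<Longrightarrow> fr (D_building n Sp Sm) TMinus = {TDim (n - 2)}"
  by (auto simp: fr_def)

section \<open>Types, incidence and points of the three Grassmannians of type D\<close>

locale D_geometry = comm_division_subring K0 for K0 :: "'k::division_ring set" +
  fixes n :: nat and Sp Sm :: "'k vec set set"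
  assumes classes: "singular_classes n Sp Sm" and n3: "n \<ge> 3"
begin

abbreviation X :: "('k vec set, D_type) geometry" where
  "X \<equiv> D_building n Sp Sm"

lemma Sp_Sm: "Sp \<union> Sm = max_singular n" "M \<in> Sp \<Longrightarrow> M \<notin> Sm" "M \<in> Sm \<Longrightarrow> M \<notin> Sp"
  using classes by (auto simp: singular_classes_def)

lemma Sp_max: "M \<in> Sp \<Longrightarrow> M \<in> max_singular n" and Sm_max: "M \<in> Sm \<Longrightarrow> M \<in> max_singular n"
  using Sp_Sm(1) by auto

text \<open>Symmetric in the two classes, so that one pencil lemma serves lines of type
  \<open>TPlus\<close> and of type \<open>TMinus\<close>.\<close>

definition same_class :: "'k vec set \<Rightarrow> 'k vec set \<Rightarrow> bool" where
  "same_class M M' \<longleftrightarrow> M \<in> Sp \<and> M' \<in> Sp \<or> M \<in> Sm \<and> M' \<in> Sm"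

text \<open>Within a class the codimension of the intersection is even, and it is positive for
  distinct members, hence at least 2. Containing \<open>K\<close> of codimension 2, the intersection
  equals \<open>K\<close>.\<close>

lemma same_class_Int:
  assumes "same_class M M'" "M \<noteq> M'" "is_subspace (2 * n) K" "vdim K = n - 2" "K \<subseteq> M" "K \<subseteq> M'"
  shows "M \<inter> M' = K"
proof -
  have max: "M \<in> max_singular n" "M' \<in> max_singular n" and "M \<in> Sp \<longleftrightarrow> M' \<in> Sp"
    using assms(1) Sp_max Sm_max Sp_Sm by (auto simp: same_class_def)
  then have "even (vdim M - vdim (M \<inter> M'))"
    using classes by (auto simp: singular_classes_def)
  note s = max_singularD[OF max(1)] and s' = max_singularD[OF max(2)]
  have I: "is_subspace (2 * n) (M \<inter> M')" by (rule is_subspace_Int[OF s(2) s'(2)])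
  have "M \<inter> M' \<noteq> M" using vdim_equal[OF s(2) s'(2)] s(4) s'(4) assms(2) by auto
  then have "vdim (M \<inter> M') < n" using vdim_less[OF I s(2)] s(4) by auto
  then have "vdim (M \<inter> M') \<le> n - 2"
    using \<open>even (vdim M - vdim (M \<inter> M'))\<close> unfolding s(4) by presburger
  then show ?thesis using vdim_equal[OF assms(3) I] assms(4-6) by auto
qed

lemma type_TDim: "x \<in> elems X \<and> etype X x = TDim i \<longleftrightarrow> tot_singular n x \<and> vdim x = i \<and> i \<in> {1..n - 2}"
  and type_TPlus: "x \<in> elems X \<and> etype X x = TPlus \<longleftrightarrow> x \<in> Sp"
  and type_TMinus: "x \<in> elems X \<and> etype X x = TMinus \<longleftrightarrow> x \<in> Sm"
proof -
  have "vdim x = n" if "x \<in> Sp \<union> Sm" for x using that Sp_Sm(1) max_singularD(4) by auto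
  then have "vdim x \<notin> {1..n - 2}" if "x \<in> Sp \<union> Sm" for x using that n3 by auto
  then show "x \<in> elems X \<and> etype X x = TDim i \<longleftrightarrow> tot_singular n x \<and> vdim x = i \<and> i \<in> {1..n - 2}"
    by auto
  show "x \<in> elems X \<and> etype X x = TPlus \<longleftrightarrow> x \<in> Sp" by auto
  show "x \<in> elems X \<and> etype X x = TMinus \<longleftrightarrow> x \<in> Sm" using Sp_Sm by auto
qed

lemma not_max:
  assumes "vdim U < n"
  shows "U \<notin> Sp" "U \<notin> Sm"
  using assms Sp_max Sm_max max_singularD(4) by fastforce+

text \<open>A non-maximal element is never in the special adjacency relation, so incidence is
  containment, and the dimensions fix its direction.\<close>

lemma inc_small:
  assumes "is_subspace (2 * n) U" "is_subspace (2 * n) W" "vdim U < n" "vdim U < vdim W"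
  shows "inc X U W \<longleftrightarrow> U \<subseteq> W" "inc X W U \<longleftrightarrow> U \<subseteq> W"
  using not_max[OF assms(3)] vdim_mono[OF assms(2,1)] assms(4) by auto

lemma inc_opposite:
  assumes "M \<in> Sp" "M' \<in> Sm"
  shows "inc X M M' \<longleftrightarrow> vdim (M \<inter> M') = n - 1" "inc X M' M \<longleftrightarrow> vdim (M \<inter> M') = n - 1"
  using assms by (auto simp: Int_commute)

lemma elems_subspace: "x \<in> elems X \<Longrightarrow> is_subspace (2 * n) x"
  using Sp_Sm(1) by (auto simp: tot_singular_def dest: Sp_max Sm_max max_singularD(2))

lemma D_type_separated: "type_separated X"
  unfolding type_separated_def
proof (intro ballI impI)
  fix x y assume xy: "x \<in> elems X" "y \<in> elems X" "inc X x y" "etype X x = etype X y"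
  have dim: "vdim z = n" if "z \<in> Sp \<union> Sm" for z using that Sp_Sm(1) max_singularD(4) by auto
  have "vdim x = vdim y \<and> (x \<subseteq> y \<or> y \<subseteq> x)"
  proof (cases "etype X x")
    case (TDim i)
    then have "vdim x = i" "vdim y = i" "i \<in> {1..n - 2}" using type_TDim xy(1,2,4) by metis+
    moreover from this have "x \<notin> Sp \<union> Sm" "y \<notin> Sp \<union> Sm" using dim[of x] dim[of y] n3 by auto
    ultimately show ?thesis using xy(3) by auto
  next
    case TPlus
    then have "x \<in> Sp" "y \<in> Sp" using type_TPlus xy(1,2,4) by metis+
    then show ?thesis using xy(3) dim Sp_Sm(2) by auto
  next
    case TMinus
    then have "x \<in> Sm" "y \<in> Sm" using type_TMinus xy(1,2,4) by metis+
    then show ?thesis using xy(3) dim Sp_Sm(3) by auto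
  qed
  then show "x = y" using vdim_equal elems_subspace xy(1,2) by (metis order_refl)
qed

lemma points_1M:
  "F \<in> gr_points X {TDim 1, TMinus} \<longleftrightarrow>
    (\<exists>p M. F = {p, M} \<and> is_subspace (2 * n) p \<and> vdim p = 1 \<and> M \<in> Sm \<and> p \<subseteq> M)"
proof -
  have "x \<in> elems X \<and> y \<in> elems X \<and> etype X x = TDim 1 \<and> etype X y = TMinus \<and> inc X x y \<and> inc X y x \<longleftrightarrow>
      is_subspace (2 * n) x \<and> vdim x = 1 \<and> y \<in> Sm \<and> x \<subseteq> y" for x y
  proof -
    have "inc X x y \<and> inc X y x \<longleftrightarrow> x \<subseteq> y" if "is_subspace (2 * n) x" "vdim x = 1" "y \<in> Sm"
      using inc_small[OF that(1), of y] max_singularD[OF Sm_max[OF that(3)]] that(2) n3 by auto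
    moreover have "tot_singular n x" if "is_subspace (2 * n) x" "y \<in> Sm" "x \<subseteq> y"
      using max_singularD(5)[OF Sm_max[OF that(2)]] that by (auto simp: tot_singular_def)
    ultimately show ?thesis
      using type_TDim[of x 1] type_TMinus[of y] n3 by (auto simp: tot_singular_def simp del: D_simps)
  qed
  then show ?thesis unfolding gr_points_def by (subst flags_of_type2[OF D_type_separated]) auto
qed

lemma points_PM:
  "F \<in> gr_points X {TPlus, TMinus} \<longleftrightarrow>
    (\<exists>M M'. F = {M, M'} \<and> M \<in> Sp \<and> M' \<in> Sm \<and> vdim (M \<inter> M') = n - 1)"
proof -
  have "x \<in> elems X \<and> y \<in> elems X \<and> etype X x = TPlus \<and> etype X y = TMinus \<and> inc X x y \<and> inc X y x \<longleftrightarrow>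
      x \<in> Sp \<and> y \<in> Sm \<and> vdim (x \<inter> y) = n - 1" for x y
    using type_TPlus[of x] type_TMinus[of y] inc_opposite[of x y] by blast
  then show ?thesis unfolding gr_points_def by (subst flags_of_type2[OF D_type_separated]) auto
qed

lemma points_1PM:
  "F \<in> gr_points X {TDim 1, TPlus, TMinus} \<longleftrightarrow>
    (\<exists>p M M'. F = {p, M, M'} \<and> is_subspace (2 * n) p \<and> vdim p = 1 \<and> M \<in> Sp \<and> M' \<in> Sm \<and>
      p \<subseteq> M \<and> p \<subseteq> M' \<and> vdim (M \<inter> M') = n - 1)"
proof -
  have "x \<in> elems X \<and> y \<in> elems X \<and> z \<in> elems X \<and> etype X x = TDim 1 \<and> etype X y = TPlus \<and> etype X z = TMinus \<and>
      inc X x y \<and> inc X y x \<and> inc X x z \<and> inc X z x \<and> inc X y z \<and> inc X z y \<longleftrightarrow>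
      is_subspace (2 * n) x \<and> vdim x = 1 \<and> y \<in> Sp \<and> z \<in> Sm \<and> x \<subseteq> y \<and> x \<subseteq> z \<and> vdim (y \<inter> z) = n - 1" for x y z
  proof -
    have "inc X x y \<and> inc X y x \<longleftrightarrow> x \<subseteq> y" if "is_subspace (2 * n) x" "vdim x = 1" "y \<in> max_singular n" for y
      using inc_small[OF that(1), of y] max_singularD[OF that(3)] that(2) n3 by auto
    moreover have "tot_singular n x" if "is_subspace (2 * n) x" "y \<in> Sp" "x \<subseteq> y"
      using max_singularD(5)[OF Sp_max[OF that(2)]] that by (auto simp: tot_singular_def)
    ultimately show ?thesis
      using type_TDim[of x 1] type_TPlus[of y] type_TMinus[of z] inc_opposite[of y z] n3 Sp_max[of y] Sm_max[of z]
      by (auto simp: tot_singular_def simp del: D_simps)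
  qed
  then show ?thesis unfolding gr_points_def by (subst flags_of_type3[OF D_type_separated]) auto
qed

text \<open>As in type A, except at dimension \<open>n - 1\<close>: no element has it, but then
  \<open>rational_max_singular'\<close> makes \<open>M\<close> itself rational. In the converse
  direction an element of type \<open>TPlus\<close> cannot be the witness, as that node does not
  split.\<close>

lemma Omega_1M:
  assumes "n \<ge> 4" and p: "is_subspace (2 * n) p" "vdim p = 1" and M: "M \<in> Sm" and "p \<subseteq> M"
  shows "{p, M} \<in> Omega_D K0 n Sp Sm {TDim 1, TMinus} \<longleftrightarrow> (\<exists>U. rat (2 * n) U \<and> p \<subseteq> U \<and> U \<subseteq> M)"
proof
  note sM = max_singularD[OF Sm_max[OF M]]
  assume "{p, M} \<in> Omega_D K0 n Sp Sm {TDim 1, TMinus}"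
  then consider "rat (2 * n) p" | "rat (2 * n) M"
    | y where "y \<in> elems X" "rat (2 * n) y" "splits X (etype X y) {TDim 1, TMinus}" "inc X y p" "inc X y M"
    unfolding Omega_D_def nearly_rational_points_def by (auto simp del: D_simps)
  then show "\<exists>U. rat (2 * n) U \<and> p \<subseteq> U \<and> U \<subseteq> M"
  proof cases
    case (3 y)
    note sy = elems_subspace[OF 3(1)]
    show ?thesis
    proof (cases "etype X y")
      case (TDim i)
      then have y: "tot_singular n y" "vdim y = i" "1 \<le> i" "i \<le> n - 2" using type_TDim[of y i] 3(1) by auto
      have "y \<subseteq> M" using inc_small[OF sy sM(2)] y sM(4) 3(5) by auto
      moreover have "p \<subseteq> y"
        using 3(4) not_max[of p] not_max[of y] y p n3 vdim_equal[OF sy p(1)] by auto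
      ultimately show ?thesis using 3 by blast
    qed (use 3 D_not_splits_TPlus[OF n3] in \<open>auto simp: splits_def simp del: D_simps\<close>)
  qed (use assms in blast)+
next
  note sM = max_singularD[OF Sm_max[OF M]]
  assume "\<exists>U. rat (2 * n) U \<and> p \<subseteq> U \<and> U \<subseteq> M"
  then obtain U where U: "rat (2 * n) U" "p \<subseteq> U" "U \<subseteq> M" by blast
  note sU = rational_is_subspace[OF U(1)]
  have pt: "{p, M} \<in> gr_points X {TDim 1, TMinus}" using points_1M assms by blast
  have "1 \<le> vdim U" using vdim_mono[OF p(1) sU U(2)] p(2) by simp
  then consider "vdim U = 1" | "n - 1 \<le> vdim U" | "2 \<le> vdim U" "vdim U \<le> n - 2" by linarith
  then show "{p, M} \<in> Omega_D K0 n Sp Sm {TDim 1, TMinus}"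
  proof cases
    case 1
    then have "U = p" using vdim_equal[OF p(1) sU U(2)] p(2) by simp
    then show ?thesis using pt U by (auto simp: Omega_D_def nearly_rational_points_def)
  next
    case 2
    then have "rat (2 * n) M" using rational_max_singular'[OF U(1) _ _ Sm_max[OF M] U(3)] n3 by simp
    then show ?thesis using pt by (auto simp: Omega_D_def nearly_rational_points_def)
  next
    case 3
    have "tot_singular n U" using sU U(3) sM(5) by (auto simp: tot_singular_def)
    then have "U \<in> elems X" "etype X U = TDim (vdim U)" using type_TDim[of U "vdim U"] 3 by auto
    moreover have "splits X (TDim (vdim U)) {TDim 1, TMinus}" using 3 by (intro D_splits_TDim) auto
    moreover have "inc X U p" "inc X U M"
      using inc_small[OF p(1) sU] inc_small[OF sU sM(2)] U(2,3) 3 p(2) sM(4) n3 by auto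
    ultimately show ?thesis
      using pt U(1) unfolding Omega_D_def nearly_rational_points_def by (auto simp del: D_simps)
  qed
qed

text \<open>Rationality of one of \<open>M\<close>, \<open>M'\<close> does not put a rational
  subspace between \<open>p\<close> and \<open>M \<inter> M'\<close>, so it stays as a separate
  alternative. A rational \<open>U\<close> of dimension \<open>n - 1\<close> is absorbed by
  it.\<close>

lemma Omega_1PM:
  assumes p: "is_subspace (2 * n) p" "vdim p = 1" and M: "M \<in> Sp" "M' \<in> Sm"
    and sub: "p \<subseteq> M" "p \<subseteq> M'" "vdim (M \<inter> M') = n - 1"
  shows "{p, M, M'} \<in> Omega_D K0 n Sp Sm {TDim 1, TPlus, TMinus} \<longleftrightarrow>
    (\<exists>U. rat (2 * n) U \<and> p \<subseteq> U \<and> U \<subseteq> M \<inter> M') \<or> rat (2 * n) M \<or> rat (2 * n) M'"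
proof
  note sM = max_singularD[OF Sp_max[OF M(1)]] and sM' = max_singularD[OF Sm_max[OF M(2)]]
  assume "{p, M, M'} \<in> Omega_D K0 n Sp Sm {TDim 1, TPlus, TMinus}"
  then consider "rat (2 * n) p" | "rat (2 * n) M" | "rat (2 * n) M'"
    | y where "y \<in> elems X" "rat (2 * n) y" "splits X (etype X y) {TDim 1, TPlus, TMinus}"
        "inc X y p" "inc X y M" "inc X y M'"
    unfolding Omega_D_def nearly_rational_points_def by (auto simp del: D_simps)
  then show "(\<exists>U. rat (2 * n) U \<and> p \<subseteq> U \<and> U \<subseteq> M \<inter> M') \<or> rat (2 * n) M \<or> rat (2 * n) M'"
  proof cases
    case (4 y)
    note sy = elems_subspace[OF 4(1)]
    show ?thesis
    proof (cases "etype X y")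
      case (TDim i)
      then have y: "tot_singular n y" "vdim y = i" "1 \<le> i" "i \<le> n - 2" using type_TDim[of y i] 4(1) by auto
      have "y \<subseteq> M \<inter> M'" using inc_small[OF sy sM(2)] inc_small[OF sy sM'(2)] y sM(4) sM'(4) 4(5,6) by auto
      moreover have "p \<subseteq> y"
        using 4(4) not_max[of p] not_max[of y] y p n3 vdim_equal[OF sy p(1)] by auto
      ultimately show ?thesis using 4 by blast
    qed (use 4 in \<open>auto simp: splits_def simp del: D_simps\<close>)
  qed (use assms in blast)+
next
  note sM = max_singularD[OF Sp_max[OF M(1)]] and sM' = max_singularD[OF Sm_max[OF M(2)]]
  have pt: "{p, M, M'} \<in> gr_points X {TDim 1, TPlus, TMinus}" using points_1PM assms by blast
  have *: ?thesis if "rat (2 * n) M \<or> rat (2 * n) M'"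
    using that pt by (auto simp: Omega_D_def nearly_rational_points_def)
  assume "(\<exists>U. rat (2 * n) U \<and> p \<subseteq> U \<and> U \<subseteq> M \<inter> M') \<or> rat (2 * n) M \<or> rat (2 * n) M'"
  then consider U where "rat (2 * n) U" "p \<subseteq> U" "U \<subseteq> M \<inter> M'" | "rat (2 * n) M \<or> rat (2 * n) M'" by blast
  then show "{p, M, M'} \<in> Omega_D K0 n Sp Sm {TDim 1, TPlus, TMinus}"
  proof cases
    case (1 U)
    note sU = rational_is_subspace[OF 1(1)]
    have "1 \<le> vdim U" using vdim_mono[OF p(1) sU 1(2)] p(2) by simp
    then consider "vdim U = 1" | "n - 1 \<le> vdim U" | "2 \<le> vdim U" "vdim U \<le> n - 2" by linarith
    then show ?thesis
    proof cases
      case U: 1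
      then have "U = p" using vdim_equal[OF p(1) sU 1(2)] p(2) by simp
      then show ?thesis using pt 1 by (auto simp: Omega_D_def nearly_rational_points_def)
    next
      case 2
      then have "rat (2 * n) M" using rational_max_singular'[OF 1(1) _ _ Sp_max[OF M(1)]] 1(3) n3 by simp
      then show ?thesis using * by blast
    next
      case 3
      have "tot_singular n U" using sU 1(3) sM(5) by (auto simp: tot_singular_def)
      then have "U \<in> elems X" "etype X U = TDim (vdim U)" using type_TDim[of U "vdim U"] 3 by auto
      moreover have "splits X (TDim (vdim U)) {TDim 1, TPlus, TMinus}" using 3 by (intro D_splits_TDim) auto
      moreover have "inc X U p" "inc X U M" "inc X U M'"
        using inc_small[OF p(1) sU] inc_small[OF sU sM(2)] inc_small[OF sU sM'(2)] 1(2,3) 3 p(2) sM(4) sM'(4) n3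
        by auto
      ultimately show ?thesis
        using pt 1(1) unfolding Omega_D_def nearly_rational_points_def by (auto simp del: D_simps)
    qed
  qed (use * in blast)
qed

text \<open>No point is in the flag to bound \<open>U\<close> from below; instead its dimension is
  fixed, since among the nodes outside the flag type only the branch node splits.\<close>

lemma Omega_PM:
  assumes M: "M \<in> Sp" "M' \<in> Sm" "vdim (M \<inter> M') = n - 1"
  shows "{M, M'} \<in> Omega_D K0 n Sp Sm {TPlus, TMinus} \<longleftrightarrow>
    (\<exists>U. rat (2 * n) U \<and> vdim U = n - 2 \<and> U \<subseteq> M \<inter> M') \<or> rat (2 * n) M \<or> rat (2 * n) M'"
proof
  note sM = max_singularD[OF Sp_max[OF M(1)]] and sM' = max_singularD[OF Sm_max[OF M(2)]]
  assume "{M, M'} \<in> Omega_D K0 n Sp Sm {TPlus, TMinus}"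
  then consider "rat (2 * n) M" | "rat (2 * n) M'"
    | y where "y \<in> elems X" "rat (2 * n) y" "splits X (etype X y) {TPlus, TMinus}" "inc X y M" "inc X y M'"
    unfolding Omega_D_def nearly_rational_points_def by (auto simp del: D_simps)
  then show "(\<exists>U. rat (2 * n) U \<and> vdim U = n - 2 \<and> U \<subseteq> M \<inter> M') \<or> rat (2 * n) M \<or> rat (2 * n) M'"
  proof cases
    case (3 y)
    note sy = elems_subspace[OF 3(1)]
    show ?thesis
    proof (cases "etype X y")
      case (TDim i)
      then have y: "vdim y = i" "i \<le> n - 2" using type_TDim[of y i] 3(1) by auto
      moreover have "i = n - 2" using 3(3) D_splits_PM[OF n3] TDim by metis
      moreover have "y \<subseteq> M \<inter> M'" using inc_small[OF sy sM(2)] inc_small[OF sy sM'(2)] y sM(4) sM'(4) 3(4,5) n3 by auto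
      ultimately show ?thesis using 3 by blast
    qed (use 3 in \<open>auto simp: splits_def simp del: D_simps\<close>)
  qed blast+
next
  note sM = max_singularD[OF Sp_max[OF M(1)]] and sM' = max_singularD[OF Sm_max[OF M(2)]]
  have pt: "{M, M'} \<in> gr_points X {TPlus, TMinus}" using points_PM assms by blast
  assume "(\<exists>U. rat (2 * n) U \<and> vdim U = n - 2 \<and> U \<subseteq> M \<inter> M') \<or> rat (2 * n) M \<or> rat (2 * n) M'"
  then consider U where "rat (2 * n) U" "vdim U = n - 2" "U \<subseteq> M \<inter> M'" | "rat (2 * n) M \<or> rat (2 * n) M'" by blast
  then show "{M, M'} \<in> Omega_D K0 n Sp Sm {TPlus, TMinus}"
  proof cases
    case (1 U)
    note sU = rational_is_subspace[OF 1(1)]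
    have "tot_singular n U" using sU 1(3) sM(5) by (auto simp: tot_singular_def)
    then have "U \<in> elems X" "etype X U = TDim (vdim U)" using type_TDim[of U "vdim U"] 1(2) n3
      by (auto simp del: D_simps)
    moreover have "splits X (TDim (vdim U)) {TPlus, TMinus}" unfolding 1(2) by (simp only: D_splits_PM[OF n3])
    moreover have "inc X U M" "inc X U M'"
      using inc_small[OF sU sM(2)] inc_small[OF sU sM'(2)] 1(2,3) sM(4) sM'(4) n3 by auto
    ultimately show ?thesis
      using pt 1(1) unfolding Omega_D_def nearly_rational_points_def by (auto simp del: D_simps)
  next
    case 2
    then show ?thesis using pt by (auto simp: Omega_D_def nearly_rational_points_def)
  qed
qed

section \<open>The subspace property in type D\<close>

lemma flag_insertD:
  assumes "is_flag X (insert x L)" "l \<in> L" "etype X x \<noteq> etype X l"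
  shows "x \<in> elems X" "inc X x l"
proof -
  show "x \<in> elems X" using assms(1) by (auto simp: is_flag_def simp del: D_simps)
  have "x \<noteq> l" using assms(3) by blast
  then show "inc X x l" using flagD[OF assms(1), of x l] assms(2) by blast
qed

lemma flag_point_in:
  assumes "is_flag X (insert x L)" "etype X x = TDim 1" "l \<in> L" "l \<in> elems X" "etype X l \<noteq> TDim 1" "vdim l \<ge> 2"
  shows "is_subspace (2 * n) x" "vdim x = 1" "x \<subseteq> l"
proof -
  have x: "x \<in> elems X" "inc X x l" using flag_insertD[OF assms(1,3)] assms(2,5) by metis+
  show sx: "is_subspace (2 * n) x" and dx: "vdim x = 1"
    using type_TDim[of x 1] x(1) assms(2) by (auto simp: tot_singular_def simp del: D_simps)
  show "x \<subseteq> l" using inc_small(1)[OF sx elems_subspace[OF assms(4)]] dx n3 x(2) assms(6) by auto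
qed

lemma flag_max_contains:
  assumes "is_flag X (insert M L)" "M \<in> Sp \<union> Sm" "K \<in> L" "tot_singular n K" "vdim K = n - 2" "K \<in> elems X"
    "etype X K = TDim (n - 2)"
  shows "K \<subseteq> M"
proof -
  have M: "M \<in> max_singular n" using assms(2) Sp_max Sm_max by blast
  note sM = max_singularD[OF M]
  have "etype X M \<noteq> etype X K" using type_TPlus[of M] type_TMinus[of M] assms(2,7) by (metis D_type.distinct(1,3) UnE)
  then have "inc X M K" using flag_insertD[OF assms(1,3)] by blast
  moreover have "is_subspace (2 * n) K" using assms(4) by (simp add: tot_singular_def)
  ultimately show ?thesis using inc_small(2)[of K M] sM(2,4) assms(5) n3 by auto
qed

lemma D_subspace_1M:
  assumes n: "n \<ge> 4"
  shows "gr_subspace X {TDim 1, TMinus} (Omega_D K0 n Sp Sm {TDim 1, TMinus})"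
proof (rule gr_subspaceI[OF D_type_separated])
  show "Omega_D K0 n Sp Sm {TDim 1, TMinus} \<subseteq> gr_points X {TDim 1, TMinus}"
    by (auto simp: Omega_D_def nearly_rational_points_def)
next
  fix j L L0 p q r
  let ?S = "Omega_D K0 n Sp Sm {TDim 1, TMinus}"
  assume j: "j \<in> {TDim 1, TMinus}" and L: "L \<in> flags_of_type X ({TDim 1, TMinus} - {j} \<union> fr X j)"
    and L0: "L0 = {h \<in> L. etype X h \<in> {TDim 1, TMinus} - {j}}"
    and p: "is_flag X (insert p L)" "etype X p = j" and q: "is_flag X (insert q L)" "etype X q = j"
    and r: "is_flag X (insert r L)" "etype X r = j" and "p \<noteq> q"
    and S: "insert p L0 \<in> ?S" "insert q L0 \<in> ?S"
  have el: "p \<in> elems X" "q \<in> elems X" "r \<in> elems X"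
    using p(1) q(1) r(1) by (auto simp: is_flag_def simp del: D_simps)
  from j consider "j = TDim 1" | "j = TMinus" by blast
  then show "insert r L0 \<in> ?S"
  proof cases
    case 1
    have "{TDim 1, TMinus} - {TDim 1} \<union> fr X (TDim 1) = {TMinus, TDim 2}" using D_fr(1)[OF n] by auto
    then have "L \<in> flags_of_type X {TMinus, TDim 2}" using L 1 by metis
    then obtain M W where MW: "L = {M, W}" "M \<in> elems X" "W \<in> elems X" "etype X M = TMinus" "etype X W = TDim 2"
      by (subst (asm) flags_of_type2[OF D_type_separated]) (auto simp del: D_simps)
    have M: "M \<in> Sm" using type_TMinus[of M] MW by blast
    note sM = max_singularD[OF Sm_max[OF M]]
    have W: "is_subspace (2 * n) W" "vdim W = 2"
      using type_TDim[of W 2] MW by (auto simp: tot_singular_def simp del: D_simps)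
    have L0: "L0 = {M}" unfolding L0 MW(1) 1 using MW(4,5) by (auto simp del: D_simps)
    have sub: "is_subspace (2 * n) x \<and> vdim x = 1 \<and> x \<subseteq> W \<and> x \<subseteq> M"
      if "is_flag X (insert x L)" "etype X x = j" for x
      using flag_point_in[OF that(1), of W] flag_point_in[OF that(1), of M] that(2) 1 MW W(2) sM(4) n
      by (auto simp del: D_simps)
    note p' = sub[OF p] and q' = sub[OF q] and r' = sub[OF r]
    have iff: "insert x L0 \<in> ?S \<longleftrightarrow> (\<exists>U. rat (2 * n) U \<and> x \<subseteq> U \<and> U \<subseteq> M)"
      if "is_subspace (2 * n) x \<and> vdim x = 1 \<and> x \<subseteq> W \<and> x \<subseteq> M" for x
      using Omega_1M[OF n, of x M] that M by (simp add: L0)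
    obtain U where U: "rat (2 * n) U" "p \<subseteq> U" "U \<subseteq> M" using iff[OF p'] S(1) by blast
    obtain U' where U': "rat (2 * n) U'" "q \<subseteq> U'" "U' \<subseteq> M" using iff[OF q'] S(2) by blast
    have "W = lspan (p \<union> q)" using plane_span[of "2 * n" p q W] p' q' W \<open>p \<noteq> q\<close> by auto
    also have "\<dots> \<subseteq> lspan (U \<union> U')" using U U' by (intro hull_mono) auto
    finally have "r \<subseteq> lspan (U \<union> U')" using r' by auto
    moreover have "lspan (U \<union> U') \<subseteq> M" unfolding lspan_subset_iff[OF sM(3)] using U U' by auto
    ultimately show ?thesis using iff[OF r'] rational_Un[OF U(1) U'(1)] by auto
  next
    case 2
    have "{TDim 1, TMinus} - {TMinus} \<union> fr X TMinus = {TDim 1, TDim (n - 2)}" using D_fr(3)[OF n3] by auto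
    then have "L \<in> flags_of_type X {TDim 1, TDim (n - 2)}" using L 2 by metis
    \<comment> \<open>For \<open>n = 3\<close> a point and the axis \<open>K\<close> of a pencil
      would have the same type.\<close>
    moreover have "TDim 1 \<noteq> TDim (n - 2)" using n by simp
    ultimately obtain x K where xK: "L = {x, K}" "x \<in> elems X" "K \<in> elems X" "etype X x = TDim 1"
        "etype X K = TDim (n - 2)" "inc X x K"
      by (subst (asm) flags_of_type2[OF D_type_separated]) (auto simp del: D_simps)
    have x: "is_subspace (2 * n) x" "vdim x = 1"
      using type_TDim[of x 1] xK by (auto simp: tot_singular_def simp del: D_simps)
    have K: "tot_singular n K" "is_subspace (2 * n) K" "vdim K = n - 2"
      using type_TDim[of K "n - 2"] xK by (auto simp: tot_singular_def simp del: D_simps)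
    have "x \<subseteq> K" using inc_small(1)[OF x(1) K(2)] x(2) K(3) n xK(6) by auto
    have L0: "L0 = {x}" unfolding L0 xK(1) 2 using xK(4,5) n by (auto simp del: D_simps)
    have sub: "y \<in> Sm \<and> K \<subseteq> y" if "is_flag X (insert y L)" "etype X y = j" "y \<in> elems X" for y
      using type_TMinus[of y] that flag_max_contains[OF that(1), of K] 2 xK K by (auto simp del: D_simps)
    note p' = sub[OF p el(1)] and q' = sub[OF q el(2)] and r' = sub[OF r el(3)]
    have iff: "insert M L0 \<in> ?S \<longleftrightarrow> (\<exists>U. rat (2 * n) U \<and> x \<subseteq> U \<and> U \<subseteq> M)"
      if "M \<in> Sm \<and> K \<subseteq> M" for M
      using Omega_1M[OF n, of x M] that x \<open>x \<subseteq> K\<close> by (auto simp add: L0 insert_commute)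
    obtain U where U: "rat (2 * n) U" "x \<subseteq> U" "U \<subseteq> p" using iff[OF p'] S(1) by blast
    obtain U' where U': "rat (2 * n) U'" "x \<subseteq> U'" "U' \<subseteq> q" using iff[OF q'] S(2) by blast
    \<comment> \<open>Whatever lies in both \<open>p\<close> and \<open>q\<close> lies in
      \<open>K\<close>, hence in the third member \<open>r\<close>.\<close>
    have "p \<inter> q = K" using same_class_Int[OF _ \<open>p \<noteq> q\<close> K(2,3)] p' q' by (auto simp: same_class_def)
    then have "U \<inter> U' \<subseteq> r" using U U' r' by auto
    moreover have "x \<subseteq> U \<inter> U'" using U U' by blast
    ultimately show ?thesis using iff[OF r'] rational_Int[OF U(1) U'(1)] by auto
  qed
qed

text \<open>If \<open>N\<close> is not rational, each hypothesis supplies a rational subspace above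
  \<open>x\<close> inside \<open>p\<close> or \<open>q\<close>, namely \<open>p\<close> or
  \<open>q\<close> itself when that one is rational. The intersection of the two lies in
  \<open>K\<close>, hence in both \<open>r\<close> and \<open>N\<close>.\<close>

lemma rational_between_pencil:
  assumes pq: "same_class p q" "p \<noteq> q" and K: "is_subspace (2 * n) K" "vdim K = n - 2" "K \<subseteq> p" "K \<subseteq> q" "K \<subseteq> N"
    and x: "x \<subseteq> K" and "K \<subseteq> r"
    and hp: "(\<exists>U. rat (2 * n) U \<and> x \<subseteq> U \<and> U \<subseteq> p \<inter> N) \<or> rat (2 * n) p \<or> rat (2 * n) N"
    and hq: "(\<exists>U. rat (2 * n) U \<and> x \<subseteq> U \<and> U \<subseteq> q \<inter> N) \<or> rat (2 * n) q \<or> rat (2 * n) N"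
  shows "(\<exists>U. rat (2 * n) U \<and> x \<subseteq> U \<and> U \<subseteq> r \<inter> N) \<or> rat (2 * n) N"
proof (cases "rat (2 * n) N")
  case False
  obtain U where U: "rat (2 * n) U" "x \<subseteq> U" "U \<subseteq> p" using hp False K(3) x by blast
  obtain U' where U': "rat (2 * n) U'" "x \<subseteq> U'" "U' \<subseteq> q" using hq False K(4) x by blast
  have "p \<inter> q = K" by (rule same_class_Int[OF pq K(1-4)])
  then have "U \<inter> U' \<subseteq> r \<inter> N" using U U' K(5) \<open>K \<subseteq> r\<close> by auto
  moreover have "x \<subseteq> U \<inter> U'" using U U' by blast
  ultimately show ?thesis using rational_Int[OF U(1) U'(1)] by blast
qed simp

text \<open>Intersecting is not enough here, because the result must have dimension exactly
  \<open>n - 2\<close>. Any given \<open>U\<close> either lies in both \<open>p\<close> and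
  \<open>q\<close>, and then equals \<open>K\<close>, or protrudes from one of them, and then it
  helps to make \<open>N\<close> rational. The conclusion mentions neither \<open>p\<close> nor
  \<open>q\<close>, so it passes to every point of the line.\<close>

lemma rational_pencil:
  assumes pq: "same_class p q" "p \<noteq> q" and K: "is_subspace (2 * n) K" "vdim K = n - 2" "K \<subseteq> p" "K \<subseteq> q"
    and N: "N \<in> max_singular n" "vdim (p \<inter> N) = n - 1" "vdim (q \<inter> N) = n - 1"
    and hp: "(\<exists>U. rat (2 * n) U \<and> vdim U = n - 2 \<and> U \<subseteq> p \<inter> N) \<or> rat (2 * n) p \<or> rat (2 * n) N"
    and hq: "(\<exists>U. rat (2 * n) U \<and> vdim U = n - 2 \<and> U \<subseteq> q \<inter> N) \<or> rat (2 * n) q \<or> rat (2 * n) N"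
  shows "rat (2 * n) K \<or> rat (2 * n) N"
proof -
  have max: "p \<in> max_singular n" "q \<in> max_singular n"
    using pq(1) Sp_max Sm_max by (auto simp: same_class_def)
  have pqK: "p \<inter> q = K" by (rule same_class_Int[OF pq K])
  have eqK: "U = K" if "rat (2 * n) U" "vdim U = n - 2" "U \<subseteq> p" "U \<subseteq> q" for U
    using vdim_equal[OF rational_is_subspace[OF that(1)] K(1)] that K(2) pqK by auto
  \<comment> \<open>\<open>U\<close> contains a rational vector outside \<open>M\<close>, which
    transports rationality from \<open>M\<close> to its neighbour \<open>N\<close>.\<close>
  have mixed: "rat (2 * n) N" if m: "rat (2 * n) M" "M \<in> max_singular n" "vdim (M \<inter> N) = n - 1" "rat (2 * n) U" "U \<subseteq> N"
    "\<not> U \<subseteq> M" for M U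
  proof -
    obtain u where "u \<in> U" "rational_vec K0 (2 * n) u" "u \<notin> M"
      using rational_subset[OF m(4) max_singularD(3)[OF m(2)]] m(6) by blast
    then show ?thesis using rational_adjacent_max_singular[OF m(2) N(1) m(3) _ m(1)] m(5) n3 by auto
  qed
  from hp hq consider "rat (2 * n) N" | "rat (2 * n) p" "rat (2 * n) q"
    | U where "rat (2 * n) p" "rat (2 * n) U" "vdim U = n - 2" "U \<subseteq> q \<inter> N"
    | U where "rat (2 * n) q" "rat (2 * n) U" "vdim U = n - 2" "U \<subseteq> p \<inter> N"
    | U U' where "rat (2 * n) U" "vdim U = n - 2" "U \<subseteq> p \<inter> N" "rat (2 * n) U'" "vdim U' = n - 2" "U' \<subseteq> q \<inter> N"
    by blast
  then show ?thesis
  proof cases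
    case 2
    then show ?thesis using rational_Int pqK by metis
  next
    case (3 U)
    then show ?thesis using mixed[OF 3(1) max(1) N(2) 3(2)] eqK[OF 3(2,3)] by blast
  next
    case (4 U)
    then show ?thesis using mixed[OF 4(1) max(2) N(3) 4(2)] eqK[OF 4(2,3)] by blast
  next
    case (5 U U')
    show ?thesis
    proof (cases "U' \<subseteq> p")
      case True
      then show ?thesis using 5 eqK[OF 5(4,5)] by blast
    next
      case False
      \<comment> \<open>Two different subspaces of dimension \<open>n - 2\<close> span at least
        \<open>n - 1\<close> dimensions inside \<open>N\<close>, enough for
        \<open>rational_max_singular'\<close>.\<close>
      let ?T = "lspan (U \<union> U')"
      note sU = rational_is_subspace[OF 5(1)]
      have rT: "rat (2 * n) ?T" by (rule rational_Un[OF 5(1,4)])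
      have "U \<subseteq> ?T" "U' \<subseteq> ?T" using hull_subset[of "U \<union> U'" lsub] by auto
      then have "vdim U < vdim ?T"
        using False 5(3) by (intro vdim_less[OF sU rational_is_subspace[OF rT]]) auto
      moreover have "?T \<subseteq> N" unfolding lspan_subset_iff[OF max_singularD(3)[OF N(1)]] using 5 by auto
      ultimately have "rat (2 * n) N" using rational_max_singular'[OF rT _ _ N(1)] 5(2) n3 by auto
      then show ?thesis by simp
    qed
  qed simp
qed

lemma D_subspace_1PM:
  assumes n: "n \<ge> 4"
  shows "gr_subspace X {TDim 1, TPlus, TMinus} (Omega_D K0 n Sp Sm {TDim 1, TPlus, TMinus})"
proof (rule gr_subspaceI[OF D_type_separated])
  show "Omega_D K0 n Sp Sm {TDim 1, TPlus, TMinus} \<subseteq> gr_points X {TDim 1, TPlus, TMinus}"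
    by (auto simp: Omega_D_def nearly_rational_points_def)
next
  fix j L L0 p q r
  let ?J = "{TDim 1, TPlus, TMinus}"
  let ?S = "Omega_D K0 n Sp Sm ?J"
  assume j: "j \<in> ?J" and L: "L \<in> flags_of_type X (?J - {j} \<union> fr X j)"
    and L0: "L0 = {h \<in> L. etype X h \<in> ?J - {j}}"
    and p: "is_flag X (insert p L)" "etype X p = j" and q: "is_flag X (insert q L)" "etype X q = j"
    and r: "is_flag X (insert r L)" "etype X r = j" and "p \<noteq> q"
    and S: "insert p L0 \<in> ?S" "insert q L0 \<in> ?S"
  have el: "p \<in> elems X" "q \<in> elems X" "r \<in> elems X"
    using p(1) q(1) r(1) by (auto simp: is_flag_def simp del: D_simps)
  from j consider "j = TDim 1" | "j = TPlus" | "j = TMinus" by blast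
  then show "insert r L0 \<in> ?S"
  proof cases
    case 1
    have "?J - {TDim 1} \<union> fr X (TDim 1) = {TPlus, TMinus, TDim 2}" using D_fr(1)[OF n] by auto
    then have "L \<in> flags_of_type X {TPlus, TMinus, TDim 2}" using L 1 by metis
    then obtain M M' W where MW: "L = {M, M', W}" "M \<in> elems X" "M' \<in> elems X" "W \<in> elems X"
        "etype X M = TPlus" "etype X M' = TMinus" "etype X W = TDim 2" "inc X M M'"
      by (subst (asm) flags_of_type3[OF D_type_separated]) (auto simp del: D_simps)
    have M: "M \<in> Sp" "M' \<in> Sm" using type_TPlus[of M] type_TMinus[of M'] MW by blast+
    note sM = max_singularD[OF Sp_max[OF M(1)]] and sM' = max_singularD[OF Sm_max[OF M(2)]]
    have dI: "vdim (M \<inter> M') = n - 1" using inc_opposite(1)[OF M] MW(8) by blast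
    have W: "is_subspace (2 * n) W" "vdim W = 2"
      using type_TDim[of W 2] MW by (auto simp: tot_singular_def simp del: D_simps)
    have L0: "L0 = {M, M'}" unfolding L0 MW(1) 1 using MW(5-7) by (auto simp del: D_simps)
    have sub: "is_subspace (2 * n) x \<and> vdim x = 1 \<and> x \<subseteq> W \<and> x \<subseteq> M \<and> x \<subseteq> M'"
      if "is_flag X (insert x L)" "etype X x = j" for x
      using flag_point_in[OF that(1), of W] flag_point_in[OF that(1), of M] flag_point_in[OF that(1), of M']
        that(2) 1 MW W(2) sM(4) sM'(4) n
      by (auto simp del: D_simps)
    note p' = sub[OF p] and q' = sub[OF q] and r' = sub[OF r]
    have iff: "insert x L0 \<in> ?S \<longleftrightarrow>
        (\<exists>U. rat (2 * n) U \<and> x \<subseteq> U \<and> U \<subseteq> M \<inter> M') \<or> rat (2 * n) M \<or> rat (2 * n) M'"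
      if "is_subspace (2 * n) x \<and> vdim x = 1 \<and> x \<subseteq> W \<and> x \<subseteq> M \<and> x \<subseteq> M'" for x
      using Omega_1PM[of x M M'] that M dI by (simp add: L0)
    show ?thesis
    proof (cases "rat (2 * n) M \<or> rat (2 * n) M'")
      case True
      then show ?thesis using iff[OF r'] by blast
    next
      case False
      obtain U where U: "rat (2 * n) U" "p \<subseteq> U" "U \<subseteq> M \<inter> M'" using iff[OF p'] S(1) False by blast
      obtain U' where U': "rat (2 * n) U'" "q \<subseteq> U'" "U' \<subseteq> M \<inter> M'" using iff[OF q'] S(2) False by blast
      have "W = lspan (p \<union> q)" using plane_span[of "2 * n" p q W] p' q' W \<open>p \<noteq> q\<close> by auto
      also have "\<dots> \<subseteq> lspan (U \<union> U')" using U U' by (intro hull_mono) auto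
      finally have "r \<subseteq> lspan (U \<union> U')" using r' by auto
      moreover have "lspan (U \<union> U') \<subseteq> M \<inter> M'"
        unfolding lspan_subset_iff[OF lsub_Int[OF sM(3) sM'(3)]] using U U' by auto
      ultimately show ?thesis using iff[OF r'] rational_Un[OF U(1) U'(1)] by blast
    qed
  next
    case 2
    have "?J - {TPlus} \<union> fr X TPlus = {TDim 1, TMinus, TDim (n - 2)}" using D_fr(2)[OF n3] by auto
    then have "L \<in> flags_of_type X {TDim 1, TMinus, TDim (n - 2)}" using L 2 by metis
    moreover have "TDim 1 \<noteq> TDim (n - 2)" using n by simp
    ultimately obtain x N K where xK: "L = {x, N, K}" "x \<in> elems X" "N \<in> elems X" "K \<in> elems X"
        "etype X x = TDim 1" "etype X N = TMinus" "etype X K = TDim (n - 2)" "inc X x K" "inc X K N"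
      by (subst (asm) flags_of_type3[OF D_type_separated]) (auto simp del: D_simps)
    have x: "is_subspace (2 * n) x" "vdim x = 1"
      using type_TDim[of x 1] xK by (auto simp: tot_singular_def simp del: D_simps)
    have K: "tot_singular n K" "is_subspace (2 * n) K" "vdim K = n - 2"
      using type_TDim[of K "n - 2"] xK by (auto simp: tot_singular_def simp del: D_simps)
    have N: "N \<in> Sm" using type_TMinus[of N] xK by blast
    note sN = max_singularD[OF Sm_max[OF N]]
    have "x \<subseteq> K" using inc_small(1)[OF x(1) K(2)] x(2) K(3) n xK(8) by auto
    have "K \<subseteq> N" using inc_small(1)[OF K(2) sN(2)] sN(4) K(3) n xK(9) by auto
    have L0: "L0 = {x, N}" unfolding L0 xK(1) 2 using xK(5-7) n by (auto simp del: D_simps)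
    have sub: "y \<in> Sp \<and> K \<subseteq> y \<and> vdim (y \<inter> N) = n - 1"
      if "is_flag X (insert y L)" "etype X y = j" "y \<in> elems X" for y
    proof -
      have y: "y \<in> Sp" using type_TPlus[of y] that 2 by blast
      moreover have "K \<subseteq> y" using y flag_max_contains[OF that(1), of K] xK K by (auto simp del: D_simps)
      moreover have "inc X y N" using flag_insertD(2)[OF that(1), of N] that(2) xK 2 by (auto simp del: D_simps)
      ultimately show ?thesis using inc_opposite(1)[OF y N] by blast
    qed
    note p' = sub[OF p el(1)] and q' = sub[OF q el(2)] and r' = sub[OF r el(3)]
    have iff: "insert M L0 \<in> ?S \<longleftrightarrow>
        (\<exists>U. rat (2 * n) U \<and> x \<subseteq> U \<and> U \<subseteq> M \<inter> N) \<or> rat (2 * n) M \<or> rat (2 * n) N"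
      if "M \<in> Sp \<and> K \<subseteq> M \<and> vdim (M \<inter> N) = n - 1" for M
    proof -
      have eq: "insert M L0 = {x, M, N}" by (auto simp: L0)
      have "M \<in> Sp" "x \<subseteq> M" "x \<subseteq> N" "vdim (M \<inter> N) = n - 1" using that \<open>x \<subseteq> K\<close> \<open>K \<subseteq> N\<close> by blast+
      from Omega_1PM[OF x this(1) N this(2-4)] show ?thesis unfolding eq .
    qed
    have "same_class p q" using p' q' by (auto simp: same_class_def)
    from rational_between_pencil[OF this \<open>p \<noteq> q\<close> K(2,3) _ _ \<open>K \<subseteq> N\<close> \<open>x \<subseteq> K\<close>, of r]
    have "(\<exists>U. rat (2 * n) U \<and> x \<subseteq> U \<and> U \<subseteq> r \<inter> N) \<or> rat (2 * n) N"
      using p' q' r' iff[OF p'] iff[OF q'] S by simp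
    then show ?thesis using iff[OF r'] by blast
  next
    case 3
    have "?J - {TMinus} \<union> fr X TMinus = {TDim 1, TPlus, TDim (n - 2)}" using D_fr(3)[OF n3] by auto
    then have "L \<in> flags_of_type X {TDim 1, TPlus, TDim (n - 2)}" using L 3 by metis
    moreover have "TDim 1 \<noteq> TDim (n - 2)" using n by simp
    ultimately obtain x N K where xK: "L = {x, N, K}" "x \<in> elems X" "N \<in> elems X" "K \<in> elems X"
        "etype X x = TDim 1" "etype X N = TPlus" "etype X K = TDim (n - 2)" "inc X x K" "inc X K N"
      by (subst (asm) flags_of_type3[OF D_type_separated]) (auto simp del: D_simps)
    have x: "is_subspace (2 * n) x" "vdim x = 1"
      using type_TDim[of x 1] xK by (auto simp: tot_singular_def simp del: D_simps)
    have K: "tot_singular n K" "is_subspace (2 * n) K" "vdim K = n - 2"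
      using type_TDim[of K "n - 2"] xK by (auto simp: tot_singular_def simp del: D_simps)
    have N: "N \<in> Sp" using type_TPlus[of N] xK by blast
    note sN = max_singularD[OF Sp_max[OF N]]
    have "x \<subseteq> K" using inc_small(1)[OF x(1) K(2)] x(2) K(3) n xK(8) by auto
    have "K \<subseteq> N" using inc_small(1)[OF K(2) sN(2)] sN(4) K(3) n xK(9) by auto
    have L0: "L0 = {x, N}" unfolding L0 xK(1) 3 using xK(5-7) n by (auto simp del: D_simps)
    have sub: "y \<in> Sm \<and> K \<subseteq> y \<and> vdim (N \<inter> y) = n - 1"
      if "is_flag X (insert y L)" "etype X y = j" "y \<in> elems X" for y
    proof -
      have y: "y \<in> Sm" using type_TMinus[of y] that 3 by blast
      moreover have "K \<subseteq> y" using y flag_max_contains[OF that(1), of K] xK K by (auto simp del: D_simps)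
      moreover have "inc X y N" using flag_insertD(2)[OF that(1), of N] that(2) xK 3 by (auto simp del: D_simps)
      ultimately show ?thesis using inc_opposite(2)[OF N y] by blast
    qed
    note p' = sub[OF p el(1)] and q' = sub[OF q el(2)] and r' = sub[OF r el(3)]
    have iff: "insert M L0 \<in> ?S \<longleftrightarrow>
        (\<exists>U. rat (2 * n) U \<and> x \<subseteq> U \<and> U \<subseteq> M \<inter> N) \<or> rat (2 * n) M \<or> rat (2 * n) N"
      if "M \<in> Sm \<and> K \<subseteq> M \<and> vdim (N \<inter> M) = n - 1" for M
    proof -
      have eq: "insert M L0 = {x, N, M}" by (auto simp: L0)
      have "M \<in> Sm" "x \<subseteq> N" "x \<subseteq> M" "vdim (N \<inter> M) = n - 1" using that \<open>x \<subseteq> K\<close> \<open>K \<subseteq> N\<close> by blast+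
      from Omega_1PM[OF x N this] show ?thesis unfolding eq by (simp only: Int_commute disj_commute)
    qed
    have "same_class p q" using p' q' by (auto simp: same_class_def)
    from rational_between_pencil[OF this \<open>p \<noteq> q\<close> K(2,3) _ _ \<open>K \<subseteq> N\<close> \<open>x \<subseteq> K\<close>, of r]
    have "(\<exists>U. rat (2 * n) U \<and> x \<subseteq> U \<and> U \<subseteq> r \<inter> N) \<or> rat (2 * n) N"
      using p' q' r' iff[OF p'] iff[OF q'] S by simp
    then show ?thesis using iff[OF r'] by blast
  qed
qed

lemma D_subspace_PM: "gr_subspace X {TPlus, TMinus} (Omega_D K0 n Sp Sm {TPlus, TMinus})"
proof (rule gr_subspaceI[OF D_type_separated])
  show "Omega_D K0 n Sp Sm {TPlus, TMinus} \<subseteq> gr_points X {TPlus, TMinus}"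
    by (auto simp: Omega_D_def nearly_rational_points_def)
next
  fix j L L0 p q r
  let ?J = "{TPlus, TMinus}"
  let ?S = "Omega_D K0 n Sp Sm ?J"
  assume j: "j \<in> ?J" and L: "L \<in> flags_of_type X (?J - {j} \<union> fr X j)"
    and L0: "L0 = {h \<in> L. etype X h \<in> ?J - {j}}"
    and p: "is_flag X (insert p L)" "etype X p = j" and q: "is_flag X (insert q L)" "etype X q = j"
    and r: "is_flag X (insert r L)" "etype X r = j" and "p \<noteq> q"
    and S: "insert p L0 \<in> ?S" "insert q L0 \<in> ?S"
  have el: "p \<in> elems X" "q \<in> elems X" "r \<in> elems X"
    using p(1) q(1) r(1) by (auto simp: is_flag_def simp del: D_simps)
  from j consider "j = TPlus" | "j = TMinus" by blast
  then show "insert r L0 \<in> ?S"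
  proof cases
    case 1
    have "?J - {TPlus} \<union> fr X TPlus = {TMinus, TDim (n - 2)}" using D_fr(2)[OF n3] by auto
    then have "L \<in> flags_of_type X {TMinus, TDim (n - 2)}" using L 1 by metis
    then obtain N K where NK: "L = {N, K}" "N \<in> elems X" "K \<in> elems X"
        "etype X N = TMinus" "etype X K = TDim (n - 2)" "inc X K N"
      by (subst (asm) flags_of_type2[OF D_type_separated]) (auto simp del: D_simps)
    have K: "tot_singular n K" "is_subspace (2 * n) K" "vdim K = n - 2"
      using type_TDim[of K "n - 2"] NK by (auto simp: tot_singular_def simp del: D_simps)
    have N: "N \<in> Sm" using type_TMinus[of N] NK by blast
    note sN = max_singularD[OF Sm_max[OF N]]
    have "K \<subseteq> N" using inc_small(1)[OF K(2) sN(2)] sN(4) K(3) n3 NK(6) by auto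
    have L0: "L0 = {N}" unfolding L0 NK(1) 1 using NK(4,5) by (auto simp del: D_simps)
    have sub: "y \<in> Sp \<and> K \<subseteq> y \<and> vdim (y \<inter> N) = n - 1"
      if "is_flag X (insert y L)" "etype X y = j" "y \<in> elems X" for y
    proof -
      have y: "y \<in> Sp" using type_TPlus[of y] that 1 by blast
      moreover have "K \<subseteq> y" using y flag_max_contains[OF that(1), of K] NK K by (auto simp del: D_simps)
      moreover have "inc X y N" using flag_insertD(2)[OF that(1), of N] that(2) NK 1 by (auto simp del: D_simps)
      ultimately show ?thesis using inc_opposite(1)[OF y N] by blast
    qed
    note p' = sub[OF p el(1)] and q' = sub[OF q el(2)] and r' = sub[OF r el(3)]
    have iff: "insert M L0 \<in> ?S \<longleftrightarrow>
        (\<exists>U. rat (2 * n) U \<and> vdim U = n - 2 \<and> U \<subseteq> M \<inter> N) \<or> rat (2 * n) M \<or> rat (2 * n) N"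
      if "M \<in> Sp \<and> K \<subseteq> M \<and> vdim (M \<inter> N) = n - 1" for M
      using Omega_PM[of M N] that N by (simp add: L0)
    have "same_class p q" using p' q' by (auto simp: same_class_def)
    from rational_pencil[OF this \<open>p \<noteq> q\<close> K(2,3) _ _ Sm_max[OF N]]
    have "rat (2 * n) K \<or> rat (2 * n) N"
      using p' q' iff[OF p'] iff[OF q'] S by simp
    \<comment> \<open>If \<open>K\<close> is rational, it is a subspace of dimension
      \<open>n - 2\<close> in \<open>r \<inter> N\<close>; if \<open>N\<close> is, it belongs to
      every point of the line.\<close>
    then show ?thesis using iff[OF r'] r' K(3) \<open>K \<subseteq> N\<close> by blast
  next
    case 2
    have "?J - {TMinus} \<union> fr X TMinus = {TPlus, TDim (n - 2)}" using D_fr(3)[OF n3] by auto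
    then have "L \<in> flags_of_type X {TPlus, TDim (n - 2)}" using L 2 by metis
    then obtain N K where NK: "L = {N, K}" "N \<in> elems X" "K \<in> elems X"
        "etype X N = TPlus" "etype X K = TDim (n - 2)" "inc X K N"
      by (subst (asm) flags_of_type2[OF D_type_separated]) (auto simp del: D_simps)
    have K: "tot_singular n K" "is_subspace (2 * n) K" "vdim K = n - 2"
      using type_TDim[of K "n - 2"] NK by (auto simp: tot_singular_def simp del: D_simps)
    have N: "N \<in> Sp" using type_TPlus[of N] NK by blast
    note sN = max_singularD[OF Sp_max[OF N]]
    have "K \<subseteq> N" using inc_small(1)[OF K(2) sN(2)] sN(4) K(3) n3 NK(6) by auto
    have L0: "L0 = {N}" unfolding L0 NK(1) 2 using NK(4,5) by (auto simp del: D_simps)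
    have sub: "y \<in> Sm \<and> K \<subseteq> y \<and> vdim (y \<inter> N) = n - 1"
      if "is_flag X (insert y L)" "etype X y = j" "y \<in> elems X" for y
    proof -
      have y: "y \<in> Sm" using type_TMinus[of y] that 2 by blast
      moreover have "K \<subseteq> y" using y flag_max_contains[OF that(1), of K] NK K by (auto simp del: D_simps)
      moreover have "inc X y N" using flag_insertD(2)[OF that(1), of N] that(2) NK 2 by (auto simp del: D_simps)
      ultimately show ?thesis using inc_opposite(2)[OF N y] by (simp add: Int_commute)
    qed
    note p' = sub[OF p el(1)] and q' = sub[OF q el(2)] and r' = sub[OF r el(3)]
    have iff: "insert M L0 \<in> ?S \<longleftrightarrow>
        (\<exists>U. rat (2 * n) U \<and> vdim U = n - 2 \<and> U \<subseteq> M \<inter> N) \<or> rat (2 * n) M \<or> rat (2 * n) N"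
      if "M \<in> Sm \<and> K \<subseteq> M \<and> vdim (M \<inter> N) = n - 1" for M
    proof -
      have eq: "insert M L0 = {N, M}" by (auto simp: L0)
      from Omega_PM[OF N, of M] that show ?thesis unfolding eq by (simp only: Int_commute disj_commute)
    qed
    have "same_class p q" using p' q' by (auto simp: same_class_def)
    from rational_pencil[OF this \<open>p \<noteq> q\<close> K(2,3) _ _ Sp_max[OF N]]
    have "rat (2 * n) K \<or> rat (2 * n) N"
      using p' q' iff[OF p'] iff[OF q'] S by (simp add: Int_commute)
    then show ?thesis using iff[OF r'] r' K(3) \<open>K \<subseteq> N\<close> by blast
  qed
qed

text \<open>
  For \<open>a\<close> outside \<open>K0\<close> a rational vector in \<open>twisted a c\<close> has vanishing coordinates 1 and 4; the two
  choices of \<open>c\<close> give adjacent maximal totally singular subspaces, one in each class. The vector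
  \<open>unit_vec (11 - c)\<close> imposes \<open>x c = 0\<close>, since the form pairs coordinates 5 and 6.
\<close>

definition twisted :: "'k \<Rightarrow> nat \<Rightarrow> 'k vec set" where
  "twisted a c = perp n ({unit_vec 1 + unit_vec 3 \<star> a, unit_vec 4 - unit_vec 2 \<star> a, unit_vec (11 - c)} \<union>
     (\<lambda>i. unit_vec (2 * i - 1)) ` {4..n})"

lemma twisted_iff:
  assumes "c \<in> {5, 6}"
  shows "x \<in> twisted a c \<longleftrightarrow> x \<in> vecs (2 * n) \<and> x 2 = - (x 4 * a) \<and> x 3 = x 1 * a \<and> x c = 0 \<and>
    (\<forall>i\<in>{4..n}. x (2 * i) = 0)"
proof -
  have b: "bil n (unit_vec 1) x = x 2" "bil n (unit_vec 2) x = x 1" "bil n (unit_vec 3) x = x 4"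
    "bil n (unit_vec 4) x = x 3" "bil n (unit_vec 5) x = x 6" "bil n (unit_vec 6) x = x 5"
    using bil_unit_vec[of 1 n x] bil_unit_vec[of 2 n x] bil_unit_vec[of 3 n x] n3 by simp_all
  have "bil n (unit_vec (11 - c)) x = x c" using assms b by auto
  moreover have "bil n (unit_vec 1 + unit_vec 3 \<star> a) x = x 2 + x 4 * a"
    by (simp only: bil_linear bil_scl_left b)
  moreover have "bil n (unit_vec 4 - unit_vec 2 \<star> a) x = x 3 - x 1 * a"
  proof -
    have "(unit_vec 4 - unit_vec 2 \<star> a :: 'k vec) = unit_vec 4 + unit_vec 2 \<star> (- a)" by (simp add: fun_eq_iff)
    then show ?thesis by (simp only: bil_linear bil_scl_left b) simp
  qed
  moreover have "bil n (unit_vec (2 * i - 1)) x = x (2 * i)" if "i \<in> {4..n}" for i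
    using bil_unit_vec(1)[of i n x] that by simp
  ultimately show ?thesis
    by (auto simp: twisted_def perp_def eq_neg_iff_add_eq_0)
qed

lemma is_subspace_twisted: "is_subspace (2 * n) (twisted a c)"
  by (simp add: twisted_def)

text \<open>On the first two pairs the form is \<open>x 1 * x 2 + x 3 * x 4\<close>, whose terms
  cancel by commutativity; each further pair has a vanishing coordinate. There are
  \<open>3 + (n - 3) = n\<close> defining conditions, so the dimension is at least
  \<open>n\<close>.\<close>

lemma twisted_max:
  assumes c: "c \<in> {5, 6}"
  shows "twisted a c \<in> max_singular n"
proof -
  have "quad n x = 0" if "x \<in> twisted a c" for x
  proof -
    note x = that[unfolded twisted_iff[OF c]]
    let ?f = "\<lambda>i. x (2 * i - 1) * x (2 * i)"
    have "?f i = 0" if i: "i \<in> {1..n} - {1, 2}" for i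
    proof (cases "i = 3")
      case True
      then show ?thesis using x c by auto
    next
      case False
      then have "i \<in> {4..n}" using i by auto
      then show ?thesis using x by auto
    qed
    then have "quad n x = sum ?f {1, 2}"
      unfolding quad_def using n3 by (intro sum.mono_neutral_right) auto
    also have "\<dots> = x 1 * x 2 + x 3 * x 4" by simp
    also have "\<dots> = - (x 1 * (x 4 * a)) + x 1 * a * x 4" using x by simp
    also have "\<dots> = 0" by (simp add: mult.assoc comm[of a])
    finally show ?thesis .
  qed
  then have ts: "tot_singular n (twisted a c)" by (simp add: tot_singular_def is_subspace_twisted)
  let ?T = "{unit_vec 1 + unit_vec 3 \<star> a, unit_vec 4 - unit_vec 2 \<star> a, unit_vec (11 - c)} \<union>
     (\<lambda>i. unit_vec (2 * i - 1)) ` {4..n}"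
  have "card ?T \<le> card {unit_vec 1 + unit_vec 3 \<star> a, unit_vec 4 - unit_vec 2 \<star> a, unit_vec (11 - c) :: 'k vec} +
      card ((\<lambda>i. unit_vec (2 * i - 1) :: 'k vec) ` {4..n})" by (rule card_Un_le)
  also have "\<dots> \<le> 3 + card {4..n}"
    by (intro add_mono card_image_le) (simp_all add: card_insert_le_m1)
  finally have "card ?T \<le> n" using n3 by simp
  moreover have "vdim (vecs (2 * n) :: 'k vec set) \<le> vdim (vecs (2 * n) \<inter> perp n ?T) + card ?T"
    by (rule vdim_Int_perp) auto
  moreover have "vecs (2 * n) \<inter> perp n ?T = twisted a c" using perp_subset_vecs by (auto simp: twisted_def)
  ultimately have "n \<le> vdim (twisted a c)" by simp
  then show ?thesis using tot_singular_vdim[OF ts] ts by (simp add: max_singular_def)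
qed

text \<open>A nonzero \<open>x 1\<close> or \<open>x 4\<close> in a rational vector would express
  \<open>a\<close> as a quotient of elements of \<open>K0\<close>.\<close>

lemma twisted_rational:
  assumes "a \<notin> K0" "c \<in> {5, 6}" "rat (2 * n) U" "U \<subseteq> twisted a c"
  shows "U \<subseteq> {x. x 1 = 0 \<and> x 4 = 0}"
proof (rule rational_subset[OF assms(3)])
  fix x assume x: "x \<in> U" "rational_vec K0 (2 * n) x"
  have K: "x i \<in> K0" for i using x(2) by (simp add: rational_vec_iff)
  have t: "x 2 = - (x 4 * a)" "x 3 = x 1 * a" using x(1) assms(4) twisted_iff[OF assms(2)] by auto
  have zero: "u = 0" if "u \<in> K0" "v \<in> K0" "v = u * a" for u v
  proof (rule ccontr)
    assume "u \<noteq> 0"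
    then have "a = inverse u * v" using that(3) by (simp flip: mult.assoc)
    moreover have "inverse u * v \<in> K0" by (intro K0_mult K0_inverse that)
    ultimately show False using assms(1) by metis
  qed
  have "x 1 = 0" using zero[OF K[of 1] K[of 3] t(2)] .
  moreover have "- x 2 = x 4 * a" using t(1) by simp
  then have "x 4 = 0" by (rule zero[OF K[of 4] K0_uminus[OF K[of 2]]])
  ultimately show "x \<in> {x. x 1 = 0 \<and> x 4 = 0}" by simp
qed (auto simp: lsub_def)

text \<open>The intersection is cut out of \<open>twisted a 5\<close> by the single equation
  \<open>x 6 = 0\<close>, and this cut is proper because of \<open>unit_vec 6\<close>.\<close>

lemma twisted_Int: "vdim (twisted a 5 \<inter> twisted a 6) = n - 1"
proof -
  have s: "is_subspace (2 * n) (twisted a 5 \<inter> twisted a 6)"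
    using is_subspace_Int is_subspace_twisted by blast
  have "vdim (twisted a 5) \<le> vdim {x \<in> twisted a 5. x 6 = 0} + 1"
    by (rule vdim_kernel[OF is_subspace_twisted]) simp_all
  also have "{x \<in> twisted a 5. x 6 = 0} = twisted a 5 \<inter> twisted a 6"
    using twisted_iff[of 5] twisted_iff[of 6] by auto
  finally have "n \<le> vdim (twisted a 5 \<inter> twisted a 6) + 1"
    using max_singularD(4)[OF twisted_max[of 5 a]] by simp
  moreover have "unit_vec 6 \<in> twisted a 5" "unit_vec 6 \<notin> twisted a 6"
    using n3 by (auto simp: twisted_iff vecs_def unit_vec_def)
  then have "twisted a 5 \<inter> twisted a 6 \<subset> twisted a 5" by blast
  then have "vdim (twisted a 5 \<inter> twisted a 6) < n"
    using vdim_less[OF s is_subspace_twisted, of a 5] max_singularD(4)[OF twisted_max[of 5 a]] by simp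
  ultimately show ?thesis by linarith
qed

lemma twisted_vecs:
  assumes "c \<in> {5, 6}"
  shows "unit_vec 1 + unit_vec 3 \<star> a \<in> twisted a c" "unit_vec 4 - unit_vec 2 \<star> a \<in> twisted a c"
  using assms n3 by (auto simp: twisted_iff vecs_def unit_vec_def)

text \<open>One flag serves all three geometries: the first condition on \<open>U\<close> refutes
  sandwiched rational subspaces and the rationality of \<open>M\<close> and \<open>M'\<close>, the
  second the witnesses of dimension \<open>n - 2\<close>.\<close>

lemma nonrational_witness:
  assumes "a \<notin> K0"
  obtains p M M' where "is_subspace (2 * n) p" "vdim p = 1" "M \<in> Sp" "M' \<in> Sm" "p \<subseteq> M" "p \<subseteq> M'"
    "vdim (M \<inter> M') = n - 1"
    "\<And>U. rat (2 * n) U \<Longrightarrow> U \<subseteq> M \<or> U \<subseteq> M' \<Longrightarrow> \<not> p \<subseteq> U"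
    "\<And>U. rat (2 * n) U \<Longrightarrow> U \<subseteq> M \<inter> M' \<Longrightarrow> vdim U \<noteq> n - 2"
proof -
  let ?v = "unit_vec 1 + unit_vec 3 \<star> a" and ?w = "unit_vec 4 - unit_vec 2 \<star> a"
  let ?A = "twisted a 5" and ?B = "twisted a 6"
  define p where "p = lspan {?v}"
  have vv: "?v \<in> vecs (2 * n)" "?w \<in> vecs (2 * n)" using twisted_vecs[of 5 a] twisted_iff[of 5 _ a] by auto
  have v1: "?v 1 = 1" by (simp add: unit_vec_def)
  then have "?v \<noteq> 0" by (metis zero_fun_apply zero_neq_one)
  then have p: "is_subspace (2 * n) p" "vdim p = 1"
    using vdim_line[OF vv(1)] is_subspace_lspan[of "{?v}" "2 * n"] vv(1) unfolding p_def by auto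
  have "lsub (twisted a c)" for c by (rule is_subspaceD(1)[OF is_subspace_twisted])
  then have pAB: "p \<subseteq> ?A" "p \<subseteq> ?B" using twisted_vecs(1) by (simp_all add: p_def lspan_subset_iff)
  have vp: "?v \<in> p" by (simp add: p_def lspan_inc)
  have noU: "\<not> p \<subseteq> U" if "rat (2 * n) U" "U \<subseteq> ?A \<or> U \<subseteq> ?B" for U
    using that twisted_rational[OF assms _ that(1), of 5] twisted_rational[OF assms _ that(1), of 6] v1 vp
    by (metis (mono_tags, lifting) insertCI mem_Collect_eq subsetD zero_neq_one)
  \<comment> \<open>Rational subspaces of the intersection vanish on coordinates 1 and 4, where
    \<open>?v\<close> and \<open>?w\<close> have entries 1, 0 and 0, 1. The two vectors are thus
    independent modulo \<open>U\<close>, and \<open>vdim U + 2 \<le> n - 1\<close>.\<close>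
  have dimU: "vdim U \<noteq> n - 2" if U: "rat (2 * n) U" "U \<subseteq> ?A \<inter> ?B" for U
  proof -
    note sU = rational_is_subspace[OF U(1)]
    have U14: "x 1 = 0" "x 4 = 0" if "x \<in> U" for x
      using twisted_rational[OF assms _ U(1), of 5] U(2) that by auto
    have vU: "?v \<notin> U" using U14(1)[of ?v] v1 by (metis zero_neq_one)
    let ?T = "lspan (insert ?v U)"
    have sT: "is_subspace (2 * n) ?T" using vv(1) is_subspaceD(2)[OF sU] by (intro is_subspace_lspan) auto
    have wT: "?w \<notin> ?T"
    proof
      assume "?w \<in> ?T"
      then obtain b where "?w - ?v \<star> b \<in> U"
        unfolding lspan_insert_iff lspan_lsub[OF is_subspaceD(1)[OF sU]] by blast
      then have "(?w - ?v \<star> b) 4 = 0" by (rule U14(2))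
      then show False by (simp add: unit_vec_def)
    qed
    have "vdim (lspan (insert ?w ?T)) = vdim U + 2"
      using vdim_insert[OF sU vv(1) vU] vdim_insert[OF sT vv(2) wT] by simp
    moreover have sI: "is_subspace (2 * n) (?A \<inter> ?B)" using is_subspace_Int is_subspace_twisted by blast
    have TI: "?T \<subseteq> ?A \<inter> ?B"
      unfolding lspan_subset_iff[OF is_subspaceD(1)[OF sI]] using U(2) twisted_vecs(1) by auto
    have "lspan (insert ?w ?T) \<subseteq> ?A \<inter> ?B"
      unfolding lspan_subset_iff[OF is_subspaceD(1)[OF sI]] using TI twisted_vecs(2) by auto
    moreover have "is_subspace (2 * n) (lspan (insert ?w ?T))"
      using vv(2) is_subspaceD(2)[OF sT] by (intro is_subspace_lspan) auto
    ultimately have "vdim U + 2 \<le> n - 1" using vdim_mono sI twisted_Int by metis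
    then show ?thesis using n3 by linarith
  qed
  have max: "?A \<in> max_singular n" "?B \<in> max_singular n" using twisted_max by auto
  \<comment> \<open>Odd codimension puts the two subspaces into different classes; which one is in
    \<open>Sp\<close> depends on the labelling, so both cases are treated.\<close>
  have "vdim ?A - vdim (?A \<inter> ?B) = 1" using max_singularD(4)[OF max(1)] twisted_Int n3 by simp
  then have "\<not> (?A \<in> Sp \<longleftrightarrow> ?B \<in> Sp)" using classes max unfolding singular_classes_def by (metis odd_one)
  then consider "?A \<in> Sp" "?B \<in> Sm" | "?B \<in> Sp" "?A \<in> Sm" using Sp_Sm(1) max by blast
  then show ?thesis
  proof cases
    case 1
    show ?thesis using that[OF p 1 pAB twisted_Int] noU dimU by blast
  next
    case 2
    show ?thesis using that[OF p 2 pAB(2,1)] twisted_Int noU dimU by (metis Int_commute)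
  qed
qed

lemma D_proper:
  assumes "a \<notin> K0"
  shows "n \<ge> 4 \<Longrightarrow> Omega_D K0 n Sp Sm {TDim 1, TMinus} \<noteq> gr_points X {TDim 1, TMinus}"
    and "Omega_D K0 n Sp Sm {TDim 1, TPlus, TMinus} \<noteq> gr_points X {TDim 1, TPlus, TMinus}"
    and "Omega_D K0 n Sp Sm {TPlus, TMinus} \<noteq> gr_points X {TPlus, TMinus}"
proof -
  obtain p M M' where p: "is_subspace (2 * n) p" "vdim p = 1" and M: "M \<in> Sp" "M' \<in> Sm" and sub: "p \<subseteq> M" "p \<subseteq> M'"
    and I: "vdim (M \<inter> M') = n - 1"
    and noU: "\<And>U. rat (2 * n) U \<Longrightarrow> U \<subseteq> M \<or> U \<subseteq> M' \<Longrightarrow> \<not> p \<subseteq> U"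
    and dimU: "\<And>U. rat (2 * n) U \<Longrightarrow> U \<subseteq> M \<inter> M' \<Longrightarrow> vdim U \<noteq> n - 2"
    using nonrational_witness[OF assms] by metis
  have nM: "\<not> rat (2 * n) M" "\<not> rat (2 * n) M'" using noU sub by blast+
  show "Omega_D K0 n Sp Sm {TDim 1, TMinus} \<noteq> gr_points X {TDim 1, TMinus}" if "n \<ge> 4"
  proof -
    have "{p, M'} \<notin> Omega_D K0 n Sp Sm {TDim 1, TMinus}"
      unfolding Omega_1M[OF that p M(2) sub(2)] using noU by blast
    moreover have "{p, M'} \<in> gr_points X {TDim 1, TMinus}" using points_1M p M(2) sub(2) by blast
    ultimately show ?thesis by blast
  qed
  have "{p, M, M'} \<notin> Omega_D K0 n Sp Sm {TDim 1, TPlus, TMinus}"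
    unfolding Omega_1PM[OF p M sub I] using noU nM by blast
  moreover have "{p, M, M'} \<in> gr_points X {TDim 1, TPlus, TMinus}" using points_1PM p M sub I by blast
  ultimately show "Omega_D K0 n Sp Sm {TDim 1, TPlus, TMinus} \<noteq> gr_points X {TDim 1, TPlus, TMinus}" by blast
  have "{M, M'} \<notin> Omega_D K0 n Sp Sm {TPlus, TMinus}"
    unfolding Omega_PM[OF M I] using dimU nM by blast
  moreover have "{M, M'} \<in> gr_points X {TPlus, TMinus}" using points_PM M I by blast
  ultimately show "Omega_D K0 n Sp Sm {TPlus, TMinus} \<noteq> gr_points X {TPlus, TMinus}" by blast
qed

lemma D_proper_gr_subspace:
  assumes "a \<notin> K0"
  shows "n \<ge> 4 \<Longrightarrow> proper_gr_subspace X {TDim 1, TMinus} (Omega_D K0 n Sp Sm {TDim 1, TMinus})"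
    and "n \<ge> 4 \<Longrightarrow> proper_gr_subspace X {TDim 1, TPlus, TMinus} (Omega_D K0 n Sp Sm {TDim 1, TPlus, TMinus})"
    and "proper_gr_subspace X {TPlus, TMinus} (Omega_D K0 n Sp Sm {TPlus, TMinus})"
  unfolding proper_gr_subspace_def
  using D_subspace_1M D_subspace_1PM D_subspace_PM D_proper[OF assms] by blast+

end

theorem theorem3p3:
  fixes K0 :: "'k::division_ring set" and n :: nat
  assumes "sub_division_ring K0" and "K0 \<noteq> UNIV"
  shows
    "(n \<ge> 3 \<longrightarrow> proper_gr_subspace (A_building n) {1, n} (Omega_A K0 n {1, n})) \<and>
     ((\<forall>x y :: 'k. x * y = y * x) \<longrightarrow>
       (\<forall>Sp Sm :: 'k vec set set. singular_classes n Sp Sm \<longrightarrow>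
         (n \<ge> 4 \<longrightarrow>
            proper_gr_subspace (D_building n Sp Sm) {TDim 1, TMinus}
              (Omega_D K0 n Sp Sm {TDim 1, TMinus})) \<and>
         (n \<ge> 4 \<longrightarrow>
            proper_gr_subspace (D_building n Sp Sm) {TDim 1, TPlus, TMinus}
              (Omega_D K0 n Sp Sm {TDim 1, TPlus, TMinus})) \<and>
         (n \<ge> 3 \<longrightarrow>
            proper_gr_subspace (D_building n Sp Sm) {TPlus, TMinus}
              (Omega_D K0 n Sp Sm {TPlus, TMinus}))))"
proof -
  obtain a where a: "a \<notin> K0" using assms(2) by blast
  have K0: "division_subring K0" using assms(1) by (rule division_subring.intro)
  have D: "D_geometry K0 n Sp Sm" if "\<forall>x y :: 'k. x * y = y * x" "singular_classes n Sp Sm" "n \<ge> 3" for Sp Sm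
    using that K0
    by (simp add: D_geometry_def D_geometry_axioms_def comm_division_subring_def comm_division_subring_axioms_def)
  have "n \<ge> 4 \<Longrightarrow> n \<ge> 3" by simp
  then show ?thesis
    using division_subring.A_proper_gr_subspace[OF K0 a] D_geometry.D_proper_gr_subspace[OF D a] by blast
qed

end
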